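(* Let $\theta^\star=(\mu^\star,p^\star,(\sigma^\star)^2)\in\Theta=\mathbb{R}^d\times(0,1)\times(0,+\infty)$ be such that the Fisher information matrix $\mathrm{I}(\theta^\star)$ is non-singular, and let $(y_n,h_n)$, $n\ge 1$, be i.i.d. with density $f_{Y,H}(\cdot,\cdot|\theta^\star)$. Then there exist $\delta>0$ and a norm $\|\cdot\|$ on $\mathbb{R}^{d+2}$, with $\bar{B}^{\|\cdot\|}_{\delta,\theta^\star}\subseteq\Theta$, such that, as $N\to\infty$, $$\mathbb{P}_{\theta^\star}\Big(\sup_{\theta\in\bar{B}^{\|\cdot\|}_{\delta,\theta^\star}}\big\|T_N(\theta)-\theta^\star\big\|\leq\delta\Big)\to 1\quad\text{and}\quad \mathbb{P}_{\theta^\star}\Big(\sup_{\theta\in\bar{B}^{\|\cdot\|}_{\delta,\theta^\star}}\big\|T_N^\prime(\theta)\big\|<1\Big)\to 1,$$ where $\|T_N^\prime(\theta)\|$ is the matrix norm induced by $\|\cdot\|$.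
   Context: Notation: $\mathcal{N}(\cdot|\mu,\sigma^2)$ is the Gaussian density with mean $\mu$ and variance $\sigma^2$ (covariance, in the vector case). A generic parameter is $\theta=(\mu,p,\sigma^2)\in\Theta=\mathbb{R}^d\times(0,1)\times(0,+\infty)\subset\mathbb{R}^{d+2}$; the last coordinate is the variable $\sigma^2$ itself (derivatives are taken with respect to $\sigma^2$). $\bar{B}^{\|\cdot\|}_{\delta,\theta^\star}$ is the closed ball of center $\theta^\star$ and radius $\delta$ with respect to $\|\cdot\|$. Model: for $y\in\mathbb{R}$, $h\in\mathbb{R}^d$, $$f_{Y,H}(y,h|\theta)=\mathcal{N}(h|0,I_d)\Big(p\,\mathcal{N}(y|h^T\mu,\sigma^2)+(1-p)\,\mathcal{N}(y|0,\sigma^2)\Big).$$ $\phi(y,h,\theta)=\log f_{Y,H}(y,h|\theta)$ is the log-likelihood; $\nabla_\theta\phi$ and $\nabla_\theta^2\phi$ are its gradient and Hessian in $\theta$. $\mathbb{P}_{\theta^\star}$, $\mathbb{E}_{\theta^\star}$ denote probability and expectation when $(y,h)$ (respectively the i.i.d. sample $(y_n,h_n)$) has density $f_{Y,H}(\cdot,\cdot|\theta^\star)$. The Fisher information is $\mathrm{I}(\theta^\star)=\mathbb{E}_{\theta^\star}\big[\nabla_\theta\phi(y,h,\theta^\star)(\nabla_\theta\phi(y,h,\theta^\star))^T\big]$. Responsibility function: $$r(y,h,\theta)=\frac{p\,\mathcal{N}(y|h^T\mu,\sigma^2)}{p\,\mathcal{N}(y|h^T\mu,\sigma^2)+(1-p)\,\mathcal{N}(y|0,\sigma^2)},\qquad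 \Gamma(y,h,\theta)=r(y,h,\theta)hh^T.$$ Define the block-diagonal $(d+2)\times(d+2)$ matrix $$A_N(\theta)=\mathrm{diag}\Big(\tfrac1N\sum_{n=1}^N\tfrac{1}{\sigma^2}\Gamma(y_n,h_n,\theta),\ \tfrac{1}{p(1-p)},\ \tfrac{1}{2(\sigma^2)^2}\Big)$$ and $$T_N(\theta)=\theta+\big(A_N(\theta)\big)^{-1}\frac1N\sum_{n=1}^N\nabla_\theta\phi(y_n,h_n,\theta),\qquad T_N^\prime(\theta)=I_{d+2}+\big(A_N(\theta)\big)^{-1}\frac1N\sum_{n=1}^N\nabla^2_\theta\phi(y_n,h_n,\theta).$$ The matrix $\frac1N\sum_{n=1}^N\Gamma(y_n,h_n,\theta)$ is assumed invertible throughout (for $N>d$ this holds with probability one). *)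

theory Defs
  imports "HOL-Probability.Probability"
begin

(* A parameter (mu, p, sigma^2) is a vector indexed by 'd + 2: the components Inl i form mu,
   Inr 1 is p and Inr 2 is the variance sigma^2 (1 and 2 are the two elements of the type 2). *)

type_synonym 'd param = "real ^ ('d + 2)"
type_synonym 'd obs = "real \<times> (real ^ 'd)"

definition mean_of :: "'d::finite param \<Rightarrow> real ^ 'd" where
  "mean_of \<theta> = (\<chi> i. \<theta> $ Inl i)"

definition prob_of :: "'d::finite param \<Rightarrow> real" where
  "prob_of \<theta> = \<theta> $ Inr 1"

definition var_of :: "'d::finite param \<Rightarrow> real" where
  "var_of \<theta> = \<theta> $ Inr 2"

definition param_space :: "'d::finite param set" where
  "param_space = {\<theta>. 0 < prob_of \<theta> \<and> prob_of \<theta> < 1 \<and> 0 < var_of \<theta>}"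

(* The library's normal_density takes the standard deviation, here the parameter is the variance. *)
definition gauss :: "real \<Rightarrow> real \<Rightarrow> real \<Rightarrow> real" where
  "gauss m v y = normal_density m (sqrt v) y"

definition std_gauss_vec :: "real ^ 'd::finite \<Rightarrow> real" where
  "std_gauss_vec h = 1 / sqrt ((2 * pi) ^ CARD('d)) * exp (- (h \<bullet> h) / 2)"

definition mix_density :: "'d::finite param \<Rightarrow> 'd obs \<Rightarrow> real" where
  "mix_density \<theta> = (\<lambda>(y, h). std_gauss_vec h *
     (prob_of \<theta> * gauss (h \<bullet> mean_of \<theta>) (var_of \<theta>) y +
      (1 - prob_of \<theta>) * gauss 0 (var_of \<theta>) y))"

definition loglik :: "'d::finite obs \<Rightarrow> 'd param \<Rightarrow> real" where
  "loglik z \<theta> = ln (mix_density \<theta> z)"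

definition grad :: "(real ^ 'n::finite \<Rightarrow> real) \<Rightarrow> real ^ 'n \<Rightarrow> real ^ 'n" where
  "grad F x = (\<chi> i. frechet_derivative F (at x) (axis i 1))"

definition hess :: "(real ^ 'n::finite \<Rightarrow> real) \<Rightarrow> real ^ 'n \<Rightarrow> real ^ 'n ^ 'n" where
  "hess F x = jacobian (grad F) (at x)"

definition fisher_info :: "'d::finite param \<Rightarrow> real ^ ('d + 2) ^ ('d + 2)" where
  "fisher_info \<theta> = (\<chi> i j.
     (\<integral>z. grad (loglik z) \<theta> $ i * grad (loglik z) \<theta> $ j
        \<partial>density lborel (\<lambda>z. ennreal (mix_density \<theta> z))))"

definition resp :: "'d::finite obs \<Rightarrow> 'd param \<Rightarrow> real" where
  "resp = (\<lambda>(y, h) \<theta>.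
     prob_of \<theta> * gauss (h \<bullet> mean_of \<theta>) (var_of \<theta>) y /
     (prob_of \<theta> * gauss (h \<bullet> mean_of \<theta>) (var_of \<theta>) y +
      (1 - prob_of \<theta>) * gauss 0 (var_of \<theta>) y))"

definition Gam :: "'d::finite obs \<Rightarrow> 'd param \<Rightarrow> real ^ 'd ^ 'd" where
  "Gam z \<theta> = (\<chi> i j. resp z \<theta> * (snd z $ i * snd z $ j))"

(* Empirical mean over the observations 1, ..., N. *)
definition emp_mean :: "nat \<Rightarrow> (nat \<Rightarrow> 'a) \<Rightarrow> ('a \<Rightarrow> 'b) \<Rightarrow> 'b::real_vector" where
  "emp_mean N zs g = (1 / real N) *\<^sub>R (\<Sum>n = 1..N. g (zs n))"

definition A_mat :: "nat \<Rightarrow> (nat \<Rightarrow> 'd::finite obs) \<Rightarrow> 'd param \<Rightarrow> real ^ ('d + 2) ^ ('d + 2)" where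
  "A_mat N zs \<theta> = (\<chi> k l. case (k, l) of
       (Inl i, Inl j) \<Rightarrow> emp_mean N zs (\<lambda>z. (1 / var_of \<theta>) *\<^sub>R Gam z \<theta>) $ i $ j
     | (Inr a, Inr b) \<Rightarrow>
         (if a = b
          then (if a = 1 then 1 / (prob_of \<theta> * (1 - prob_of \<theta>)) else 1 / (2 * (var_of \<theta>)\<^sup>2))
          else 0)
     | _ \<Rightarrow> 0)"

(* matrix_inv is total, with an unspecified value on singular matrices.  For theta in the
   parameter space, A_mat N zs theta is singular only if h_1, ..., h_N do not span R^d, which has
   probability zero as soon as N >= d. *)
definition T_map :: "nat \<Rightarrow> (nat \<Rightarrow> 'd::finite obs) \<Rightarrow> 'd param \<Rightarrow> 'd param" where
  "T_map N zs \<theta> =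
     \<theta> + matrix_inv (A_mat N zs \<theta>) *v emp_mean N zs (\<lambda>z. grad (loglik z) \<theta>)"

definition T_prime :: "nat \<Rightarrow> (nat \<Rightarrow> 'd::finite obs) \<Rightarrow> 'd param \<Rightarrow> real ^ ('d + 2) ^ ('d + 2)" where
  "T_prime N zs \<theta> =
     mat 1 + matrix_inv (A_mat N zs \<theta>) ** emp_mean N zs (\<lambda>z. hess (loglik z) \<theta>)"

definition is_norm :: "('a::real_vector \<Rightarrow> real) \<Rightarrow> bool" where
  "is_norm \<nu> \<longleftrightarrow>
     (\<forall>x. 0 \<le> \<nu> x) \<and> (\<forall>x. \<nu> x = 0 \<longleftrightarrow> x = 0) \<and>
     (\<forall>c x. \<nu> (c *\<^sub>R x) = \<bar>c\<bar> * \<nu> x) \<and> (\<forall>x y. \<nu> (x + y) \<le> \<nu> x + \<nu> y)"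

definition norm_cball :: "('a::real_vector \<Rightarrow> real) \<Rightarrow> 'a \<Rightarrow> real \<Rightarrow> 'a set" where
  "norm_cball \<nu> c \<delta> = {x. \<nu> (x - c) \<le> \<delta>}"

definition induced_norm :: "(real ^ 'n::finite \<Rightarrow> real) \<Rightarrow> real ^ 'n ^ 'n \<Rightarrow> real" where
  "induced_norm \<nu> M = (SUP x\<in>{x. \<nu> x = 1}. \<nu> (M *v x))"

end

theory Submission
  imports Defs
begin

text \<open>
  Let \<open>r\<close> be the responsibility, the posterior probability that an observation comes from the
  component with regression, and let \<open>S\<^sub>x\<close> be the score of the joint density of the
  observation and the component label \<open>x \<in> {0, 1}\<close>. Then
  \<open>grad \<phi> = r S\<^sub>1 + (1 - r) S\<^sub>0\<close> and
  \<open>hess \<phi> = r DS\<^sub>1 + (1 - r) DS\<^sub>0 + r (1 - r) (S\<^sub>1 - S\<^sub>0) (S\<^sub>1 - S\<^sub>0)\<^sup>T\<close>.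
  Under \<open>\<theta>s\<close> the weights \<open>r\<close> and \<open>1 - r\<close> turn expectations into
  expectations over a single Gaussian component, where the central moments up to order four suffice to
  evaluate everything. The outcome (\<open>fisher_missing_complete\<close>, \<open>expected_hess\<close>) is that the
  gradient has mean 0, the Hessian has mean \<open>- J\<close> with \<open>J\<close> the Fisher information, and
  \<open>A\<^sub>N(\<theta>s)\<close> tends to \<open>P = J + B\<close>: the information of the labelled data is the
  Fisher information plus the missing information \<open>B = E[r (1 - r) (S\<^sub>1 - S\<^sub>0) (S\<^sub>1 - S\<^sub>0)\<^sup>T]\<close>,
  which is positive semidefinite.

  So \<open>T'\<^sub>N(\<theta>s)\<close> tends to \<open>1 - P\<^sup>-\<^sup>1 J = P\<^sup>-\<^sup>1 B\<close>. Because \<open>J\<close> is non-singular,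
  it is positive definite and \<open>0 \<le> B < P\<close>. Hence \<open>P\<^sup>-\<^sup>1 B\<close>, which is self-adjoint for the inner
  product \<open>x \<bullet> (P y)\<close>, has norm less than 1 for the norm \<open>\<nu> x = sqrt (x \<bullet> (P x))\<close>
  (\<open>qnorm_contraction\<close>); this \<open>\<nu>\<close> is the norm of the theorem. Being a strict contraction
  survives small changes of the two matrices (\<open>contraction_perturb\<close>), so it is enough that the
  empirical means of the Hessian and of the matrix in \<open>A\<^sub>N\<close> are close to \<open>- J\<close> and \<open>P\<close> at the same
  time for all \<open>\<theta>\<close> near \<open>\<theta>s\<close>. At \<open>\<theta>s\<close> this is the weak law of large numbers. It extends to
  a ball (\<open>emp_mean_mat_locally_uniform\<close>) because the entries are Lipschitz in \<open>\<theta>\<close> with a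
  constant that grows polynomially in the observation, and the empirical mean of these constants is itself
  under control. All moments exist since the mixture density has Gaussian decay.

  The matrix \<open>T'\<^sub>N\<close> is not the derivative of \<open>T\<^sub>N\<close>, since \<open>A\<^sub>N\<close> varies with \<open>\<theta>\<close>. For the
  first claim \<open>X = A\<^sub>N(\<theta>)\<^sup>-\<^sup>1\<close> is therefore held fixed: with \<open>G\<close> the mean gradient and
  \<open>\<Psi> t = t + X G(t)\<close>,
  \<open>T\<^sub>N(\<theta>) - \<theta>s = X G(\<theta>s) + (\<Psi> \<theta> - \<Psi> \<theta>s)\<close>. The derivative of \<open>\<Psi>\<close> is a
  contraction on the whole ball by the same closeness, and \<open>G(\<theta>s)\<close> tends to 0
  (\<open>T_map_contraction\<close>).

  Finally both events involve a supremum over uncountably many parameters and must be shown to be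
  measurable. Whether \<open>A\<^sub>N(\<theta>)\<close> is singular depends on the sample only, not on \<open>\<theta>\<close>
  (\<open>A_mat_kernel\<close>). Hence \<open>T\<^sub>N\<close> and \<open>T'\<^sub>N\<close> are continuous in \<open>\<theta>\<close> for every sample, also
  for the degenerate ones, and the supremum can be taken over a countable dense set.
\<close>

section \<open>Inverse matrices and norms of quadratic forms\<close>

lemma norm_matrix_vector_mult_le:
  fixes A :: "real ^ 'n::finite ^ 'm::finite"
  shows "norm (A *v x) \<le> norm A * norm x"
proof -
  have "norm (A *v x) \<le> L2_set (\<lambda>i. norm (A $ i) * norm x) UNIV"
    unfolding norm_vec_def[of "A *v x"]
    by (rule L2_set_mono)
      (auto simp: matrix_vector_mul_component real_norm_def Cauchy_Schwarz_ineq2)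
  also have "\<dots> = norm A * norm x"
    by (simp add: norm_vec_def[of A] L2_set_left_distrib)
  finally show ?thesis .
qed

lemma matrix_inv_inverse:
  fixes A :: "real ^ 'n::finite ^ 'n"
  assumes "invertible A"
  shows "A ** matrix_inv A = mat 1" "matrix_inv A ** A = mat 1"
  using someI_ex[OF assms[unfolded invertible_def]] by (simp_all add: matrix_inv_def)

text \<open>By Cramer's rule the inverse is a rational function of the entries; continuity and measurability of
  \<open>matrix_inv\<close> are read off from this formula.\<close>

lemma matrix_inv_cramer:
  fixes A :: "real ^ 'n::finite ^ 'n"
  assumes "det A \<noteq> 0"
  shows "matrix_inv A =
    (\<chi> i j. det (\<chi> k l. if l = i then (if k = j then 1 else 0) else A $ k $ l) / det A)"
proof -
  have inv: "invertible A" using assms by (simp add: invertible_det_nz)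
  have "A *v (matrix_inv A *v axis j 1) = axis j 1" for j
    using matrix_inv_inverse(1)[OF inv] by (simp add: matrix_vector_mul_assoc)
  then have eq: "matrix_inv A *v axis j 1 = (\<chi> i. det (\<chi> k l. if l = i then axis j 1 $ k else A $ k $ l) / det A)" for j
    using cramer[OF assms] by blast
  have "matrix_inv A $ i $ j = (matrix_inv A *v axis j 1) $ i" for i j
    by (simp add: matrix_vector_mult_basis column_def)
  then show ?thesis
    unfolding eq by (simp add: vec_eq_iff axis_def eq_commute cong: if_cong)
qed

lemma tendsto_det:
  fixes f :: "'a \<Rightarrow> real ^ 'n::finite ^ 'n"
  assumes "\<And>i j. ((\<lambda>x. f x $ i $ j) \<longlongrightarrow> A $ i $ j) F"
  shows "((\<lambda>x. det (f x)) \<longlongrightarrow> det A) F"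
  unfolding det_def by (intro tendsto_intros assms)

lemma isCont_matrix_inv:
  fixes A :: "real ^ 'n::finite ^ 'n"
  assumes "invertible A"
  shows "isCont matrix_inv A"
proof -
  have nz: "det A \<noteq> 0" using assms by (simp add: invertible_det_nz)
  have c: "((\<lambda>X. X $ i $ j) \<longlongrightarrow> A $ i $ j) (at A)" for i j
    by (intro tendsto_vec_nth tendsto_ident_at)
  have d: "(det \<longlongrightarrow> det A) (at A)"
    using c by (rule tendsto_det)
  have ev: "eventually (\<lambda>X. det X \<noteq> 0) (at A)"
    using tendsto_imp_eventually_ne[OF d nz] .
  have "((\<lambda>X. \<chi> i j. det (\<chi> k l. if l = i then (if k = j then 1 else 0) else X $ k $ l) / det X)
       \<longlongrightarrow> (\<chi> i j. det (\<chi> k l. if l = i then (if k = j then 1 else 0) else A $ k $ l) / det A)) (at A)"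
    by (intro vec_tendstoI) (auto intro!: tendsto_divide tendsto_det d nz c)
  then have "(matrix_inv \<longlongrightarrow> matrix_inv A) (at A)"
    unfolding matrix_inv_cramer[OF nz, symmetric]
    by (rule Lim_transform_eventually)
      (use ev in eventually_elim, simp add: matrix_inv_cramer)
  then show ?thesis by (simp add: isCont_def)
qed

lemma borel_measurable_vecI:
  fixes f :: "'a \<Rightarrow> 'b::euclidean_space ^ 'n::finite"
  assumes "\<And>i. (\<lambda>x. f x $ i) \<in> borel_measurable M"
  shows "f \<in> borel_measurable M"
proof (rule borel_measurable_euclidean_space[THEN iffD2], rule ballI)
  fix b :: "'b ^ 'n" assume "b \<in> Basis"
  then obtain i u where b: "b = axis i u" by (auto simp: Basis_vec_def)
  have "(\<lambda>x. f x $ i \<bullet> u) \<in> borel_measurable M" using assms[of i] by measurable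
  then show "(\<lambda>x. f x \<bullet> b) \<in> borel_measurable M" by (simp add: b inner_axis)
qed

lemma borel_measurable_vec_nth [measurable]:
  "(\<lambda>x. x $ i) \<in> borel_measurable (borel :: ('b::euclidean_space ^ 'n::finite) measure)"
  by (intro borel_measurable_continuous_onI continuous_intros)

lemma borel_measurable_det:
  "det \<in> borel_measurable (borel :: (real ^ 'n::finite ^ 'n) measure)"
  unfolding det_def by measurable

text \<open>Singular matrices do not disturb measurability: the value of \<open>matrix_inv\<close> there is a choice from
  the empty predicate, hence one and the same matrix for all of them.\<close>

lemma borel_measurable_matrix_inv:
  "matrix_inv \<in> borel_measurable (borel :: (real ^ 'n::finite ^ 'n) measure)"
proof -
  define c :: "real ^ 'n ^ 'n" where "c = (SOME B. False)"
  let ?V = "\<lambda>A :: real ^ 'n ^ 'n. \<chi> i j. det (\<chi> k l. if l = i then (if k = j then 1 else 0) else A $ k $ l) / det A"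
  have eq: "matrix_inv A = (if det A = 0 then c else ?V A)" for A :: "real ^ 'n ^ 'n"
  proof (cases "det A = 0")
    case True
    then have "\<not> invertible A" by (simp add: invertible_det_nz)
    then have "(\<lambda>B. A ** B = mat 1 \<and> B ** A = mat 1) = (\<lambda>B. False)" by (auto simp: invertible_def)
    then show ?thesis using True by (simp add: matrix_inv_def c_def)
  qed (simp add: matrix_inv_cramer)
  have "(\<lambda>A. if l = i then (if k = j then 1 else 0) else A $ k $ l)
      \<in> borel_measurable (borel :: (real ^ 'n ^ 'n) measure)" for i j k l
    by (cases "l = i") auto
  then have num: "(\<lambda>A. det (\<chi> k l. if l = i then (if k = j then 1 else 0) else A $ k $ l))
      \<in> borel_measurable (borel :: (real ^ 'n ^ 'n) measure)" for i j
    by (intro measurable_compose[OF _ borel_measurable_det] borel_measurable_vecI) simp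
  have V: "?V \<in> borel_measurable borel"
    by (intro borel_measurable_vecI) (simp add: num borel_measurable_det borel_measurable_divide)
  show ?thesis
    unfolding eq[abs_def]
    using V borel_measurable_det by measurable
qed

text \<open>The quadratic \<open>t \<mapsto> (x + t y) \<bullet> B (x + t y)\<close> is nonnegative, so it has nonpositive
  discriminant. Stated for semidefinite forms, to cover the Fisher information before its definiteness is
  known, and the missing information.\<close>

lemma psd_Cauchy_Schwarz:
  fixes B :: "real ^ 'n::finite ^ 'n"
  assumes sym: "\<And>x y. x \<bullet> (B *v y) = y \<bullet> (B *v x)"
    and psd: "\<And>x. 0 \<le> x \<bullet> (B *v x)"
  shows "(x \<bullet> (B *v y))\<^sup>2 \<le> (x \<bullet> (B *v x)) * (y \<bullet> (B *v y))"
proof -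
  define a where "a = x \<bullet> (B *v x)"
  define b where "b = x \<bullet> (B *v y)"
  define c where "c = y \<bullet> (B *v y)"
  have q: "0 \<le> a + 2 * t * b + t * t * c" for t
  proof -
    have "0 \<le> (x + t *\<^sub>R y) \<bullet> (B *v (x + t *\<^sub>R y))" by (rule psd)
    also have "\<dots> = a + 2 * t * b + t * t * c"
      by (simp add: a_def b_def c_def matrix_vector_right_distrib matrix_vector_mult_scaleR
          inner_add sym[of y x] algebra_simps)
    finally show ?thesis .
  qed
  have c0: "0 \<le> c" and a0: "0 \<le> a" unfolding c_def a_def by (rule psd)+
  have "b\<^sup>2 \<le> a * c"
  proof (cases "c = 0")
    case True
    show ?thesis
    proof (cases "b = 0")
      case False
      then show ?thesis using q[of "- (a + 1) / (2 * b)"] True by (simp add: field_simps)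
    qed (simp add: True)
  next
    case False
    then have "0 < c" using c0 by simp
    then show ?thesis using q[of "- b / c"] by (simp add: field_simps power2_eq_square)
  qed
  then show ?thesis by (simp add: a_def b_def c_def)
qed

text \<open>A null vector of a semidefinite form is orthogonal to everything by Cauchy-Schwarz, so it lies in the
  kernel of the matrix.\<close>

lemma psd_invertible_imp_pd:
  fixes B :: "real ^ 'n::finite ^ 'n"
  assumes sym: "\<And>x y. x \<bullet> (B *v y) = y \<bullet> (B *v x)"
    and psd: "\<And>x. 0 \<le> x \<bullet> (B *v x)"
    and inv: "invertible B" and "x \<noteq> 0"
  shows "0 < x \<bullet> (B *v x)"
proof (rule ccontr)
  assume "\<not> 0 < x \<bullet> (B *v x)"
  then have "x \<bullet> (B *v x) = 0" using psd[of x] by linarith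
  then have "((B *v x) \<bullet> (B *v x))\<^sup>2 \<le> 0"
    using psd_Cauchy_Schwarz[OF sym psd, of "B *v x" x] by simp
  then have "B *v x = 0" by simp
  then have "matrix_inv B *v (B *v x) = 0" by simp
  then have "x = 0" by (simp add: matrix_vector_mul_assoc matrix_inv_inverse(2)[OF inv])
  with \<open>x \<noteq> 0\<close> show False by simp
qed

definition pd_matrix :: "real ^ 'n::finite ^ 'n \<Rightarrow> bool" where
  "pd_matrix P \<longleftrightarrow> (\<forall>x y. x \<bullet> (P *v y) = y \<bullet> (P *v x)) \<and> (\<forall>x. x \<noteq> 0 \<longrightarrow> 0 < x \<bullet> (P *v x))"

lemma pd_matrix_sym: "pd_matrix P \<Longrightarrow> x \<bullet> (P *v y) = y \<bullet> (P *v x)"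
  by (simp add: pd_matrix_def)

lemma pd_matrix_nonneg: "pd_matrix P \<Longrightarrow> 0 \<le> x \<bullet> (P *v x)"
  by (cases "x = 0") (auto simp: pd_matrix_def intro: less_imp_le)

lemma pd_matrix_invertible:
  assumes "pd_matrix P" shows "invertible P"
proof -
  have "P *v x = 0 \<longrightarrow> x = 0" for x
    using assms by (force simp: pd_matrix_def)
  then show ?thesis
    by (auto simp: invertible_left_inverse matrix_left_invertible_ker)
qed

text \<open>The norm of the theorem is of this form; \<open>P\<close> will be the information of the labelled data.\<close>

definition qnorm :: "real ^ 'n::finite ^ 'n \<Rightarrow> real ^ 'n \<Rightarrow> real" where
  "qnorm P x = sqrt (x \<bullet> (P *v x))"

lemma qnorm_nonneg: "pd_matrix P \<Longrightarrow> 0 \<le> qnorm P x"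
  by (simp add: qnorm_def pd_matrix_nonneg)

lemma qnorm_power2: "pd_matrix P \<Longrightarrow> (qnorm P x)\<^sup>2 = x \<bullet> (P *v x)"
  by (simp add: qnorm_def pd_matrix_nonneg)

lemma qnorm_Cauchy_Schwarz:
  assumes P: "pd_matrix P" shows "x \<bullet> (P *v y) \<le> qnorm P x * qnorm P y"
proof -
  have "(x \<bullet> (P *v y))\<^sup>2 \<le> (qnorm P x * qnorm P y)\<^sup>2"
    using psd_Cauchy_Schwarz[OF pd_matrix_sym[OF P] pd_matrix_nonneg[OF P]]
    by (simp add: power_mult_distrib qnorm_power2[OF P])
  then show ?thesis
    using abs_le_square_iff[of "x \<bullet> (P *v y)" "qnorm P x * qnorm P y"] qnorm_nonneg[OF P] by simp
qed

lemma is_norm_qnorm: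
  assumes P: "pd_matrix P" shows "is_norm (qnorm P)"
  unfolding is_norm_def
proof (intro conjI allI)
  show "0 \<le> qnorm P x" for x by (rule qnorm_nonneg[OF P])
  show "qnorm P x = 0 \<longleftrightarrow> x = 0" for x
    using P by (force simp: qnorm_def pd_matrix_def)
  show "qnorm P (c *\<^sub>R x) = \<bar>c\<bar> * qnorm P x" for c x
    by (simp add: qnorm_def matrix_vector_mult_scaleR real_sqrt_mult flip: mult.assoc)
  show "qnorm P (x + y) \<le> qnorm P x + qnorm P y" for x y
  proof (rule power2_le_imp_le)
    have "(qnorm P (x + y))\<^sup>2 = (qnorm P x)\<^sup>2 + 2 * (x \<bullet> (P *v y)) + (qnorm P y)\<^sup>2"
      by (simp add: qnorm_power2[OF P] matrix_vector_right_distrib inner_add pd_matrix_sym[OF P, of y x])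
    also have "\<dots> \<le> (qnorm P x + qnorm P y)\<^sup>2"
      using qnorm_Cauchy_Schwarz[OF P, of x y] by (simp add: power2_sum)
    finally show "(qnorm P (x + y))\<^sup>2 \<le> (qnorm P x + qnorm P y)\<^sup>2" .
  qed (simp add: qnorm_nonneg[OF P])
qed

text \<open>All norms on a finite-dimensional space are equivalent: an upper bound from the basis expansion, which
  makes \<open>\<nu>\<close> continuous, and a lower bound from the minimum over the Euclidean unit sphere.\<close>

lemma is_norm_equiv:
  fixes \<nu> :: "real ^ 'n::finite \<Rightarrow> real"
  assumes "is_norm \<nu>"
  obtains c C where "0 < c" "0 < C" "\<And>x. c * norm x \<le> \<nu> x" "\<And>x. \<nu> x \<le> C * norm x"
    "continuous_on UNIV \<nu>"
proof -
  have nn: "0 \<le> \<nu> x" and z: "\<nu> x = 0 \<longleftrightarrow> x = 0" and sc: "\<nu> (a *\<^sub>R x) = \<bar>a\<bar> * \<nu> x"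
    and tri: "\<nu> (x + y) \<le> \<nu> x + \<nu> y" for x y a
    using assms by (auto simp: is_norm_def)
  define C where "C = 1 + (\<Sum>b\<in>Basis. \<nu> b)"
  have "0 < C" unfolding C_def using sum_nonneg[of Basis \<nu>] nn by (smt (verit))
  have sum_le: "\<nu> (\<Sum>b\<in>S. f b) \<le> (\<Sum>b\<in>S. \<nu> (f b))" if "finite S" for S and f :: "_ \<Rightarrow> real ^ 'n"
    using that z[of 0] by (induction S) (auto intro: order_trans[OF tri])
  have up: "\<nu> x \<le> C * norm x" for x
  proof -
    have "\<nu> x = \<nu> (\<Sum>b\<in>Basis. (x \<bullet> b) *\<^sub>R b)" by (simp add: euclidean_representation)
    also have "\<dots> \<le> (\<Sum>b\<in>Basis. \<bar>x \<bullet> b\<bar> * \<nu> b)" using sum_le[of Basis "\<lambda>b. (x \<bullet> b) *\<^sub>R b"] by (simp add: sc)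
    also have "\<dots> \<le> (\<Sum>b\<in>Basis. norm x * \<nu> b)"
      by (intro sum_mono mult_right_mono nn Basis_le_norm)
    also have "\<dots> = (\<Sum>b\<in>Basis. \<nu> b) * norm x" by (simp add: sum_distrib_left mult.commute sum_distrib_right)
    also have "\<dots> \<le> C * norm x" by (simp add: C_def distrib_right)
    finally show ?thesis .
  qed
  have lip: "\<bar>\<nu> x - \<nu> y\<bar> \<le> C * norm (x - y)" for x y
  proof -
    have "\<nu> x \<le> \<nu> y + \<nu> (x - y)" using tri[of y "x - y"] by simp
    moreover have "\<nu> y \<le> \<nu> x + \<nu> (y - x)" using tri[of x "y - x"] by simp
    moreover have "\<nu> (y - x) = \<nu> (x - y)" using sc[of "-1" "x - y"] by simp
    ultimately show ?thesis using up[of "x - y"] by linarith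
  qed
  have "C-lipschitz_on UNIV \<nu>"
    by (rule lipschitz_onI) (use lip \<open>0 < C\<close> in \<open>auto simp: dist_norm\<close>)
  then have cont: "continuous_on UNIV \<nu>" by (rule lipschitz_on_continuous_on)
  have "compact (sphere (0::real^'n) 1)" "sphere (0::real^'n) 1 \<noteq> {}" by auto
  then obtain m where m: "m \<in> sphere 0 1" "\<And>y. y \<in> sphere 0 1 \<Longrightarrow> \<nu> m \<le> \<nu> y"
    using continuous_attains_inf[of "sphere 0 1" \<nu>] continuous_on_subset[OF cont] by blast
  have "0 < \<nu> m" using m(1) nn[of m] z[of m] by force
  have low: "\<nu> m * norm x \<le> \<nu> x" for x
  proof (cases "x = 0")
    case False
    have "\<nu> m \<le> \<nu> ((1 / norm x) *\<^sub>R x)" using m(2)[of "(1 / norm x) *\<^sub>R x"] False by simp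
    also have "\<dots> = \<nu> x / norm x" by (simp add: sc)
    finally show ?thesis using False by (simp add: field_simps)
  qed (simp add: nn)
  show ?thesis by (rule that[OF \<open>0 < \<nu> m\<close> \<open>0 < C\<close> low up cont])
qed


lemma is_norm_lower:
  fixes \<nu> :: "real ^ 'n::finite \<Rightarrow> real"
  assumes "is_norm \<nu>" shows "\<exists>c>0. \<forall>x. c * norm x \<le> \<nu> x"
  by (rule is_norm_equiv[OF assms]) blast

lemma is_norm_upper:
  fixes \<nu> :: "real ^ 'n::finite \<Rightarrow> real"
  assumes "is_norm \<nu>" shows "\<exists>C>0. \<forall>x. \<nu> x \<le> C * norm x"
  by (rule is_norm_equiv[OF assms]) blast

lemma is_norm_continuous:
  fixes \<nu> :: "real ^ 'n::finite \<Rightarrow> real"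
  assumes "is_norm \<nu>" shows "continuous_on UNIV \<nu>"
  by (rule is_norm_equiv[OF assms]) blast

section \<open>Contractions in the norm of a positive definite form\<close>

lemma pd_matrix_add_psd:
  assumes "pd_matrix J"
    and sym: "\<And>x y. x \<bullet> (B *v y) = y \<bullet> (B *v x)" and psd: "\<And>x. 0 \<le> x \<bullet> (B *v x)"
  shows "pd_matrix (J + B)"
  unfolding pd_matrix_def
proof (intro conjI allI impI)
  show "x \<bullet> ((J + B) *v y) = y \<bullet> ((J + B) *v x)" for x y
    using sym[of x y] pd_matrix_sym[OF assms(1), of x y]
    by (simp add: matrix_vector_mult_add_rdistrib inner_add_right)
  show "0 < x \<bullet> ((J + B) *v x)" if "x \<noteq> 0" for x
    using psd[of x] assms(1) that
    by (simp add: pd_matrix_def matrix_vector_mult_add_rdistrib inner_add_right add_pos_nonneg)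
qed

text \<open>The matrix is \<open>P\<^sup>-\<^sup>1 B\<close> with \<open>P = J + B\<close>. For \<open>w = P\<^sup>-\<^sup>1 B x\<close> one has
  \<open>w \<bullet> (P w) = w \<bullet> (B x)\<close>. Since \<open>J\<close> takes a fixed proportion of \<open>P\<close>, the form of \<open>B\<close> is at most
  \<open>\<kappa>\<close> times that of \<open>P\<close>, and Cauchy-Schwarz for \<open>B\<close> gives the claim.\<close>

lemma qnorm_contraction:
  fixes J B :: "real ^ 'n::finite ^ 'n"
  assumes J: "pd_matrix J"
    and sym: "\<And>x y. x \<bullet> (B *v y) = y \<bullet> (B *v x)" and psd: "\<And>x. 0 \<le> x \<bullet> (B *v x)"
  obtains \<kappa> where "0 \<le> \<kappa>" "\<kappa> < 1"
    "\<And>x. qnorm (J + B) ((mat 1 + matrix_inv (J + B) ** (- J)) *v x) \<le> \<kappa> * qnorm (J + B) x"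
proof -
  define P where "P = J + B"
  have P: "pd_matrix P" unfolding P_def by (rule pd_matrix_add_psd[OF assms])
  let ?\<nu> = "qnorm P"
  obtain c where c: "0 < c" "\<And>x. c * norm x \<le> qnorm J x"
    using is_norm_lower[OF is_norm_qnorm[OF J]] by blast
  obtain C where C: "0 < C" "\<And>x. ?\<nu> x \<le> C * norm x"
    using is_norm_upper[OF is_norm_qnorm[OF P]] by blast
  \<comment> \<open>The form of J is at least \<open>(c / C)\<^sup>2\<close> times that of P; the maximum makes \<kappa> nonnegative.\<close>
  define \<kappa> where "\<kappa> = max 0 (1 - (c / C)\<^sup>2)"
  have \<kappa>: "0 \<le> \<kappa>" "\<kappa> < 1" using c(1) C(1) by (auto simp: \<kappa>_def)
  have B_le: "x \<bullet> (B *v x) \<le> \<kappa> * (?\<nu> x)\<^sup>2" for x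
  proof -
    have "(c / C) * ?\<nu> x \<le> c * norm x" using C(2)[of x] C(1) c(1) by (simp add: field_simps)
    also have "\<dots> \<le> qnorm J x" by (rule c(2))
    finally have "((c / C) * ?\<nu> x)\<^sup>2 \<le> (qnorm J x)\<^sup>2"
      using C(1) c(1) qnorm_nonneg[OF P, of x] by (intro power_mono) auto
    then have 1: "(c / C)\<^sup>2 * (?\<nu> x)\<^sup>2 \<le> x \<bullet> (J *v x)"
      by (simp only: power_mult_distrib qnorm_power2[OF J])
    have "x \<bullet> (B *v x) = (?\<nu> x)\<^sup>2 - x \<bullet> (J *v x)"
      unfolding qnorm_power2[OF P] by (simp add: P_def matrix_vector_mult_add_rdistrib inner_add_right)
    also have "\<dots> \<le> (1 - (c / C)\<^sup>2) * (?\<nu> x)\<^sup>2" using 1 by (simp add: algebra_simps)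
    also have "\<dots> \<le> \<kappa> * (?\<nu> x)\<^sup>2" by (intro mult_right_mono) (auto simp: \<kappa>_def)
    finally show ?thesis .
  qed
  have "?\<nu> ((mat 1 + matrix_inv P ** (- J)) *v x) \<le> \<kappa> * ?\<nu> x" for x
  proof -
    define w where "w = (mat 1 + matrix_inv P ** (- J)) *v x"
    have "P *v w = (P + (P ** matrix_inv P) ** (- J)) *v x"
      by (simp add: w_def matrix_vector_mul_assoc matrix_add_ldistrib matrix_mul_assoc)
    also have "\<dots> = B *v x"
      unfolding matrix_inv_inverse(1)[OF pd_matrix_invertible[OF P]]
      by (simp add: P_def)
    finally have Pw: "P *v w = B *v x" .
    have "((?\<nu> w)\<^sup>2)\<^sup>2 = (w \<bullet> (B *v x))\<^sup>2" by (simp add: qnorm_power2[OF P] Pw)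
    also have "\<dots> \<le> (w \<bullet> (B *v w)) * (x \<bullet> (B *v x))" by (rule psd_Cauchy_Schwarz[OF sym psd])
    also have "\<dots> \<le> (\<kappa> * (?\<nu> w)\<^sup>2) * (\<kappa> * (?\<nu> x)\<^sup>2)"
      by (intro mult_mono B_le psd mult_nonneg_nonneg \<kappa>) auto
    also have "\<dots> = (?\<nu> w)\<^sup>2 * (\<kappa> * ?\<nu> x)\<^sup>2" by (simp add: power2_eq_square)
    finally have *: "(?\<nu> w)\<^sup>2 * (?\<nu> w)\<^sup>2 \<le> (?\<nu> w)\<^sup>2 * (\<kappa> * ?\<nu> x)\<^sup>2" by (simp add: power2_eq_square)
    have nn: "0 \<le> \<kappa> * ?\<nu> x" using \<kappa> qnorm_nonneg[OF P] by simp
    have "?\<nu> w \<le> \<kappa> * ?\<nu> x"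
    proof (cases "?\<nu> w = 0")
      case False
      then have "0 < (?\<nu> w)\<^sup>2" by simp
      then have "(?\<nu> w)\<^sup>2 \<le> (\<kappa> * ?\<nu> x)\<^sup>2" using * by (simp only: mult_le_cancel_left_pos)
      then show ?thesis using nn by (rule power2_le_imp_le)
    qed (use nn in simp)
    then show ?thesis by (simp add: w_def)
  qed
  then show ?thesis using that[OF \<kappa>] by (simp add: P_def)
qed

text \<open>Strictness of the contraction leaves room \<open>q - \<kappa>\<close> for an error in both matrices. The bound on the
  inverse has to come with the same \<open>\<eta>\<close>: the radius of the ball of parameters is chosen after \<open>\<eta>\<close>, and
  the size of the gradient after the radius.\<close>

lemma contraction_perturb:
  fixes P H0 :: "real ^ 'n::finite ^ 'n"
  assumes \<nu>: "is_norm \<nu>" and inv: "invertible P" and "\<kappa> < q"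
    and contr: "\<And>x. \<nu> ((mat 1 + matrix_inv P ** H0) *v x) \<le> \<kappa> * \<nu> x"
  obtains \<eta> where "0 < \<eta>"
    "\<And>A. norm (A - P) < \<eta> \<Longrightarrow> norm (matrix_inv A) \<le> norm (matrix_inv P) + 1"
    "\<And>A H x. norm (A - P) < \<eta> \<Longrightarrow> norm (H - H0) < \<eta> \<Longrightarrow>
       \<nu> ((mat 1 + matrix_inv A ** H) *v x) \<le> q * \<nu> x"
proof -
  obtain c C where c: "0 < c" "0 < C" "\<And>x. c * norm x \<le> \<nu> x" "\<And>x. \<nu> x \<le> C * norm x"
    using is_norm_lower[OF \<nu>] is_norm_upper[OF \<nu>] by blast
  have tri: "\<nu> (x + y) \<le> \<nu> x + \<nu> y" for x y using \<nu> by (auto simp: is_norm_def)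
  define b where "b = norm H0 + 1 + norm (matrix_inv P)"
  have b: "0 < b" unfolding b_def by (smt (verit) norm_ge_zero)
  \<comment> \<open>An error e in both matrices moves the product by at most e b in operator norm; c and C convert to \<nu>.\<close>
  define e where "e = min 1 ((q - \<kappa>) * c / (C * b))"
  have e: "0 < e" "e \<le> 1" "C * (e * b) \<le> (q - \<kappa>) * c"
  proof -
    show "0 < e" "e \<le> 1" using \<open>\<kappa> < q\<close> c b by (auto simp: e_def)
    have "e \<le> (q - \<kappa>) * c / (C * b)" by (simp add: e_def)
    then show "C * (e * b) \<le> (q - \<kappa>) * c" using c b by (simp add: field_simps)
  qed
  obtain \<eta> where \<eta>: "0 < \<eta>" "\<And>A. norm (A - P) < \<eta> \<Longrightarrow> norm (matrix_inv A - matrix_inv P) < e"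
    using isCont_matrix_inv[OF inv, unfolded continuous_at_eps_delta, rule_format, OF \<open>0 < e\<close>]
    by (auto simp: dist_norm)
  show ?thesis
  proof (rule that[of "min \<eta> e"])
    show "0 < min \<eta> e" using \<eta> e by simp
    show "norm (matrix_inv A) \<le> norm (matrix_inv P) + 1" if "norm (A - P) < min \<eta> e" for A
    proof -
      have "norm (matrix_inv A - matrix_inv P) < e" using that by (intro \<eta>(2)) simp
      then show ?thesis using e(2) norm_triangle_ineq2[of "matrix_inv A" "matrix_inv P"] by linarith
    qed
    show "\<nu> ((mat 1 + matrix_inv A ** H) *v x) \<le> q * \<nu> x"
      if A: "norm (A - P) < min \<eta> e" and H: "norm (H - H0) < min \<eta> e" for A H x
    proof -
      define D where "D = matrix_inv A ** H - matrix_inv P ** H0"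
      have nA: "norm (matrix_inv A - matrix_inv P) \<le> e" using \<eta>(2)[of A] A by (simp add: less_imp_le)
      have nH: "norm (H - H0) \<le> e" using H by simp
      have nH': "norm H \<le> norm H0 + 1" using nH e(2) norm_triangle_ineq2[of H H0] by linarith
      have "D *v x = (matrix_inv A - matrix_inv P) *v (H *v x) + matrix_inv P *v ((H - H0) *v x)"
        by (simp add: D_def matrix_vector_mult_diff_rdistrib matrix_vector_mult_diff_distrib
            flip: matrix_vector_mul_assoc)
      also have "norm \<dots> \<le> e * ((norm H0 + 1) * norm x) + norm (matrix_inv P) * (e * norm x)"
      proof (intro order_trans[OF norm_triangle_ineq] add_mono)
        show "norm ((matrix_inv A - matrix_inv P) *v (H *v x)) \<le> e * ((norm H0 + 1) * norm x)"
          by (intro order_trans[OF norm_matrix_vector_mult_le] mult_mono nA mult_right_mono nH') (use e in auto)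
        show "norm (matrix_inv P *v ((H - H0) *v x)) \<le> norm (matrix_inv P) * (e * norm x)"
          by (intro order_trans[OF norm_matrix_vector_mult_le] mult_left_mono mult_right_mono nH) auto
      qed
      also have "\<dots> = e * b * norm x" by (simp add: b_def algebra_simps)
      finally have D: "norm (D *v x) \<le> e * b * norm x" .
      have "\<nu> (D *v x) \<le> C * (e * b * norm x)"
        using c(4)[of "D *v x"] D c(2) by (meson mult_left_mono less_imp_le order_trans)
      also have "\<dots> = (C * (e * b)) * norm x" by simp
      also have "\<dots> \<le> ((q - \<kappa>) * c) * norm x" by (intro mult_right_mono e) auto
      also have "\<dots> = (q - \<kappa>) * (c * norm x)" by simp
      also have "\<dots> \<le> (q - \<kappa>) * \<nu> x" using \<open>\<kappa> < q\<close> by (intro mult_left_mono c) auto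
      finally have D': "\<nu> (D *v x) \<le> (q - \<kappa>) * \<nu> x" .
      have "(mat 1 + matrix_inv A ** H) *v x = (mat 1 + matrix_inv P ** H0) *v x + D *v x"
        by (simp add: D_def matrix_vector_mult_add_rdistrib matrix_vector_mult_diff_rdistrib)
      then show ?thesis
        using tri[of "(mat 1 + matrix_inv P ** H0) *v x" "D *v x"] contr[of x] D'
        by (simp add: algebra_simps)
    qed
  qed
qed

lemma induced_norm_le:
  fixes M :: "real ^ 'n::finite ^ 'n"
  assumes \<nu>: "is_norm \<nu>" and le: "\<And>x. \<nu> (M *v x) \<le> q * \<nu> x"
  shows "induced_norm \<nu> M \<le> q"
  unfolding induced_norm_def
proof (rule cSUP_least)
  obtain k :: 'n where True by simp
  have nz: "\<nu> (axis k 1) \<noteq> 0" and sc: "\<And>a x. \<nu> (a *\<^sub>R x) = \<bar>a\<bar> * \<nu> x" and "0 \<le> \<nu> (axis k 1)"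
    using \<nu> axis_eq_0_iff[of k "1::real"] by (auto simp: is_norm_def)
  then have "\<nu> ((1 / \<nu> (axis k 1)) *\<^sub>R axis k 1) = 1" by simp
  then show "{x. \<nu> x = 1} \<noteq> {}" by blast
  show "\<nu> (M *v x) \<le> q" if "x \<in> {x. \<nu> x = 1}" for x using le[of x] that by simp
qed

lemma continuous_on_induced_norm:
  fixes \<nu> :: "real ^ 'n::finite \<Rightarrow> real"
  assumes \<nu>: "is_norm \<nu>"
  shows "continuous_on UNIV (induced_norm \<nu>)"
proof -
  obtain c C where c: "0 < c" "0 < C" "\<And>x. c * norm x \<le> \<nu> x" "\<And>x. \<nu> x \<le> C * norm x"
    using is_norm_lower[OF \<nu>] is_norm_upper[OF \<nu>] by blast
  have tri: "\<nu> (x + y) \<le> \<nu> x + \<nu> y" for x y using \<nu> by (auto simp: is_norm_def)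
  have bd: "\<nu> (M *v x) \<le> (C / c * norm M) * \<nu> x" for M x
  proof -
    have "\<nu> (M *v x) \<le> C * (norm M * norm x)"
      using c(4)[of "M *v x"] norm_matrix_vector_mult_le[of M x] c(2)
      by (meson mult_left_mono less_imp_le order_trans)
    also have "\<dots> = C * norm M / c * (c * norm x)" using c by simp
    also have "\<dots> \<le> C * norm M / c * \<nu> x" using c by (intro mult_left_mono) auto
    finally show ?thesis by simp
  qed
  have bdd: "bdd_above ((\<lambda>x. \<nu> (M *v x)) ` {x. \<nu> x = 1})" for M
    using bd[of M] by (intro bdd_aboveI2[where M = "C / c * norm M"]) (metis mem_Collect_eq mult.right_neutral)
  have le: "induced_norm \<nu> A \<le> induced_norm \<nu> B + C / c * norm (A - B)" for A B
  proof (rule induced_norm_le[OF \<nu>])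
    fix x
    have op: "\<nu> (B *v x) \<le> induced_norm \<nu> B * \<nu> x"
    proof (cases "x = 0")
      case True
      have "\<nu> (0 :: real ^ 'n) = 0" using \<nu> by (simp add: is_norm_def)
      then show ?thesis using True by simp
    next
      case False
      then have pos: "0 < \<nu> x" using \<nu> unfolding is_norm_def by (metis less_eq_real_def)
      have sc: "\<nu> (a *\<^sub>R x) = \<bar>a\<bar> * \<nu> x" for a x using \<nu> by (auto simp: is_norm_def)
      have "\<nu> (B *v ((1 / \<nu> x) *\<^sub>R x)) \<le> induced_norm \<nu> B"
        unfolding induced_norm_def
        by (rule cSUP_upper[OF _ bdd]) (use pos in \<open>simp add: sc\<close>)
      then show ?thesis using pos by (simp add: matrix_vector_mult_scaleR sc field_simps)
    qed
    have "\<nu> (A *v x) \<le> \<nu> (B *v x) + \<nu> ((A - B) *v x)"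
      using tri[of "B *v x" "(A - B) *v x"] by (simp add: matrix_vector_mult_diff_rdistrib)
    also have "\<dots> \<le> induced_norm \<nu> B * \<nu> x + C / c * norm (A - B) * \<nu> x" by (intro add_mono op bd)
    finally show "\<nu> (A *v x) \<le> (induced_norm \<nu> B + C / c * norm (A - B)) * \<nu> x" by (simp add: algebra_simps)
  qed
  have "(C / c)-lipschitz_on UNIV (induced_norm \<nu>)"
  proof (rule lipschitz_onI)
    show "dist (induced_norm \<nu> A) (induced_norm \<nu> B) \<le> C / c * dist A B" for A B
      using le[of A B] le[of B A] by (auto simp: dist_norm norm_minus_commute)
  qed (use c in simp)
  then show ?thesis by (rule lipschitz_on_continuous_on)
qed

text \<open>For a norm that comes from an inner product the mean value inequality reduces to a real function: apply
  the mean value theorem to the inner product of \<open>\<Psi>\<close> along the segment with \<open>\<Psi> y - \<Psi> x\<close>.\<close>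

lemma qnorm_mean_value:
  fixes \<Psi> :: "real ^ 'n::finite \<Rightarrow> real ^ 'n"
  assumes P: "pd_matrix P" and "convex S" "x \<in> S" "y \<in> S"
    and der: "\<And>t. t \<in> S \<Longrightarrow> (\<Psi> has_derivative (\<lambda>d. D t *v d)) (at t)"
    and le: "\<And>t d. t \<in> S \<Longrightarrow> qnorm P (D t *v d) \<le> q * qnorm P d"
  shows "qnorm P (\<Psi> y - \<Psi> x) \<le> q * qnorm P (y - x)"
proof -
  define w where "w = \<Psi> y - \<Psi> x"
  define g where "g t = x + t *\<^sub>R (y - x)" for t :: real
  have gS: "g t \<in> S" if "0 \<le> t" "t \<le> 1" for t
  proof -
    have "g t = (1 - t) *\<^sub>R x + t *\<^sub>R y" by (simp add: g_def algebra_simps)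
    then show ?thesis using convexD_alt[OF \<open>convex S\<close> \<open>x \<in> S\<close> \<open>y \<in> S\<close>, of t] that by simp
  qed
  have dg: "(g has_derivative (\<lambda>h. h *\<^sub>R (y - x))) (at t within T)" for t T
    using has_derivative_add[OF has_derivative_const[of x] has_derivative_scaleR_left[OF has_derivative_ident]]
    by (simp add: g_def[abs_def])
  have d: "((\<lambda>t. w \<bullet> (P *v \<Psi> (g t))) has_derivative
      (\<lambda>h. w \<bullet> (P *v (D (g t) *v (h *\<^sub>R (y - x)))))) (at t within T)" if "0 \<le> t" "t \<le> 1" for t T
  proof -
    have "((\<lambda>t. \<Psi> (g t)) has_derivative (\<lambda>h. D (g t) *v (h *\<^sub>R (y - x)))) (at t within T)"
      using has_derivative_compose[OF dg der[OF gS[OF that]]] .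
    moreover have "bounded_linear (\<lambda>v. w \<bullet> (P *v v))"
      by (rule bounded_linear_compose[OF bounded_linear_inner_right matrix_vector_mul_bounded_linear])
    ultimately show ?thesis
      using bounded_linear.has_derivative by blast
  qed
  have "\<exists>t\<in>{0<..<1}. w \<bullet> (P *v \<Psi> (g 1)) - w \<bullet> (P *v \<Psi> (g 0))
      = w \<bullet> (P *v (D (g t) *v ((1 - 0) *\<^sub>R (y - x))))"
    by (rule mvt_simple) (use d in auto)
  then obtain t where t: "0 < t" "t < 1" "w \<bullet> (P *v \<Psi> (g 1)) - w \<bullet> (P *v \<Psi> (g 0)) = w \<bullet> (P *v (D (g t) *v (y - x)))"
    by auto
  have "(qnorm P w)\<^sup>2 = w \<bullet> (P *v (D (g t) *v (y - x)))"
    using t(3) by (simp add: qnorm_power2[OF P] w_def g_def matrix_vector_mult_diff_distrib inner_diff_right)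
  also have "\<dots> \<le> qnorm P w * (q * qnorm P (y - x))"
    using qnorm_Cauchy_Schwarz[OF P] le[OF gS] t(1,2) qnorm_nonneg[OF P]
    by (meson less_imp_le mult_left_mono order_trans)
  finally have *: "qnorm P w * qnorm P w \<le> qnorm P w * (q * qnorm P (y - x))" by (simp add: power2_eq_square)
  show ?thesis
  proof (cases "qnorm P w = 0")
    case True
    have "0 \<le> qnorm P (D x *v (y - x))" by (rule qnorm_nonneg[OF P])
    also have "\<dots> \<le> q * qnorm P (y - x)" by (rule le[OF \<open>x \<in> S\<close>])
    finally show ?thesis using True by (simp add: w_def)
  next
    case False
    then have "0 < qnorm P w" using qnorm_nonneg[OF P, of w] by simp
    then show ?thesis using * by (simp add: w_def mult_le_cancel_left_pos)
  qed
qed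

section \<open>Weak law of large numbers\<close>

text \<open>Holding with probability tending to one. Measurability is part of the notion because \<open>measure\<close> is 0
  on non-measurable sets, so that the limit alone would not be monotone in the event.\<close>

definition whp :: "'w measure \<Rightarrow> (nat \<Rightarrow> 'w \<Rightarrow> bool) \<Rightarrow> bool" where
  "whp M P \<longleftrightarrow> (\<forall>N. {\<omega> \<in> space M. P N \<omega>} \<in> sets M) \<and>
     (\<lambda>N. measure M {\<omega> \<in> space M. P N \<omega>}) \<longlonglongrightarrow> 1"

lemma (in prob_space) whp_mono:
  assumes P: "whp M P" and meas: "\<And>N. {\<omega> \<in> space M. Q N \<omega>} \<in> sets M"
    and imp: "eventually (\<lambda>N. \<forall>\<omega>\<in>space M. P N \<omega> \<longrightarrow> Q N \<omega>) sequentially"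
  shows "whp M Q"
proof -
  have "(\<lambda>N. prob {\<omega> \<in> space M. Q N \<omega>}) \<longlonglongrightarrow> 1"
  proof (rule tendsto_sandwich[OF _ _ _ tendsto_const])
    show "(\<lambda>N. prob {\<omega> \<in> space M. P N \<omega>}) \<longlonglongrightarrow> 1" using P by (simp add: whp_def)
    show "\<forall>\<^sub>F N in sequentially. prob {\<omega> \<in> space M. P N \<omega>} \<le> prob {\<omega> \<in> space M. Q N \<omega>}"
      using imp by eventually_elim (intro finite_measure_mono meas, auto)
  qed simp
  then show ?thesis using meas by (simp add: whp_def)
qed

lemma (in prob_space) whp_conj:
  assumes P: "whp M P" and Q: "whp M Q"
  shows "whp M (\<lambda>N \<omega>. P N \<omega> \<and> Q N \<omega>)"
proof -
  let ?A = "\<lambda>N. {\<omega> \<in> space M. P N \<omega>}" and ?B = "\<lambda>N. {\<omega> \<in> space M. Q N \<omega>}"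
  have mP: "?A N \<in> events" and mQ: "?B N \<in> events" for N using P Q by (auto simp: whp_def)
  have eq: "{\<omega> \<in> space M. P N \<omega> \<and> Q N \<omega>} = ?A N \<inter> ?B N" for N by auto
  have "(\<lambda>N. prob (?A N \<inter> ?B N)) \<longlonglongrightarrow> 1"
  proof (rule tendsto_sandwich[OF _ _ _ tendsto_const])
    have "(\<lambda>N. prob (?A N) + prob (?B N) - 1) \<longlonglongrightarrow> 1 + 1 - 1"
      using P Q by (intro tendsto_intros) (simp_all add: whp_def)
    then show "(\<lambda>N. prob (?A N) + prob (?B N) - 1) \<longlonglongrightarrow> 1" by simp
    have "prob (?A N) + prob (?B N) - 1 \<le> prob (?A N \<inter> ?B N)" for N
      using measure_Un3[of "?A N" M "?B N"] mP mQ prob_le_1[of "?A N \<union> ?B N"] by (simp add: fmeasurable_eq_sets)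
    then show "\<forall>\<^sub>F N in sequentially. prob (?A N) + prob (?B N) - 1 \<le> prob (?A N \<inter> ?B N)" by simp
  qed simp
  then show ?thesis using mP mQ by (auto simp: whp_def eq)
qed

lemma (in prob_space) whp_finite_ball:
  assumes "finite I" "\<And>i. i \<in> I \<Longrightarrow> whp M (P i)"
  shows "whp M (\<lambda>N \<omega>. \<forall>i\<in>I. P i N \<omega>)"
  using assms
proof (induction I)
  case empty
  show ?case by (simp add: whp_def prob_space)
next
  case (insert i I)
  then have "whp M (\<lambda>N \<omega>. P i N \<omega> \<and> (\<forall>i\<in>I. P i N \<omega>))" by (intro whp_conj) auto
  then show ?case by simp
qed

text \<open>Chebyshev's inequality; the variance of the empirical mean is computed from products of pairs, whose
  expectations factor by independence.\<close>

lemma (in prob_space) weak_law_of_large_numbers: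
  fixes Y :: "nat \<Rightarrow> 'a \<Rightarrow> real"
  assumes indep: "indep_vars (\<lambda>_. borel) Y {1..}"
    and int2: "\<And>n. 1 \<le> n \<Longrightarrow> integrable M (\<lambda>\<omega>. (Y n \<omega>)\<^sup>2)"
    and mean: "\<And>n. 1 \<le> n \<Longrightarrow> expectation (Y n) = m"
    and second: "\<And>n. 1 \<le> n \<Longrightarrow> expectation (\<lambda>\<omega>. (Y n \<omega>)\<^sup>2) = s"
    and "0 < \<epsilon>"
  shows "whp M (\<lambda>N \<omega>. \<bar>(1 / real N) * (\<Sum>n = 1..N. Y n \<omega>) - m\<bar> < \<epsilon>)"
proof -
  have Ym: "Y n \<in> borel_measurable M" if "1 \<le> n" for n
    using indep that unfolding indep_vars_def by simp
  have Yi: "integrable M (Y n)" if "1 \<le> n" for n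
    using square_integrable_imp_integrable[OF Ym int2] that by simp
  define S where "S N \<omega> = (1 / real N) * (\<Sum>n = 1..N. Y n \<omega>)" for N \<omega>
  have Sm: "S N \<in> borel_measurable M" for N
    unfolding S_def using Ym by (intro borel_measurable_times borel_measurable_sum) auto
  have pair: "indep_var borel (Y i) borel (Y j)" if "i \<noteq> j" "1 \<le> i" "1 \<le> j" for i j
    using indep_vars_sum[of "{j}" i Y] indep_vars_subset[OF indep, of "{i, j}"] that by simp
  have cross: "integrable M (\<lambda>\<omega>. Y i \<omega> * Y j \<omega>)"
    "expectation (\<lambda>\<omega>. Y i \<omega> * Y j \<omega>) = (if i = j then s else m * m)" if "1 \<le> i" "1 \<le> j" for i j
  proof -
    show "integrable M (\<lambda>\<omega>. Y i \<omega> * Y j \<omega>)"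
    proof (cases "i = j")
      case True
      then show ?thesis using int2[OF that(1)] by (simp add: power2_eq_square)
    next
      case False
      then have "indep_var borel (Y i) borel (Y j)"
        by (rule pair[OF _ that])
      then show ?thesis by (rule indep_var_integrable) (use Yi that in auto)
    qed
    show "expectation (\<lambda>\<omega>. Y i \<omega> * Y j \<omega>) = (if i = j then s else m * m)"
    proof (cases "i = j")
      case True
      then show ?thesis using second[OF that(1)] by (simp add: power2_eq_square)
    next
      case False
      then have "indep_var borel (Y i) borel (Y j)"
        by (rule pair[OF _ that])
      then show ?thesis
        using False indep_var_lebesgue_integral[of "Y i" "Y j"] Yi mean that by simp
    qed
  qed
  have sq: "(S N \<omega>)\<^sup>2 = (1 / real N)\<^sup>2 * (\<Sum>i = 1..N. \<Sum>j = 1..N. Y i \<omega> * Y j \<omega>)" for N \<omega>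
    by (simp add: S_def power_mult_distrib power_divide power2_eq_square[of "sum _ _"] sum_product)
  have Si: "integrable M (\<lambda>\<omega>. (S N \<omega>)\<^sup>2)" for N
    unfolding sq
    by (intro integrable_mult_right Bochner_Integration.integrable_sum cross(1)) auto
  have ES: "expectation (S N) = m" if "1 \<le> N" for N
  proof -
    have "expectation (S N) = (1 / real N) * (\<Sum>n = 1..N. m)"
      unfolding S_def using Yi by (simp add: mean)
    then show ?thesis using that by simp
  qed
  have ES2: "expectation (\<lambda>\<omega>. (S N \<omega>)\<^sup>2) = m\<^sup>2 + (s - m\<^sup>2) / real N" if "1 \<le> N" for N
  proof -
    have "expectation (\<lambda>\<omega>. (S N \<omega>)\<^sup>2) = (1 / real N)\<^sup>2 * (\<Sum>i = 1..N. \<Sum>j = 1..N. if i = j then s else m * m)"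
    proof -
      have "expectation (\<lambda>\<omega>. \<Sum>i = 1..N. \<Sum>j = 1..N. Y i \<omega> * Y j \<omega>)
          = (\<Sum>i = 1..N. expectation (\<lambda>\<omega>. \<Sum>j = 1..N. Y i \<omega> * Y j \<omega>))"
        by (intro Bochner_Integration.integral_sum Bochner_Integration.integrable_sum cross(1)) auto
      also have "\<dots> = (\<Sum>i = 1..N. \<Sum>j = 1..N. expectation (\<lambda>\<omega>. Y i \<omega> * Y j \<omega>))"
        by (intro sum.cong refl Bochner_Integration.integral_sum cross(1)) auto
      also have "\<dots> = (\<Sum>i = 1..N. \<Sum>j = 1..N. if i = j then s else m * m)"
        by (intro sum.cong refl cross(2)) auto
      finally show ?thesis unfolding sq by simp
    qed
    also have "(\<Sum>i = 1..N. \<Sum>j = 1..N. if i = j then s else m * m)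
        = (\<Sum>i = 1..N. \<Sum>j = 1..N. (if j = i then s - m * m else 0) + m * m)"
      by (intro sum.cong) auto
    also have "\<dots> = real N * (s - m * m) + real N * real N * (m * m)"
      by (simp add: sum.distrib algebra_simps)
    finally have "expectation (\<lambda>\<omega>. (S N \<omega>)\<^sup>2)
        = (1 / real N)\<^sup>2 * (real N * (s - m * m) + real N * real N * (m * m))" .
    also have "\<dots> = m\<^sup>2 + (s - m\<^sup>2) / real N"
      using that by (simp add: field_simps power2_eq_square)
    finally show ?thesis .
  qed
  have var: "variance (S N) = (s - m\<^sup>2) / real N" if "1 \<le> N" for N
    using variance_eq[OF square_integrable_imp_integrable[OF Sm Si] Si, of N] ES[OF that] ES2[OF that] by simp
  let ?E = "\<lambda>N. {\<omega> \<in> space M. \<bar>S N \<omega> - m\<bar> < \<epsilon>}"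
  have mE: "?E N \<in> events" for N using Sm by measurable
  have "(\<lambda>N. prob (?E N)) \<longlonglongrightarrow> 1"
  proof (rule tendsto_sandwich[OF _ _ _ tendsto_const])
    have "(\<lambda>N. 1 - ((s - m\<^sup>2) / \<epsilon>\<^sup>2) * inverse (real N)) \<longlonglongrightarrow> 1 - ((s - m\<^sup>2) / \<epsilon>\<^sup>2) * 0"
      by (intro tendsto_intros lim_inverse_n)
    then show "(\<lambda>N. 1 - ((s - m\<^sup>2) / \<epsilon>\<^sup>2) * inverse (real N)) \<longlonglongrightarrow> 1" by simp
    have "1 - ((s - m\<^sup>2) / \<epsilon>\<^sup>2) * inverse (real N) \<le> prob (?E N)" if "1 \<le> N" for N
    proof -
      have "prob {\<omega> \<in> space M. \<epsilon> \<le> \<bar>S N \<omega> - expectation (S N)\<bar>} \<le> variance (S N) / \<epsilon>\<^sup>2"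
        by (rule Chebyshev_inequality[OF Sm Si \<open>0 < \<epsilon>\<close>])
      moreover have "space M - ?E N = {\<omega> \<in> space M. \<epsilon> \<le> \<bar>S N \<omega> - m\<bar>}" by auto
      ultimately have "prob (space M - ?E N) \<le> ((s - m\<^sup>2) / real N) / \<epsilon>\<^sup>2"
        using var[OF that] ES[OF that] by simp
      then show ?thesis using prob_compl[OF mE, of N] by (simp add: field_simps)
    qed
    then show "\<forall>\<^sub>F N in sequentially. 1 - ((s - m\<^sup>2) / \<epsilon>\<^sup>2) * inverse (real N) \<le> prob (?E N)"
      by (auto simp: eventually_sequentially)
  qed simp
  then show ?thesis using mE by (simp add: whp_def S_def)
qed

section \<open>Polynomially bounded functions and Gaussian decay\<close>

text \<open>The integrands below belong to this algebra. Its elements are integrable against a density with Gaussian decay, and so are their squares, as the weak law demands.\<close>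

definition poly_bounded :: "('a::euclidean_space \<Rightarrow> real) \<Rightarrow> bool" where
  "poly_bounded g \<longleftrightarrow> g \<in> borel_measurable borel \<and> (\<exists>C k. \<forall>z. \<bar>g z\<bar> \<le> C * (1 + norm z) ^ k)"

lemma poly_boundedI:
  "g \<in> borel_measurable borel \<Longrightarrow> (\<And>z. \<bar>g z\<bar> \<le> C * (1 + norm z) ^ k) \<Longrightarrow> poly_bounded g"
  by (auto simp: poly_bounded_def)

lemma poly_boundedD:
  assumes "poly_bounded g"
  shows "\<exists>C k. 0 \<le> C \<and> (\<forall>z. \<bar>g z\<bar> \<le> C * (1 + norm z) ^ k)"
proof -
  obtain C k where C: "\<And>z. \<bar>g z\<bar> \<le> C * (1 + norm z) ^ k" using assms by (auto simp: poly_bounded_def)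
  have "\<bar>g z\<bar> \<le> \<bar>C\<bar> * (1 + norm z) ^ k" for z
    by (rule order_trans[OF C]) (intro mult_right_mono, auto)
  then show ?thesis using abs_ge_zero[of C] by blast
qed

lemma poly_bounded_measurable: "poly_bounded g \<Longrightarrow> g \<in> borel_measurable borel"
  by (simp add: poly_bounded_def)

lemma poly_bounded_mono:
  assumes "poly_bounded h" "g \<in> borel_measurable borel" "\<And>z. \<bar>g z\<bar> \<le> \<bar>h z\<bar>"
  shows "poly_bounded g"
  using assms by (meson order_trans poly_bounded_def)

lemma poly_bounded_const: "poly_bounded (\<lambda>z. c)"
  by (rule poly_boundedI[where C = "\<bar>c\<bar>" and k = 0]) auto

lemma poly_bounded_add:
  assumes "poly_bounded f" "poly_bounded g" shows "poly_bounded (\<lambda>z. f z + g z)"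
proof -
  obtain C k where C: "0 \<le> C" "\<And>z. \<bar>f z\<bar> \<le> C * (1 + norm z) ^ k" using poly_boundedD[OF assms(1)] by blast
  obtain D l where D: "0 \<le> D" "\<And>z. \<bar>g z\<bar> \<le> D * (1 + norm z) ^ l" using poly_boundedD[OF assms(2)] by blast
  show ?thesis
  proof (rule poly_boundedI)
    show "\<bar>f z + g z\<bar> \<le> (C + D) * (1 + norm z) ^ (k + l)" for z
    proof -
      have "C * (1 + norm z) ^ k \<le> C * (1 + norm z) ^ (k + l)"
        "D * (1 + norm z) ^ l \<le> D * (1 + norm z) ^ (k + l)"
        using C(1) D(1) by (auto intro!: mult_left_mono power_increasing)
      then show ?thesis using C(2)[of z] D(2)[of z] by (simp add: distrib_right)
    qed
  qed (use assms[THEN poly_bounded_measurable] in measurable)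
qed

lemma poly_bounded_mult:
  assumes "poly_bounded f" "poly_bounded g" shows "poly_bounded (\<lambda>z. f z * g z)"
proof -
  obtain C k where C: "0 \<le> C" "\<And>z. \<bar>f z\<bar> \<le> C * (1 + norm z) ^ k" using poly_boundedD[OF assms(1)] by blast
  obtain D l where D: "0 \<le> D" "\<And>z. \<bar>g z\<bar> \<le> D * (1 + norm z) ^ l" using poly_boundedD[OF assms(2)] by blast
  show ?thesis
  proof (rule poly_boundedI)
    show "\<bar>f z * g z\<bar> \<le> (C * D) * (1 + norm z) ^ (k + l)" for z
      using mult_mono[OF C(2)[of z] D(2)[of z]] C(1) D(1) by (simp add: abs_mult power_add algebra_simps)
  qed (use assms[THEN poly_bounded_measurable] in measurable)
qed

lemma poly_bounded_minus: "poly_bounded f \<Longrightarrow> poly_bounded (\<lambda>z. - f z)"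
  using poly_bounded_mult[OF poly_bounded_const[of "-1"], of f] by simp

lemma poly_bounded_diff: "poly_bounded f \<Longrightarrow> poly_bounded g \<Longrightarrow> poly_bounded (\<lambda>z. f z - g z)"
  using poly_bounded_add[OF _ poly_bounded_minus, of f g] by simp

lemma poly_bounded_sum:
  "(\<And>i. i \<in> I \<Longrightarrow> poly_bounded (f i)) \<Longrightarrow> poly_bounded (\<lambda>z. \<Sum>i\<in>I. f i z)"
  by (induction I rule: infinite_finite_induct) (auto intro: poly_bounded_const poly_bounded_add)

lemma poly_bounded_power: "poly_bounded f \<Longrightarrow> poly_bounded (\<lambda>z. f z ^ n)"
  by (induction n) (auto intro: poly_bounded_const poly_bounded_mult)

lemma poly_bounded_linear:
  assumes "bounded_linear f" shows "poly_bounded f"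
proof -
  obtain K where "0 < K" "\<And>x. norm (f x) \<le> norm x * K" using bounded_linear.pos_bounded[OF assms] by blast
  then have "\<bar>f z\<bar> \<le> K * (1 + norm z) ^ 1" for z
    by (smt (verit) mult.commute mult_left_mono power_one_right real_norm_def distrib_left)
  then show ?thesis
    using borel_measurable_continuous_onI[OF linear_continuous_on[OF assms]] by (rule poly_boundedI[rotated])
qed

lemmas poly_bounded_intros = poly_bounded_const poly_bounded_add poly_bounded_mult poly_bounded_minus
  poly_bounded_diff poly_bounded_sum poly_bounded_power

lemma integrable_exp_neg_norm_sq:
  assumes "0 < c" shows "integrable lborel (\<lambda>z :: 'a::euclidean_space. exp (- c * (norm z)\<^sup>2))"
proof (rule integrableI_nonneg)
  define \<sigma> where "\<sigma> = 1 / sqrt (2 * c)"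
  have \<sigma>: "0 < \<sigma>" "\<sigma>\<^sup>2 = 1 / (2 * c)" using assms by (simp_all add: \<sigma>_def power_divide)
  have "exp (- c * x\<^sup>2) = sqrt (2 * pi * \<sigma>\<^sup>2) * normal_density 0 \<sigma> x" for x
    using assms \<sigma> by (simp add: normal_density_def field_simps)
  then have "integrable lborel (\<lambda>x :: real. exp (- c * x\<^sup>2))"
    using integrable_normal_density[OF \<sigma>(1), of 0] by simp
  then have fin: "(\<integral>\<^sup>+ x. ennreal (exp (- c * x\<^sup>2)) \<partial>lborel) < \<infinity>"
    by (simp add: integrable_iff_bounded)
  have "(norm z)\<^sup>2 = (\<Sum>b\<in>Basis. (z \<bullet> b)\<^sup>2)" for z :: 'a
    unfolding power2_norm_eq_inner by (subst euclidean_inner) (simp add: power2_eq_square)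
  then have "ennreal (exp (- c * (norm z)\<^sup>2)) = (\<Prod>b\<in>Basis. ennreal (exp (- c * (z \<bullet> b)\<^sup>2)))" for z :: 'a
    by (simp add: prod_ennreal exp_sum[symmetric] sum_distrib_left sum_negf)
  then have "(\<integral>\<^sup>+ z. ennreal (exp (- c * (norm (z::'a))\<^sup>2)) \<partial>lborel)
      = (\<Prod>b\<in>(Basis :: 'a set). \<integral>\<^sup>+ x. ennreal (exp (- c * x\<^sup>2)) \<partial>lborel)"
    using nn_integral_lborel_prod[of "\<lambda>b x. ennreal (exp (- c * x\<^sup>2))"] by simp
  also have "\<dots> < \<infinity>" using fin by (simp add: power_less_top_ennreal)
  finally show "(\<integral>\<^sup>+ z. ennreal (exp (- c * (norm (z::'a))\<^sup>2)) \<partial>lborel) < \<infinity>" .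
qed auto

lemma integrable_gaussian_decay:
  fixes f g :: "'a::euclidean_space \<Rightarrow> real"
  assumes "0 < c" and f: "f \<in> borel_measurable borel" "\<And>z. \<bar>f z\<bar> \<le> C * exp (- c * (norm z)\<^sup>2)"
    and g: "poly_bounded g"
  shows "integrable lborel (\<lambda>z. f z * g z)"
proof -
  obtain D k where D: "0 \<le> D" "\<And>z. \<bar>g z\<bar> \<le> D * (1 + norm z) ^ k" using poly_boundedD[OF g] by blast
  have C: "0 \<le> C" using f(2)[of 0] by simp
  \<comment> \<open>From 1 + t \<le> exp t and \<open>k t \<le> k\<^sup>2 / (2 c) + c t\<^sup>2 / 2\<close>; half of the decay absorbs the polynomial.\<close>
  define K where "K = exp ((real k)\<^sup>2 / (2 * c))"
  have pow: "(1 + t) ^ k \<le> K * exp (c / 2 * t\<^sup>2)" if "0 \<le> t" for t :: real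
  proof -
    have "(1 + t) ^ k \<le> exp t ^ k" using that by (intro power_mono exp_ge_add_one_self) auto
    also have "\<dots> = exp (real k * t)" by (simp add: exp_of_nat_mult)
    also have "\<dots> \<le> exp ((real k)\<^sup>2 / (2 * c) + c / 2 * t\<^sup>2)"
    proof -
      have "0 \<le> (real k - c * t)\<^sup>2 / (2 * c)" using \<open>0 < c\<close> by simp
      also have "\<dots> = (real k)\<^sup>2 / (2 * c) + c / 2 * t\<^sup>2 - real k * t"
        using \<open>0 < c\<close> by (simp add: field_simps power2_eq_square)
      finally show ?thesis by simp
    qed
    finally show ?thesis by (simp add: K_def exp_add)
  qed
  show ?thesis
  proof (rule Bochner_Integration.integrable_bound)
    show "integrable lborel (\<lambda>z::'a. (C * D * K) * exp (- (c / 2) * (norm z)\<^sup>2))"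
      using integrable_exp_neg_norm_sq[where c = "c / 2" and 'a = 'a] \<open>0 < c\<close> by simp
    show "(\<lambda>z. f z * g z) \<in> borel_measurable lborel" using f poly_bounded_measurable[OF g] by simp
    have "\<bar>f z * g z\<bar> \<le> \<bar>(C * D * K) * exp (- (c / 2) * (norm z)\<^sup>2)\<bar>" for z
    proof -
      have "\<bar>f z * g z\<bar> \<le> (C * exp (- c * (norm z)\<^sup>2)) * (D * (K * exp (c / 2 * (norm z)\<^sup>2)))"
        unfolding abs_mult using C D(1)
        by (intro mult_mono f(2) order_trans[OF D(2)] mult_left_mono pow) auto
      also have "\<dots> = (C * D * K) * (exp (- c * (norm z)\<^sup>2) * exp (c / 2 * (norm z)\<^sup>2))" by simp
      also have "exp (- c * (norm z)\<^sup>2) * exp (c / 2 * (norm z)\<^sup>2) = exp (- (c / 2) * (norm z)\<^sup>2)"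
        by (simp add: exp_add[symmetric])
      finally show ?thesis by linarith
    qed
    then show "AE z in lborel. norm (f z * g z) \<le> norm ((C * D * K) * exp (- (c / 2) * (norm z)\<^sup>2))" by simp
  qed
qed

section \<open>Scores of the labelled model\<close>

definition mk_param :: "real ^ 'd::finite \<Rightarrow> real \<Rightarrow> real \<Rightarrow> 'd param" where
  "mk_param m a b = (\<chi> k. case k of Inl i \<Rightarrow> m $ i | Inr j \<Rightarrow> if j = 1 then a else b)"

lemma two_neq_one_2 [simp]: "(2::2) \<noteq> 1" "(1::2) \<noteq> 2"
  by auto

lemma mk_param_nth [simp]:
  "mk_param m a b $ Inl i = m $ i" "mk_param m a b $ Inr 1 = a" "mk_param m a b $ Inr 2 = b"
  by (simp_all add: mk_param_def)

lemma param_sel_mk [simp]: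
  "mean_of (mk_param m a b) = m" "prob_of (mk_param m a b) = a" "var_of (mk_param m a b) = b"
  by (simp_all add: mean_of_def prob_of_def var_of_def vec_eq_iff)

lemma param_index_cases:
  obtains i where "k = Inl i" | "k = Inr (1::2)" | "k = Inr 2"
  by (cases k) (use exhaust_2 in auto)

lemma sum_param_index:
  fixes f :: "'d::finite + 2 \<Rightarrow> real"
  shows "sum f UNIV = (\<Sum>i\<in>UNIV. f (Inl i)) + f (Inr 1) + f (Inr 2)"
proof -
  have "sum f UNIV = sum f (UNIV <+> UNIV)" by simp
  also have "\<dots> = (\<Sum>i\<in>UNIV. f (Inl i)) + (\<Sum>j\<in>UNIV. f (Inr j))"
    by (subst sum.Plus) auto
  finally show ?thesis by (simp add: UNIV_2)
qed

text \<open>Identifies gradients: a derivative that is a linear expression in the three parts of the direction is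
  an inner product with the corresponding \<open>mk_param\<close>.\<close>

lemma inner_param:
  "d \<bullet> v = mean_of d \<bullet> mean_of v + prob_of d * prob_of v + var_of d * var_of v"
  by (simp add: inner_vec_def sum_param_index mean_of_def prob_of_def var_of_def)

lemma bounded_linear_sel:
  "bounded_linear (\<lambda>\<theta> :: 'd::finite param. h \<bullet> mean_of \<theta>)"
  "bounded_linear (prob_of :: 'd param \<Rightarrow> real)"
  "bounded_linear (var_of :: 'd param \<Rightarrow> real)"
proof -
  have "(\<lambda>\<theta> :: 'd param. h \<bullet> mean_of \<theta>) = (\<lambda>\<theta>. \<theta> \<bullet> mk_param h 0 0)"
    by (simp add: inner_param inner_commute)
  then show "bounded_linear (\<lambda>\<theta> :: 'd param. h \<bullet> mean_of \<theta>)" by (simp add: bounded_linear_inner_left)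
  show "bounded_linear (prob_of :: 'd param \<Rightarrow> real)" "bounded_linear (var_of :: 'd param \<Rightarrow> real)"
    unfolding prob_of_def var_of_def by (rule bounded_linear_vec_nth)+
qed

lemmas has_derivative_sel [derivative_intros] =
  bounded_linear_sel(1)[THEN bounded_linear.has_derivative]
  bounded_linear_sel(2)[THEN bounded_linear.has_derivative]
  bounded_linear_sel(3)[THEN bounded_linear.has_derivative]

lemmas continuous_on_sel [continuous_intros] =
  bounded_linear_sel(1)[THEN bounded_linear.continuous_on]
  bounded_linear_sel(2)[THEN bounded_linear.continuous_on]
  bounded_linear_sel(3)[THEN bounded_linear.continuous_on]

lemma open_param_space: "open (param_space :: 'd::finite param set)"
  unfolding param_space_def
  by (intro open_Collect_conj open_Collect_less continuous_intros)

lemma param_spaceD: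
  "\<theta> \<in> param_space \<Longrightarrow> 0 < prob_of \<theta>" "\<theta> \<in> param_space \<Longrightarrow> prob_of \<theta> < 1"
  "\<theta> \<in> param_space \<Longrightarrow> 0 < var_of \<theta>"
  by (auto simp: param_space_def)

text \<open>The component label \<open>x\<close> is a real number restricted to 0 and 1: the component without regression is
  the one with mean \<open>0 \<cdot> (h \<bullet> \<mu>)\<close>, and every formula below covers both components at once.\<close>

definition resid :: "real \<Rightarrow> 'd::finite obs \<Rightarrow> 'd param \<Rightarrow> real" where
  "resid x z \<theta> = fst z - x * (snd z \<bullet> mean_of \<theta>)"

definition comp_weight :: "real \<Rightarrow> 'd::finite param \<Rightarrow> real" where
  "comp_weight x \<theta> = x * prob_of \<theta> + (1 - x) * (1 - prob_of \<theta>)"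

definition comp_density :: "real \<Rightarrow> 'd::finite obs \<Rightarrow> 'd param \<Rightarrow> real" where
  "comp_density x z \<theta> = comp_weight x \<theta> * gauss (x * (snd z \<bullet> mean_of \<theta>)) (var_of \<theta>) (fst z)"

definition comp_resp :: "real \<Rightarrow> 'd::finite obs \<Rightarrow> 'd param \<Rightarrow> real" where
  "comp_resp x z \<theta> = comp_density x z \<theta> / (comp_density 1 z \<theta> + comp_density 0 z \<theta>)"

text \<open>The gradient of \<open>ln (comp_density x z \<theta>)\<close> in \<open>\<theta>\<close>, the last coordinate being the variance.\<close>

definition score :: "real \<Rightarrow> 'd::finite obs \<Rightarrow> 'd param \<Rightarrow> 'd param" where
  "score x z \<theta> = mk_param ((x * resid x z \<theta> / var_of \<theta>) *\<^sub>R snd z)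
     (x / prob_of \<theta> - (1 - x) / (1 - prob_of \<theta>))
     ((resid x z \<theta>)\<^sup>2 / (2 * (var_of \<theta>)\<^sup>2) - 1 / (2 * var_of \<theta>))"

text \<open>Row \<open>k\<close> of the derivative of the score.\<close>

definition dscore :: "real \<Rightarrow> 'd::finite obs \<Rightarrow> 'd param \<Rightarrow> 'd + 2 \<Rightarrow> 'd param" where
  "dscore x z \<theta> k = (case k of
      Inl i \<Rightarrow> mk_param ((- (x\<^sup>2) * snd z $ i / var_of \<theta>) *\<^sub>R snd z) 0
                 (- x * resid x z \<theta> * snd z $ i / (var_of \<theta>)\<^sup>2)
    | Inr j \<Rightarrow> if j = 1 then mk_param 0 (- x / (prob_of \<theta>)\<^sup>2 - (1 - x) / (1 - prob_of \<theta>)\<^sup>2) 0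
        else mk_param ((- x * resid x z \<theta> / (var_of \<theta>)\<^sup>2) *\<^sub>R snd z) 0
               (1 / (2 * (var_of \<theta>)\<^sup>2) - (resid x z \<theta>)\<^sup>2 / (var_of \<theta>) ^ 3))"

lemma comp_weight_pos:
  "\<theta> \<in> param_space \<Longrightarrow> x \<in> {0, 1} \<Longrightarrow> 0 < comp_weight x \<theta>"
  by (auto simp: comp_weight_def param_space_def)

lemma gauss_pos: "0 < v \<Longrightarrow> 0 < gauss m v y"
  by (simp add: gauss_def normal_density_pos)

lemma comp_density_pos:
  "\<theta> \<in> param_space \<Longrightarrow> x \<in> {0, 1} \<Longrightarrow> 0 < comp_density x z \<theta>"
  unfolding comp_density_def by (intro mult_pos_pos comp_weight_pos gauss_pos) (auto dest: param_spaceD)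

lemma mix_density_eq:
  "mix_density \<theta> z = std_gauss_vec (snd z) * (comp_density 1 z \<theta> + comp_density 0 z \<theta>)"
  by (simp add: mix_density_def comp_density_def comp_weight_def split_beta)

lemma resp_eq: "resp z \<theta> = comp_resp 1 z \<theta>"
  by (simp add: resp_def comp_resp_def comp_density_def comp_weight_def split_beta)

lemma comp_resp_bounds:
  assumes "\<theta> \<in> param_space" "x \<in> {0, 1}"
  shows "0 < comp_resp x z \<theta>" "comp_resp x z \<theta> \<le> 1"
  using comp_density_pos[OF assms(1), of 0 z] comp_density_pos[OF assms(1), of 1 z] assms(2)
  by (auto simp: comp_resp_def field_simps)

lemma comp_resp_sum:
  assumes "\<theta> \<in> param_space"
  shows "comp_resp 1 z \<theta> + comp_resp 0 z \<theta> = 1"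
  using comp_density_pos[OF assms, of 0 z] comp_density_pos[OF assms, of 1 z]
  by (simp add: comp_resp_def flip: add_divide_distrib)

lemma has_derivative_resid:
  "(resid x z has_derivative (\<lambda>d. - x * (snd z \<bullet> mean_of d))) (at \<theta>)"
  unfolding resid_def by (rule derivative_eq_intros refl)+ simp

text \<open>Logarithmic derivative: the density is the exponential of a sum of elementary terms.\<close>

lemma GDERIV_comp_density:
  assumes \<theta>: "\<theta> \<in> param_space" and x: "x \<in> {0, 1}"
  shows "GDERIV (comp_density x z) \<theta> :> comp_density x z \<theta> *\<^sub>R score x z \<theta>"
proof -
  define L where "L \<theta> = ln (comp_weight x \<theta>) - ln (2 * pi * var_of \<theta>) / 2
      - (resid x z \<theta>)\<^sup>2 / (2 * var_of \<theta>)" for \<theta>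
  have eq: "comp_density x z t = exp (L t)" if "t \<in> param_space" for t
  proof -
    have "exp (L t) = exp (ln (comp_weight x t)) * exp (- (ln (2 * pi * var_of t) / 2))
        * exp (- ((resid x z t)\<^sup>2 / (2 * var_of t)))"
      by (simp add: L_def flip: exp_add)
    also have "exp (- (ln (2 * pi * var_of t) / 2)) = 1 / sqrt (2 * pi * var_of t)"
      using param_spaceD(3)[OF that] ln_sqrt[of "2 * pi * var_of t"]
      by (simp add: exp_minus inverse_eq_divide flip: ln_sqrt)
    finally show ?thesis using comp_weight_pos[OF that x] param_spaceD(3)[OF that]
      by (simp add: comp_density_def gauss_def normal_density_def resid_def power2_commute)
  qed
  note pos = param_spaceD[OF \<theta>] comp_weight_pos[OF \<theta> x]
  have "(L has_derivative (\<lambda>d. d \<bullet> score x z \<theta>)) (at \<theta>)"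
  proof -
    have w: "(comp_weight x has_derivative (\<lambda>d. x * prob_of d - (1 - x) * prob_of d)) (at \<theta>)"
      unfolding comp_weight_def by (rule derivative_eq_intros refl)+ simp
    have "(L has_derivative (\<lambda>d. (x * prob_of d - (1 - x) * prob_of d) / comp_weight x \<theta>
        - (2 * pi * var_of d) / (2 * pi * var_of \<theta>) / 2
        - ((2 * resid x z \<theta> * (- x * (snd z \<bullet> mean_of d))) * (2 * var_of \<theta>) - (resid x z \<theta>)\<^sup>2 * (2 * var_of d))
          / ((2 * var_of \<theta>) * (2 * var_of \<theta>)))) (at \<theta>)"
      unfolding L_def using pos
      by (auto intro!: derivative_eq_intros w has_derivative_resid simp: field_simps)
    moreover have "(x * prob_of d - (1 - x) * prob_of d) / comp_weight x \<theta>
        - (2 * pi * var_of d) / (2 * pi * var_of \<theta>) / 2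
        - ((2 * resid x z \<theta> * (- x * (snd z \<bullet> mean_of d))) * (2 * var_of \<theta>) - (resid x z \<theta>)\<^sup>2 * (2 * var_of d))
          / ((2 * var_of \<theta>) * (2 * var_of \<theta>)) = d \<bullet> score x z \<theta>" for d
    proof -
      have 1: "(x * prob_of d - (1 - x) * prob_of d) / comp_weight x \<theta>
          = prob_of d * (x / prob_of \<theta> - (1 - x) / (1 - prob_of \<theta>))"
        using x pos by (auto simp: comp_weight_def field_simps)
      show ?thesis unfolding 1 using pos
        by (simp add: inner_param score_def inner_commute field_simps power2_eq_square)
    qed
    ultimately show ?thesis by simp
  qed
  then have "GDERIV L \<theta> :> score x z \<theta>" by (simp add: gderiv_def)
  then have "GDERIV (\<lambda>t. exp (L t)) \<theta> :> exp (L \<theta>) *\<^sub>R score x z \<theta>"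
    by (rule GDERIV_DERIV_compose) (rule DERIV_exp)
  then show ?thesis
    unfolding gderiv_def eq[OF \<theta>, symmetric]
    by (rule has_derivative_transform_within_open[OF _ open_param_space \<theta>]) (simp add: eq)
qed

text \<open>The responsibility is a logistic function of the difference of the log densities.\<close>

lemma GDERIV_comp_resp1:
  assumes \<theta>: "\<theta> \<in> param_space"
  shows "GDERIV (comp_resp 1 z) \<theta> :>
    (comp_resp 1 z \<theta> * comp_resp 0 z \<theta>) *\<^sub>R (score 1 z \<theta> - score 0 z \<theta>)"
proof -
  let ?a = "comp_density 1 z \<theta>" and ?b = "comp_density 0 z \<theta>"
  have pos: "0 < ?a" "0 < ?b" using comp_density_pos[OF \<theta>] by auto
  have "GDERIV (\<lambda>t. comp_density 1 z t * inverse (comp_density 1 z t + comp_density 0 z t)) \<theta> :>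
      ?a *\<^sub>R (- (inverse (?a + ?b))\<^sup>2 *\<^sub>R (?a *\<^sub>R score 1 z \<theta> + ?b *\<^sub>R score 0 z \<theta>))
      + inverse (?a + ?b) *\<^sub>R (?a *\<^sub>R score 1 z \<theta>)"
    by (intro GDERIV_mult GDERIV_inverse GDERIV_add GDERIV_comp_density \<theta>) (use pos in auto)
  moreover have "?a *\<^sub>R (- (inverse (?a + ?b))\<^sup>2 *\<^sub>R (?a *\<^sub>R score 1 z \<theta> + ?b *\<^sub>R score 0 z \<theta>))
      + inverse (?a + ?b) *\<^sub>R (?a *\<^sub>R score 1 z \<theta>)
      = (comp_resp 1 z \<theta> * comp_resp 0 z \<theta>) *\<^sub>R (score 1 z \<theta> - score 0 z \<theta>)"
    using pos by (simp add: vec_eq_iff comp_resp_def divide_simps power2_eq_square) (simp add: algebra_simps)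
  ultimately show ?thesis unfolding comp_resp_def[abs_def] by (simp add: divide_inverse)
qed

lemma GDERIV_loglik:
  assumes \<theta>: "\<theta> \<in> param_space"
  shows "GDERIV (loglik z) \<theta> :> comp_resp 1 z \<theta> *\<^sub>R score 1 z \<theta> + comp_resp 0 z \<theta> *\<^sub>R score 0 z \<theta>"
proof -
  let ?a = "comp_density 1 z \<theta>" and ?b = "comp_density 0 z \<theta>"
  have pos: "0 < ?a" "0 < ?b" using comp_density_pos[OF \<theta>] by auto
  have g: "0 < std_gauss_vec (snd z)" by (simp add: std_gauss_vec_def)
  have "GDERIV (\<lambda>t. comp_density 1 z t + comp_density 0 z t) \<theta> :> ?a *\<^sub>R score 1 z \<theta> + ?b *\<^sub>R score 0 z \<theta>"
    by (intro GDERIV_add GDERIV_comp_density \<theta>) auto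
  moreover have "DERIV (\<lambda>u. ln (std_gauss_vec (snd z) * u)) (?a + ?b) :> 1 / (?a + ?b)"
    using pos g by (auto intro!: derivative_eq_intros mult_pos_pos add_pos_pos)
  ultimately have "GDERIV (\<lambda>t. ln (std_gauss_vec (snd z) * (comp_density 1 z t + comp_density 0 z t))) \<theta> :>
      (1 / (?a + ?b)) *\<^sub>R (?a *\<^sub>R score 1 z \<theta> + ?b *\<^sub>R score 0 z \<theta>)"
    by (rule GDERIV_DERIV_compose)
  then show ?thesis
    by (simp add: loglik_def[abs_def] mix_density_eq[abs_def] comp_resp_def scaleR_add_right)
qed

lemma GDERIV_score:
  assumes \<theta>: "\<theta> \<in> param_space"
  shows "GDERIV (\<lambda>t. score x z t $ k) \<theta> :> dscore x z \<theta> k"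
proof (cases k rule: param_index_cases)
  note pos = param_spaceD[OF \<theta>]
  case (1 i)
  have "((\<lambda>t. x * resid x z t / var_of t * snd z $ i) has_derivative (\<lambda>d. d \<bullet> dscore x z \<theta> k)) (at \<theta>)"
    using pos by (auto intro!: derivative_eq_intros has_derivative_resid ext
        simp: 1 dscore_def inner_param inner_commute field_simps power2_eq_square)
  then show ?thesis by (simp add: 1 score_def gderiv_def)
next
  note pos = param_spaceD[OF \<theta>]
  case 2
  have "((\<lambda>t. x / prob_of t - (1 - x) / (1 - prob_of t)) has_derivative (\<lambda>d. d \<bullet> dscore x z \<theta> k)) (at \<theta>)"
    using pos by (auto intro!: derivative_eq_intros ext
        simp: 2 dscore_def inner_param field_simps power2_eq_square)
  then show ?thesis by (simp add: 2 score_def gderiv_def)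
next
  note pos = param_spaceD[OF \<theta>]
  case 3
  have "((\<lambda>t. (resid x z t)\<^sup>2 / (2 * (var_of t)\<^sup>2) - 1 / (2 * var_of t)) has_derivative (\<lambda>d. d \<bullet> dscore x z \<theta> k)) (at \<theta>)"
    using pos by (auto intro!: derivative_eq_intros has_derivative_resid ext
        simp: 3 dscore_def inner_param inner_commute field_simps power2_eq_square power3_eq_cube)
  then show ?thesis by (simp add: 3 score_def gderiv_def)
qed

lemma grad_eq_GDERIV:
  assumes "GDERIV F x :> D" shows "grad F x = D"
  using frechet_derivative_at[OF assms[unfolded gderiv_def], symmetric]
  by (simp add: grad_def vec_eq_iff inner_axis' )

lemma grad_loglik:
  "\<theta> \<in> param_space \<Longrightarrow>
   grad (loglik z) \<theta> = comp_resp 1 z \<theta> *\<^sub>R score 1 z \<theta> + comp_resp 0 z \<theta> *\<^sub>R score 0 z \<theta>"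
  by (intro grad_eq_GDERIV GDERIV_loglik)

text \<open>The last summand comes from the derivative of the responsibilities; its expectation is the missing
  information.\<close>

definition hess_row :: "'d::finite obs \<Rightarrow> 'd param \<Rightarrow> 'd + 2 \<Rightarrow> 'd param" where
  "hess_row z \<theta> k = comp_resp 1 z \<theta> *\<^sub>R dscore 1 z \<theta> k + comp_resp 0 z \<theta> *\<^sub>R dscore 0 z \<theta> k
     + (comp_resp 1 z \<theta> * comp_resp 0 z \<theta> * (score 1 z \<theta> - score 0 z \<theta>) $ k) *\<^sub>R (score 1 z \<theta> - score 0 z \<theta>)"

lemma GDERIV_grad_loglik:
  assumes \<theta>: "\<theta> \<in> param_space"
  shows "GDERIV (\<lambda>t. grad (loglik z) t $ k) \<theta> :> hess_row z \<theta> k"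
proof -
  have 1: "GDERIV (\<lambda>t. comp_resp 1 z t * score 1 z t $ k + (1 - comp_resp 1 z t) * score 0 z t $ k) \<theta> :>
      (comp_resp 1 z \<theta> *\<^sub>R dscore 1 z \<theta> k + score 1 z \<theta> $ k *\<^sub>R ((comp_resp 1 z \<theta> * comp_resp 0 z \<theta>) *\<^sub>R (score 1 z \<theta> - score 0 z \<theta>)))
      + ((1 - comp_resp 1 z \<theta>) *\<^sub>R dscore 0 z \<theta> k + score 0 z \<theta> $ k *\<^sub>R (0 - (comp_resp 1 z \<theta> * comp_resp 0 z \<theta>) *\<^sub>R (score 1 z \<theta> - score 0 z \<theta>)))"
    by (intro GDERIV_add GDERIV_mult GDERIV_diff GDERIV_const GDERIV_score GDERIV_comp_resp1 \<theta>)
  have r0: "comp_resp 0 z t = 1 - comp_resp 1 z t" if "t \<in> param_space" for t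
    using comp_resp_sum[OF that, of z] by simp
  have 2: "(comp_resp 1 z \<theta> *\<^sub>R dscore 1 z \<theta> k + score 1 z \<theta> $ k *\<^sub>R ((comp_resp 1 z \<theta> * comp_resp 0 z \<theta>) *\<^sub>R (score 1 z \<theta> - score 0 z \<theta>)))
      + ((1 - comp_resp 1 z \<theta>) *\<^sub>R dscore 0 z \<theta> k + score 0 z \<theta> $ k *\<^sub>R (0 - (comp_resp 1 z \<theta> * comp_resp 0 z \<theta>) *\<^sub>R (score 1 z \<theta> - score 0 z \<theta>)))
      = hess_row z \<theta> k"
    by (simp add: hess_row_def r0[OF \<theta>] vec_eq_iff algebra_simps)
  show ?thesis
    using 1 unfolding 2 gderiv_def
    by (rule has_derivative_transform_within_open[OF _ open_param_space \<theta>]) (simp add: grad_loglik r0)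
qed

lemma has_derivative_grad_loglik:
  assumes \<theta>: "\<theta> \<in> param_space"
  shows "(grad (loglik z) has_derivative (\<lambda>d. (\<chi> k. hess_row z \<theta> k) *v d)) (at \<theta>)"
proof (subst has_derivative_componentwise_within, rule ballI)
  fix b :: "'a param" assume "b \<in> Basis"
  then obtain k where b: "b = axis k 1" by (auto simp: Basis_vec_def)
  show "((\<lambda>t. grad (loglik z) t \<bullet> b) has_derivative (\<lambda>d. ((\<chi> k. hess_row z \<theta> k) *v d) \<bullet> b)) (at \<theta>)"
    using GDERIV_grad_loglik[OF \<theta>, of z k]
    by (simp add: b gderiv_def inner_axis matrix_vector_mul_component inner_commute[of "hess_row z \<theta> k"])
qed

lemma hess_loglik:
  assumes \<theta>: "\<theta> \<in> param_space"
  shows "hess (loglik z) \<theta> = (\<chi> k. hess_row z \<theta> k)"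
  unfolding hess_def jacobian_def
    frechet_derivative_at[OF has_derivative_grad_loglik[OF \<theta>], symmetric]
  by simp

lemma has_derivative_grad_loglik_hess:
  assumes \<theta>: "\<theta> \<in> param_space"
  shows "(grad (loglik z) has_derivative (\<lambda>d. hess (loglik z) \<theta> *v d)) (at \<theta>)"
  using has_derivative_grad_loglik[OF \<theta>] by (simp add: hess_loglik[OF \<theta>])

section \<open>Moments under the mixture density\<close>

definition obs_measure :: "'d::finite param \<Rightarrow> 'd obs measure" where
  "obs_measure \<theta> = density lborel (\<lambda>z. ennreal (mix_density \<theta> z))"

lemma borel_measurable_std_gauss_vec [measurable]: "std_gauss_vec \<in> borel_measurable borel"
  unfolding std_gauss_vec_def by measurable

lemma borel_measurable_fst_snd [measurable]:
  "fst \<in> borel_measurable (borel :: 'd::finite obs measure)"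
  "snd \<in> borel_measurable (borel :: 'd::finite obs measure)"
  by (intro borel_measurable_continuous_onI continuous_intros)+

lemma borel_measurable_comp_density [measurable]:
  "(\<lambda>z. comp_density x z \<theta>) \<in> borel_measurable borel"
  unfolding comp_density_def gauss_def normal_density_def by measurable

lemma borel_measurable_mix_density [measurable]:
  "mix_density \<theta> \<in> borel_measurable borel"
  unfolding mix_density_eq[abs_def] by measurable

lemma borel_measurable_comp_resp [measurable]:
  "(\<lambda>z. comp_resp x z \<theta>) \<in> borel_measurable borel"
  unfolding comp_resp_def by measurable

lemma poly_bounded_fst: "poly_bounded (fst :: 'd::finite obs \<Rightarrow> real)"
  by (rule poly_bounded_linear[OF bounded_linear_fst])

lemma poly_bounded_snd_nth: "poly_bounded (\<lambda>z :: 'd::finite obs. snd z $ i)"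
  by (rule poly_bounded_linear[OF bounded_linear_compose[OF bounded_linear_vec_nth bounded_linear_snd]])

lemma poly_bounded_vec_nth: "poly_bounded (\<lambda>h :: real ^ 'd::finite. h $ i)"
  by (rule poly_bounded_linear[OF bounded_linear_vec_nth])

lemma poly_bounded_snd_inner: "poly_bounded (\<lambda>z :: 'd::finite obs. snd z \<bullet> v)"
  by (rule poly_bounded_linear[OF bounded_linear_compose[OF bounded_linear_inner_left bounded_linear_snd]])

lemma poly_bounded_resid: "poly_bounded (\<lambda>z. resid x z \<theta>)"
  unfolding resid_def by (intro poly_bounded_intros poly_bounded_fst poly_bounded_snd_inner)

lemma poly_bounded_comp_resp:
  assumes "\<theta> \<in> param_space" "x \<in> {0, 1}" shows "poly_bounded (\<lambda>z. comp_resp x z \<theta>)"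
  by (rule poly_boundedI[where C = 1 and k = 0])
    (use comp_resp_bounds[OF assms] in \<open>auto simp: abs_of_pos\<close>)

lemma poly_bounded_snd:
  assumes "poly_bounded q" shows "poly_bounded (\<lambda>z :: 'd::finite obs. q (snd z))"
proof -
  obtain C k where C: "0 \<le> C" "\<And>z. \<bar>q z\<bar> \<le> C * (1 + norm z) ^ k"
    using poly_boundedD[OF assms] by blast
  show ?thesis
  proof (rule poly_boundedI)
    show "\<bar>q (snd z)\<bar> \<le> C * (1 + norm z) ^ k" for z :: "'d obs"
    proof -
      have "norm (snd z) \<le> norm z" by (metis norm_snd_le prod.collapse)
      then show ?thesis
        by (intro order_trans[OF C(2)] mult_left_mono power_mono C(1) add_left_mono) auto
    qed
  qed (use poly_bounded_measurable[OF assms] in measurable)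
qed

lemma score_nth:
  "score x z \<theta> $ Inl i = x * resid x z \<theta> / var_of \<theta> * snd z $ i"
  "score x z \<theta> $ Inr 1 = x / prob_of \<theta> - (1 - x) / (1 - prob_of \<theta>)"
  "score x z \<theta> $ Inr 2 = (resid x z \<theta>)\<^sup>2 / 2 / var_of \<theta> / var_of \<theta> - 1 / 2 / var_of \<theta>"
  by (simp_all add: score_def power2_eq_square)

lemma dscore_nth:
  "dscore x z \<theta> (Inl i) $ Inl j = - (x\<^sup>2) * snd z $ i / var_of \<theta> * snd z $ j"
  "dscore x z \<theta> (Inl i) $ Inr 1 = 0"
  "dscore x z \<theta> (Inl i) $ Inr 2 = - x * resid x z \<theta> * snd z $ i / var_of \<theta> / var_of \<theta>"
  "dscore x z \<theta> (Inr 1) $ Inl j = 0"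
  "dscore x z \<theta> (Inr 1) $ Inr 1 = - x / prob_of \<theta> / prob_of \<theta> - (1 - x) / (1 - prob_of \<theta>) / (1 - prob_of \<theta>)"
  "dscore x z \<theta> (Inr 1) $ Inr 2 = 0"
  "dscore x z \<theta> (Inr 2) $ Inl j = - x * resid x z \<theta> / var_of \<theta> / var_of \<theta> * snd z $ j"
  "dscore x z \<theta> (Inr 2) $ Inr 1 = 0"
  "dscore x z \<theta> (Inr 2) $ Inr 2 = 1 / 2 / var_of \<theta> / var_of \<theta> - (resid x z \<theta>)\<^sup>2 / var_of \<theta> / var_of \<theta> / var_of \<theta>"
  by (simp_all add: dscore_def power2_eq_square power3_eq_cube mult.assoc)

lemma poly_bounded_divide: "poly_bounded f \<Longrightarrow> poly_bounded (\<lambda>z. f z / c)"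
  unfolding divide_inverse by (intro poly_bounded_intros)

lemma poly_bounded_score: "poly_bounded (\<lambda>z. score x z \<theta> $ k)"
  by (cases k rule: param_index_cases)
    (simp only: score_nth, intro poly_bounded_intros poly_bounded_divide poly_bounded_resid poly_bounded_snd_nth)+

lemma poly_bounded_dscore: "poly_bounded (\<lambda>z. dscore x z \<theta> k $ l)"
  by (cases k rule: param_index_cases; cases l rule: param_index_cases)
    (simp only: dscore_nth, intro poly_bounded_intros poly_bounded_divide poly_bounded_resid poly_bounded_snd_nth)+

text \<open>The noise bounds \<open>y - x (h \<bullet> \<mu>)\<close> only; the decay in \<open>y\<close> itself is paid for by a part of the decay
  in \<open>h\<close>.\<close>

lemma mix_density_decay:
  fixes \<theta> :: "'d::finite param"
  assumes \<theta>: "\<theta> \<in> param_space"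
  shows "\<exists>c C. 0 < c \<and> (\<forall>z. \<bar>mix_density \<theta> z\<bar> \<le> C * exp (- c * (norm z)\<^sup>2))"
proof -
  define s where "s = var_of \<theta>"
  define m where "m = norm (mean_of \<theta>)"
  have s: "0 < s" using param_spaceD[OF \<theta>] by (simp add: s_def)
  \<comment> \<open>Small enough for \<open>y\<^sup>2 \<le> 2 (y - u)\<^sup>2 + 2 m\<^sup>2 (h \<bullet> h)\<close>, where u is the mean of y, to be absorbed by the exponents of the noise and of h.\<close>
  define c where "c = min (1 / (4 * s)) (1 / (2 * (2 * m\<^sup>2 + 1)))"
  have mp: "0 < 2 * m\<^sup>2 + 1" using zero_le_power2[of m] by linarith
  have c: "0 < c" "2 * c \<le> 1 / (2 * s)" "(2 * m\<^sup>2 + 1) * c \<le> 1 / 2"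
  proof -
    show "0 < c" using s mp by (simp add: c_def)
    have "c \<le> 1 / (4 * s)" by (simp add: c_def)
    then show "2 * c \<le> 1 / (2 * s)" using s by (simp add: field_simps)
    have "c \<le> 1 / (2 * (2 * m\<^sup>2 + 1))" by (simp add: c_def)
    then have "(2 * m\<^sup>2 + 1) * c \<le> (2 * m\<^sup>2 + 1) * (1 / (2 * (2 * m\<^sup>2 + 1)))"
      using mp by (intro mult_left_mono) auto
    moreover have "(2 * m\<^sup>2 + 1) * (1 / (2 * (2 * m\<^sup>2 + 1))) = 1 / 2" using mp by (simp add: divide_simps)
    ultimately show "(2 * m\<^sup>2 + 1) * c \<le> 1 / 2" by linarith
  qed
  define G where "G = 1 / sqrt ((2 * pi) ^ CARD('d)) * (1 / sqrt (2 * pi * s))"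
  have G: "0 \<le> G" using s by (simp add: G_def)
  have comp: "std_gauss_vec (snd z) * comp_density x z \<theta> \<le> G * exp (- c * (norm z)\<^sup>2)"
    if x: "x \<in> {0, 1}" for x and z :: "'d obs"
  proof -
    define h where "h = snd z" define y where "y = fst z"
    define u where "u = x * (h \<bullet> mean_of \<theta>)"
    have nz: "(norm z)\<^sup>2 = y\<^sup>2 + h \<bullet> h"
      by (cases z) (simp add: norm_Pair h_def y_def power2_norm_eq_inner)
    have "\<bar>u\<bar> \<le> norm h * m" using x Cauchy_Schwarz_ineq2[of h "mean_of \<theta>"] by (auto simp: u_def m_def)
    then have "u\<^sup>2 \<le> (norm h * m)\<^sup>2" by (simp add: abs_le_square_iff[symmetric] m_def)
    then have u: "u\<^sup>2 \<le> m\<^sup>2 * (h \<bullet> h)" by (simp add: power_mult_distrib power2_norm_eq_inner mult.commute)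
    have "0 \<le> (y - 2 * u)\<^sup>2" by simp
    then have "y\<^sup>2 \<le> 2 * (y - u)\<^sup>2 + 2 * u\<^sup>2" by (simp add: power2_eq_square algebra_simps)
    then have "y\<^sup>2 + h \<bullet> h \<le> 2 * (y - u)\<^sup>2 + (2 * m\<^sup>2 + 1) * (h \<bullet> h)" using u by (simp add: algebra_simps)
    then have "c * (y\<^sup>2 + h \<bullet> h) \<le> c * (2 * (y - u)\<^sup>2 + (2 * m\<^sup>2 + 1) * (h \<bullet> h))"
      using c by (intro mult_left_mono) auto
    also have "\<dots> = (2 * c) * (y - u)\<^sup>2 + ((2 * m\<^sup>2 + 1) * c) * (h \<bullet> h)" by (simp add: algebra_simps)
    also have "\<dots> \<le> (1 / (2 * s)) * (y - u)\<^sup>2 + 1 / 2 * (h \<bullet> h)" using c by (intro add_mono mult_right_mono) auto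
    finally have le: "- ((y - u)\<^sup>2 / (2 * s)) + - (h \<bullet> h) / 2 \<le> - c * (norm z)\<^sup>2" by (simp add: nz)
    have w: "0 \<le> comp_weight x \<theta>" "comp_weight x \<theta> \<le> 1" using x param_spaceD[OF \<theta>] by (auto simp: comp_weight_def)
    have "std_gauss_vec (snd z) * comp_density x z \<theta>
        = comp_weight x \<theta> * (G * exp (- ((y - u)\<^sup>2 / (2 * s)) + - (h \<bullet> h) / 2))"
      using s unfolding exp_add
      by (simp add: std_gauss_vec_def comp_density_def gauss_def normal_density_def G_def h_def[symmetric] y_def[symmetric]
          u_def[symmetric] s_def[symmetric])
    also have "\<dots> \<le> 1 * (G * exp (- c * (norm z)\<^sup>2))"
      using w G le by (intro mult_mono mult_left_mono) auto
    finally show ?thesis by simp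
  qed
  have pos: "0 \<le> std_gauss_vec (snd z) * comp_density x z \<theta>" if "x \<in> {0, 1}" for x and z :: "'d obs"
    using comp_density_pos[OF \<theta> that, of z] by (simp add: std_gauss_vec_def)
  have "\<bar>mix_density \<theta> z\<bar> \<le> (2 * G) * exp (- c * (norm z)\<^sup>2)" for z
    using comp[of 0 z] comp[of 1 z] pos[of 0 z] pos[of 1 z] by (simp add: mix_density_eq distrib_left)
  then show ?thesis using c(1) by blast
qed

lemma mix_density_nonneg: "\<theta> \<in> param_space \<Longrightarrow> 0 \<le> mix_density \<theta> z"
  using comp_density_pos[of \<theta> 0 z] comp_density_pos[of \<theta> 1 z]
  by (simp add: mix_density_eq std_gauss_vec_def)

lemma integrable_mix_density:
  assumes \<theta>: "\<theta> \<in> param_space" and g: "poly_bounded g"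
  shows "integrable lborel (\<lambda>z. mix_density \<theta> z * g z)"
  using mix_density_decay[OF \<theta>] integrable_gaussian_decay[OF _ borel_measurable_mix_density _ g] by blast

lemma integrable_obs_measure:
  assumes \<theta>: "\<theta> \<in> param_space" and g: "poly_bounded g"
  shows "integrable (obs_measure \<theta>) g"
  using integrable_mix_density[OF assms] poly_bounded_measurable[OF g] mix_density_nonneg[OF \<theta>]
  unfolding obs_measure_def by (subst integrable_density) auto

lemma integral_obs_measure:
  assumes \<theta>: "\<theta> \<in> param_space" and g: "poly_bounded g"
  shows "integral\<^sup>L (obs_measure \<theta>) g = (\<integral>z. mix_density \<theta> z * g z \<partial>lborel)"
  using poly_bounded_measurable[OF g] mix_density_nonneg[OF \<theta>]
  unfolding obs_measure_def by (subst integral_density) auto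

definition gauss_vec_mean :: "(real ^ 'd::finite \<Rightarrow> real) \<Rightarrow> real" where
  "gauss_vec_mean q = (\<integral>h. std_gauss_vec h * q h \<partial>lborel)"

lemma gauss_central_moments:
  assumes "0 < v"
  shows "has_bochner_integral lborel
    (\<lambda>y. gauss m v y * (a0 + a1 * (y - m) + a2 * (y - m)\<^sup>2 + a3 * (y - m) ^ 3 + a4 * (y - m) ^ 4))
    (a0 + a2 * v + a4 * (3 * v\<^sup>2))"
proof -
  note e = normal_moment_even[OF real_sqrt_gt_zero[OF assms], of m]
    and o = normal_moment_odd[OF real_sqrt_gt_zero[OF assms], of m]
  have f: "fact 2 = (2 :: real)" "fact 4 = (24 :: real)" by (simp_all add: fact_numeral)
  have 0: "has_bochner_integral lborel (\<lambda>y. gauss m v y * (y - m) ^ 0) 1"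
    using e[of 0] by (simp add: gauss_def)
  have 1: "has_bochner_integral lborel (\<lambda>y. gauss m v y * (y - m) ^ 1) 0"
    using o[of 0] by (simp add: gauss_def)
  have 2: "has_bochner_integral lborel (\<lambda>y. gauss m v y * (y - m) ^ 2) v"
    using e[of 1] assms by (simp add: gauss_def f)
  have 3: "has_bochner_integral lborel (\<lambda>y. gauss m v y * (y - m) ^ 3) 0"
    using o[of 1] by (simp add: gauss_def)
  have "(24 :: real) / ((2 / v)\<^sup>2 * 2) = 3 * v\<^sup>2" using assms by (simp add: field_simps)
  then have 4: "has_bochner_integral lborel (\<lambda>y. gauss m v y * (y - m) ^ 4) (3 * v\<^sup>2)"
    using e[of 2] assms by (simp add: gauss_def f)
  have "has_bochner_integral lborel
    (\<lambda>y. a0 * (gauss m v y * (y - m) ^ 0) + a1 * (gauss m v y * (y - m) ^ 1) + a2 * (gauss m v y * (y - m) ^ 2)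
      + a3 * (gauss m v y * (y - m) ^ 3) + a4 * (gauss m v y * (y - m) ^ 4))
    (a0 * 1 + a1 * 0 + a2 * v + a3 * 0 + a4 * (3 * v\<^sup>2))"
    by (intro has_bochner_integral_add has_bochner_integral_mult_right 0 1 2 3 4)
  then show ?thesis by (simp add: algebra_simps)
qed

text \<open>The weight \<open>comp_resp x\<close> cancels the mixture in the density and leaves a single component. By Fubini
  the response \<open>y\<close> is integrated first, for fixed \<open>h\<close>, where \<open>resid\<close> is a centred Gaussian variable.
  Polynomials of degree four in \<open>resid\<close> suffice for products of two scores.\<close>

lemma component_moment:
  fixes q :: "real ^ 'd::finite \<Rightarrow> real"
  assumes \<theta>: "\<theta> \<in> param_space" and x: "x \<in> {0, 1}" and q: "poly_bounded q"
    and f: "\<And>z. f z = comp_resp x z \<theta> * (q (snd z) * (a + b * resid x z \<theta> + c * (resid x z \<theta>)\<^sup>2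
      + d * resid x z \<theta> ^ 3 + e * resid x z \<theta> ^ 4))"
  shows "integral\<^sup>L (obs_measure \<theta>) f
    = comp_weight x \<theta> * (a + c * var_of \<theta> + e * (3 * (var_of \<theta>)\<^sup>2)) * gauss_vec_mean q"
proof -
  have v: "0 < var_of \<theta>" using param_spaceD[OF \<theta>] by simp
  have pf: "poly_bounded f"
    unfolding f[abs_def]
    by (intro poly_bounded_intros poly_bounded_comp_resp[OF \<theta> x] poly_bounded_snd[OF q] poly_bounded_resid)
  let ?p = "\<lambda>u. a + b * u + c * u\<^sup>2 + d * u ^ 3 + e * u ^ 4"
  let ?m = "\<lambda>h. x * (h \<bullet> mean_of \<theta>)"
  let ?g = "\<lambda>y h. comp_weight x \<theta> * (std_gauss_vec h * q h) * (gauss (?m h) (var_of \<theta>) y * ?p (y - ?m h))"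
  have eq: "mix_density \<theta> z * f z = (case z of (y, h) \<Rightarrow> ?g y h)" for z
  proof -
    have "comp_density 1 z \<theta> + comp_density 0 z \<theta> \<noteq> 0"
      using comp_density_pos[OF \<theta>, of 0 z] comp_density_pos[OF \<theta>, of 1 z] by simp
    then have "mix_density \<theta> z * comp_resp x z \<theta> = std_gauss_vec (snd z) * comp_density x z \<theta>"
      by (simp add: mix_density_eq comp_resp_def)
    then have "mix_density \<theta> z * f z = std_gauss_vec (snd z) * comp_density x z \<theta> * (q (snd z) * ?p (resid x z \<theta>))"
      by (simp add: f)
    then show ?thesis by (simp add: split_beta comp_density_def resid_def)
  qed
  have int: "integrable (lborel \<Otimes>\<^sub>M lborel) (case_prod ?g)"
    using integrable_mix_density[OF \<theta> pf] unfolding eq[abs_def] lborel_prod by (simp add: split_def)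
  have "integral\<^sup>L (obs_measure \<theta>) f = integral\<^sup>L (lborel \<Otimes>\<^sub>M lborel) (case_prod ?g)"
    unfolding integral_obs_measure[OF \<theta> pf] eq[abs_def] lborel_prod by (simp add: split_def)
  also have "\<dots> = (\<integral>h. (\<integral>y. ?g y h \<partial>lborel) \<partial>lborel)"
    by (rule lborel_pair.integral_snd[OF int, symmetric])
  also have "\<dots> = (\<integral>h. (comp_weight x \<theta> * (a + c * var_of \<theta> + e * (3 * (var_of \<theta>)\<^sup>2))) * (std_gauss_vec h * q h) \<partial>lborel)"
    using has_bochner_integral_integral_eq[OF gauss_central_moments[OF v, of "?m _" a b c d e]]
    by (simp add: mult_ac)
  also have "\<dots> = comp_weight x \<theta> * (a + c * var_of \<theta> + e * (3 * (var_of \<theta>)\<^sup>2)) * gauss_vec_mean q"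
    by (simp add: gauss_vec_mean_def)
  finally show ?thesis .
qed

section \<open>Fisher information, missing information and complete information\<close>

text \<open>The normalisation of the Gaussian density of \<open>h\<close> follows from that of the mixture, by applying the
  moment formula to the constant 1.\<close>

lemma gauss_vec_mean_one:
  fixes \<theta> :: "'d::finite param"
  assumes \<theta>: "\<theta> \<in> param_space" and prob: "prob_space (obs_measure \<theta>)"
  shows "gauss_vec_mean (\<lambda>h :: real ^ 'd. 1) = 1"
proof -
  have m: "integral\<^sup>L (obs_measure \<theta>) (\<lambda>z. comp_resp x z \<theta>) = comp_weight x \<theta> * gauss_vec_mean (\<lambda>h :: real ^ 'd. 1)"
    if "x \<in> {0, 1}" for x
    by (subst component_moment[OF \<theta> that poly_bounded_const[of 1], where a = 1 and b = 0 and c = 0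
      and d = 0 and e = 0]) simp_all
  interpret P: prob_space "obs_measure \<theta>" by (rule prob)
  have "1 = integral\<^sup>L (obs_measure \<theta>) (\<lambda>z. 1 :: real)"
    by (simp add: P.prob_space)
  also have "\<dots> = integral\<^sup>L (obs_measure \<theta>) (\<lambda>z. comp_resp 1 z \<theta> + comp_resp 0 z \<theta>)"
    by (simp add: comp_resp_sum[OF \<theta>])
  also have "\<dots> = comp_weight 1 \<theta> * gauss_vec_mean (\<lambda>h :: real ^ 'd. 1)
      + comp_weight 0 \<theta> * gauss_vec_mean (\<lambda>h :: real ^ 'd. 1)"
    by (subst Bochner_Integration.integral_add)
      (auto intro!: integrable_obs_measure poly_bounded_comp_resp \<theta> simp: m)
  finally show ?thesis by (simp add: comp_weight_def algebra_simps)
qed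

text \<open>The contribution of the component \<open>x\<close> to the information of the labelled data. It is block-diagonal,
  because the mixed entries are odd moments or differences of matching even ones.\<close>

definition component_info :: "real \<Rightarrow> 'd::finite param \<Rightarrow> 'd + 2 \<Rightarrow> 'd + 2 \<Rightarrow> real" where
  "component_info x \<theta> k l = comp_weight x \<theta> * (case k of
      Inl i \<Rightarrow> (case l of Inl j \<Rightarrow> x\<^sup>2 / var_of \<theta> * gauss_vec_mean (\<lambda>h :: real ^ 'd. h $ i * h $ j) | Inr b \<Rightarrow> 0)
    | Inr a \<Rightarrow> (case l of Inl j \<Rightarrow> 0 | Inr b \<Rightarrow>
        if a = b then (if a = 1 then (x / prob_of \<theta> - (1 - x) / (1 - prob_of \<theta>))\<^sup>2 else 1 / (2 * (var_of \<theta>)\<^sup>2))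
        else 0))"

context
  fixes \<theta> :: "'d::finite param" and x :: real
  assumes \<theta>: "\<theta> \<in> param_space" and prob: "prob_space (obs_measure \<theta>)" and x: "x \<in> {0, 1}"
begin

lemma component_score_moments:
  "integral\<^sup>L (obs_measure \<theta>) (\<lambda>z. comp_resp x z \<theta> * (score x z \<theta> $ k * score x z \<theta> $ l)) = component_info x \<theta> k l"
proof -
  note v = param_spaceD(3)[OF \<theta>]
  note Q1 = gauss_vec_mean_one[OF \<theta> prob]
  note m = component_moment[OF \<theta> x]
  define c where "c = x / prob_of \<theta> - (1 - x) / (1 - prob_of \<theta>)"
  have sc: "score x z \<theta> $ Inr 1 = c" for z by (simp add: score_nth c_def)
  note simps = component_info_def sc score_nth(1,3) Q1 c_def[symmetric] power2_eq_square
  note alg = field_simps power2_eq_square power3_eq_cube power4_eq_xxxx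
  show ?thesis
  proof (cases k rule: param_index_cases; cases l rule: param_index_cases)
    fix i j assume k: "k = Inl i" and l: "l = Inl j"
    show ?thesis unfolding k l
      by (subst m[where q = "\<lambda>h. h $ i * h $ j" and a = 0 and b = 0 and c = "x\<^sup>2 / (var_of \<theta>)\<^sup>2"
          and d = 0 and e = 0, OF poly_bounded_mult[OF poly_bounded_vec_nth poly_bounded_vec_nth]])
        (use v in \<open>simp_all add: simps\<close>, (simp_all add: alg)?)
  next
    fix i assume k: "k = Inl i" and l: "l = Inr 1"
    show ?thesis unfolding k l
      by (subst m[where q = "\<lambda>h. h $ i" and a = 0 and b = "x * c / var_of \<theta>" and c = 0
          and d = 0 and e = 0, OF poly_bounded_vec_nth])
        (simp_all add: simps)
  next
    fix i assume k: "k = Inl i" and l: "l = Inr 2"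
    show ?thesis unfolding k l
      by (subst m[where q = "\<lambda>h. h $ i" and a = 0 and b = "- x / (2 * (var_of \<theta>)\<^sup>2)" and c = 0
          and d = "x / (2 * var_of \<theta> ^ 3)" and e = 0, OF poly_bounded_vec_nth])
        (use v in \<open>simp_all add: simps\<close>, (simp_all add: alg)?)
  next
    fix j assume k: "k = Inr 1" and l: "l = Inl j"
    show ?thesis unfolding k l
      by (subst m[where q = "\<lambda>h. h $ j" and a = 0 and b = "x * c / var_of \<theta>" and c = 0
          and d = 0 and e = 0, OF poly_bounded_vec_nth])
        (simp_all add: simps)
  next
    assume k: "k = Inr 1" and l: "l = Inr 1"
    show ?thesis unfolding k l
      by (subst m[where q = "\<lambda>h. 1" and a = "c\<^sup>2" and b = 0 and c = 0
          and d = 0 and e = 0, OF poly_bounded_const])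
        (simp_all add: simps power2_eq_square)
  next
    assume k: "k = Inr 1" and l: "l = Inr 2"
    show ?thesis unfolding k l
      by (subst m[where q = "\<lambda>h. 1" and a = "- c / (2 * var_of \<theta>)" and b = 0 and c = "c / (2 * (var_of \<theta>)\<^sup>2)"
          and d = 0 and e = 0, OF poly_bounded_const])
        (use v in \<open>simp_all add: simps\<close>, (simp_all add: alg)?)
  next
    fix j assume k: "k = Inr 2" and l: "l = Inl j"
    show ?thesis unfolding k l
      by (subst m[where q = "\<lambda>h. h $ j" and a = 0 and b = "- x / (2 * (var_of \<theta>)\<^sup>2)" and c = 0
          and d = "x / (2 * var_of \<theta> ^ 3)" and e = 0, OF poly_bounded_vec_nth])
        (use v in \<open>simp_all add: simps\<close>, (simp_all add: alg)?)
  next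
    assume k: "k = Inr 2" and l: "l = Inr 1"
    show ?thesis unfolding k l
      by (subst m[where q = "\<lambda>h. 1" and a = "- c / (2 * var_of \<theta>)" and b = 0 and c = "c / (2 * (var_of \<theta>)\<^sup>2)"
          and d = 0 and e = 0, OF poly_bounded_const])
        (use v in \<open>simp_all add: simps\<close>, (simp_all add: alg)?)
  next
    assume k: "k = Inr 2" and l: "l = Inr 2"
    show ?thesis unfolding k l
      by (subst m[where q = "\<lambda>h. 1" and a = "1 / (4 * (var_of \<theta>)\<^sup>2)" and b = 0 and c = "- 1 / (2 * var_of \<theta> ^ 3)"
          and d = 0 and e = "1 / (4 * var_of \<theta> ^ 4)", OF poly_bounded_const])
        (use v in \<open>simp_all add: simps\<close>, (simp_all add: alg)?)
  qed
qed

text \<open>With \<open>component_score_moments\<close> this is the information identity for a single weighted component.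
  For the weight \<open>p\<close> it uses that \<open>x\<close> is 0 or 1.\<close>

lemma component_dscore_moments:
  "integral\<^sup>L (obs_measure \<theta>) (\<lambda>z. comp_resp x z \<theta> * dscore x z \<theta> k $ l) = - component_info x \<theta> k l"
proof -
  note v = param_spaceD(3)[OF \<theta>]
  note Q1 = gauss_vec_mean_one[OF \<theta> prob]
  note m = component_moment[OF \<theta> x]
  note alg = field_simps power2_eq_square power3_eq_cube
  note simps = component_info_def dscore_nth Q1 power2_eq_square
  show ?thesis
  proof (cases k rule: param_index_cases; cases l rule: param_index_cases)
    fix i j assume k: "k = Inl i" and l: "l = Inl j"
    show ?thesis unfolding k l
      by (subst m[where q = "\<lambda>h. h $ i * h $ j" and a = "- (x\<^sup>2) / var_of \<theta>" and b = 0 and c = 0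
          and d = 0 and e = 0, OF poly_bounded_mult[OF poly_bounded_vec_nth poly_bounded_vec_nth]])
        (simp_all add: simps)
  next
    fix i assume k: "k = Inl i" and l: "l = Inr 2"
    show ?thesis unfolding k l
      by (subst m[where q = "\<lambda>h. h $ i" and a = 0 and b = "- x / (var_of \<theta>)\<^sup>2" and c = 0
          and d = 0 and e = 0, OF poly_bounded_vec_nth])
        (simp_all add: simps)
  next
    assume k: "k = Inr 1" and l: "l = Inr 1"
    have "- x / (prob_of \<theta>)\<^sup>2 - (1 - x) / (1 - prob_of \<theta>)\<^sup>2 = - ((x / prob_of \<theta> - (1 - x) / (1 - prob_of \<theta>))\<^sup>2)"
      using x by (auto simp: power_divide)
    then show ?thesis unfolding k l
      by (subst m[where q = "\<lambda>h. 1" and a = "- x / (prob_of \<theta>)\<^sup>2 - (1 - x) / (1 - prob_of \<theta>)\<^sup>2" and b = 0 and c = 0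
          and d = 0 and e = 0, OF poly_bounded_const])
        (simp_all add: simps)
  next
    fix j assume k: "k = Inr 2" and l: "l = Inl j"
    show ?thesis unfolding k l
      by (subst m[where q = "\<lambda>h. h $ j" and a = 0 and b = "- x / (var_of \<theta>)\<^sup>2" and c = 0
          and d = 0 and e = 0, OF poly_bounded_vec_nth])
        (simp_all add: simps)
  next
    assume k: "k = Inr 2" and l: "l = Inr 2"
    show ?thesis unfolding k l
      by (subst m[where q = "\<lambda>h. 1" and a = "1 / (2 * (var_of \<theta>)\<^sup>2)" and b = 0 and c = "- 1 / var_of \<theta> ^ 3"
          and d = 0 and e = 0, OF poly_bounded_const])
        (use v in \<open>simp_all add: simps\<close>, (simp_all add: alg)?)
  qed (simp_all add: simps)
qed

lemma component_score_mean:
  "integral\<^sup>L (obs_measure \<theta>) (\<lambda>z. comp_resp x z \<theta> * score x z \<theta> $ k)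
     = (if k = Inr 1 then comp_weight x \<theta> * (x / prob_of \<theta> - (1 - x) / (1 - prob_of \<theta>)) else 0)"
proof -
  note v = param_spaceD(3)[OF \<theta>]
  note Q1 = gauss_vec_mean_one[OF \<theta> prob]
  note m = component_moment[OF \<theta> x]
  show ?thesis
  proof (cases k rule: param_index_cases)
    case (1 i)
    show ?thesis unfolding 1
      by (subst m[where q = "\<lambda>h. h $ i" and a = 0 and b = "x / var_of \<theta>" and c = 0
          and d = 0 and e = 0, OF poly_bounded_vec_nth])
        (simp_all add: score_nth)
  next
    case 2
    show ?thesis unfolding 2
      by (subst m[where q = "\<lambda>h. 1" and a = "x / prob_of \<theta> - (1 - x) / (1 - prob_of \<theta>)" and b = 0 and c = 0
          and d = 0 and e = 0, OF poly_bounded_const])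
        (simp_all add: score_nth Q1)
  next
    case 3
    show ?thesis unfolding 3
      by (subst m[where q = "\<lambda>h. 1" and a = "- 1 / (2 * var_of \<theta>)" and b = 0 and c = "1 / (2 * (var_of \<theta>)\<^sup>2)"
          and d = 0 and e = 0, OF poly_bounded_const])
        (use v in \<open>simp_all add: score_nth Q1\<close>, (simp_all add: field_simps power2_eq_square)?)
  qed
qed

end

text \<open>The contribution of one observation to the matrix \<open>A\<^sub>N\<close>, which thereby becomes an empirical mean.\<close>

definition complete_info_obs :: "'d::finite obs \<Rightarrow> 'd param \<Rightarrow> real ^ ('d + 2) ^ ('d + 2)" where
  "complete_info_obs z \<theta> = (\<chi> k l. case (k, l) of
       (Inl i, Inl j) \<Rightarrow> 1 / var_of \<theta> * (comp_resp 1 z \<theta> * (snd z $ i * snd z $ j))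
     | (Inr a, Inr b) \<Rightarrow>
         (if a = b then (if a = 1 then 1 / (prob_of \<theta> * (1 - prob_of \<theta>)) else 1 / (2 * (var_of \<theta>)\<^sup>2)) else 0)
     | _ \<Rightarrow> 0)"

lemma complete_info_obs_nth:
  "complete_info_obs z \<theta> $ Inl i $ Inl j = 1 / var_of \<theta> * (comp_resp 1 z \<theta> * (snd z $ i * snd z $ j))"
  "complete_info_obs z \<theta> $ Inl i $ Inr b = 0"
  "complete_info_obs z \<theta> $ Inr a $ Inl j = 0"
  "complete_info_obs z \<theta> $ Inr 1 $ Inr 1 = 1 / prob_of \<theta> / (1 - prob_of \<theta>)"
  "complete_info_obs z \<theta> $ Inr 1 $ Inr 2 = 0"
  "complete_info_obs z \<theta> $ Inr 2 $ Inr 1 = 0"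
  "complete_info_obs z \<theta> $ Inr 2 $ Inr 2 = 1 / 2 / var_of \<theta> / var_of \<theta>"
  by (simp_all add: complete_info_obs_def power2_eq_square)

lemma emp_mean_nth: "emp_mean N zs g $ i = emp_mean N zs (\<lambda>z. g z $ i)"
  by (simp add: emp_mean_def)

lemma emp_mean_const: "1 \<le> N \<Longrightarrow> emp_mean N zs (\<lambda>z. c) = c"
  by (simp add: emp_mean_def sum_constant_scaleR)

lemma A_mat_eq_emp_mean:
  assumes "1 \<le> N"
  shows "A_mat N zs \<theta> = emp_mean N zs (\<lambda>z. complete_info_obs z \<theta>)"
proof -
  have "A_mat N zs \<theta> $ k $ l = emp_mean N zs (\<lambda>z. complete_info_obs z \<theta>) $ k $ l" for k l
    by (cases k rule: param_index_cases; cases l rule: param_index_cases)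
      (simp_all add: A_mat_def emp_mean_nth complete_info_obs_nth power2_eq_square emp_mean_const[OF assms] Gam_def resp_eq)
  then show ?thesis by (simp add: vec_eq_iff)
qed

lemma poly_bounded_complete_info_obs:
  assumes "\<theta> \<in> param_space"
  shows "poly_bounded (\<lambda>z. complete_info_obs z \<theta> $ k $ l)"
  by (cases k rule: param_index_cases; cases l rule: param_index_cases)
    (simp only: complete_info_obs_nth,
      intro poly_bounded_intros poly_bounded_divide poly_bounded_comp_resp poly_bounded_snd_nth assms insertI1 insertI2)+

lemma poly_bounded_hess_row:
  assumes "\<theta> \<in> param_space"
  shows "poly_bounded (\<lambda>z. hess_row z \<theta> k $ l)"
  unfolding hess_row_def vector_add_component vector_scaleR_component vector_minus_component real_scaleR_def
  by (intro poly_bounded_intros poly_bounded_comp_resp poly_bounded_score poly_bounded_dscore assms insertI1 insertI2)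

text \<open>The conditional covariance of the labelled score given the observation, averaged over the
  observations.\<close>

definition missing_info :: "'d::finite param \<Rightarrow> real ^ ('d + 2) ^ ('d + 2)" where
  "missing_info \<theta> = (\<chi> k l. \<integral>z. comp_resp 1 z \<theta> * comp_resp 0 z \<theta> *
     ((score 1 z \<theta> - score 0 z \<theta>) $ k * (score 1 z \<theta> - score 0 z \<theta>) $ l) \<partial>obs_measure \<theta>)"

definition complete_info :: "'d::finite param \<Rightarrow> real ^ ('d + 2) ^ ('d + 2)" where
  "complete_info \<theta> = (\<chi> k l. \<integral>z. complete_info_obs z \<theta> $ k $ l \<partial>obs_measure \<theta>)"

lemma fisher_info_nth:
  assumes \<theta>: "\<theta> \<in> param_space"
  shows "fisher_info \<theta> $ k $ l = (\<integral>z. 1 * ((comp_resp 1 z \<theta> *\<^sub>R score 1 z \<theta> + comp_resp 0 z \<theta> *\<^sub>R score 0 z \<theta>) $ k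
    * (comp_resp 1 z \<theta> *\<^sub>R score 1 z \<theta> + comp_resp 0 z \<theta> *\<^sub>R score 0 z \<theta>) $ l) \<partial>obs_measure \<theta>)"
  by (simp only: fisher_info_def vec_lambda_beta obs_measure_def grad_loglik[OF \<theta>] mult_1)

context
  fixes \<theta> :: "'d::finite param"
  assumes \<theta>: "\<theta> \<in> param_space" and prob: "prob_space (obs_measure \<theta>)"
begin

lemma integrable_score_products:
  "x \<in> {0, 1} \<Longrightarrow> integrable (obs_measure \<theta>) (\<lambda>z. comp_resp x z \<theta> * (score x z \<theta> $ k * score x z \<theta> $ l))"
  "x \<in> {0, 1} \<Longrightarrow> integrable (obs_measure \<theta>) (\<lambda>z. comp_resp x z \<theta> * dscore x z \<theta> k $ l)"
  "x \<in> {0, 1} \<Longrightarrow> integrable (obs_measure \<theta>) (\<lambda>z. comp_resp x z \<theta> * score x z \<theta> $ k)"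
  "integrable (obs_measure \<theta>) (\<lambda>z. comp_resp 1 z \<theta> * comp_resp 0 z \<theta> *
     ((score 1 z \<theta> - score 0 z \<theta>) $ k * (score 1 z \<theta> - score 0 z \<theta>) $ l))"
proof -
  show "integrable (obs_measure \<theta>) (\<lambda>z. comp_resp x z \<theta> * (score x z \<theta> $ k * score x z \<theta> $ l))"
    "integrable (obs_measure \<theta>) (\<lambda>z. comp_resp x z \<theta> * dscore x z \<theta> k $ l)"
    "integrable (obs_measure \<theta>) (\<lambda>z. comp_resp x z \<theta> * score x z \<theta> $ k)" if x: "x \<in> {0, 1}"
    by (intro integrable_obs_measure \<theta> poly_bounded_intros poly_bounded_comp_resp poly_bounded_score
      poly_bounded_dscore x)+
  show "integrable (obs_measure \<theta>) (\<lambda>z. comp_resp 1 z \<theta> * comp_resp 0 z \<theta> *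
     ((score 1 z \<theta> - score 0 z \<theta>) $ k * (score 1 z \<theta> - score 0 z \<theta>) $ l))"
    unfolding vector_minus_component
    by (intro integrable_obs_measure \<theta> poly_bounded_intros poly_bounded_comp_resp poly_bounded_score
      insertI1 insertI2)
qed

lemma expected_grad: "(\<integral>z. grad (loglik z) \<theta> $ k \<partial>obs_measure \<theta>) = 0"
proof -
  have "(\<integral>z. grad (loglik z) \<theta> $ k \<partial>obs_measure \<theta>)
      = (\<integral>z. comp_resp 1 z \<theta> * score 1 z \<theta> $ k + comp_resp 0 z \<theta> * score 0 z \<theta> $ k \<partial>obs_measure \<theta>)"
    by (simp add: grad_loglik[OF \<theta>])
  also have "\<dots> = (\<integral>z. comp_resp 1 z \<theta> * score 1 z \<theta> $ k \<partial>obs_measure \<theta>)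
      + (\<integral>z. comp_resp 0 z \<theta> * score 0 z \<theta> $ k \<partial>obs_measure \<theta>)"
    by (intro Bochner_Integration.integral_add integrable_score_products) auto
  also have "\<dots> = 0"
    using param_spaceD[OF \<theta>] by (simp add: component_score_mean[OF \<theta> prob] comp_weight_def)
  finally show ?thesis .
qed

lemma complete_info_nth: "complete_info \<theta> $ k $ l = component_info 1 \<theta> k l + component_info 0 \<theta> k l"
proof (cases k rule: param_index_cases; cases l rule: param_index_cases)
  interpret P: prob_space "obs_measure \<theta>" by (rule prob)
  note defs = complete_info_def complete_info_obs_nth component_info_def P.prob_space
  fix i j assume k: "k = Inl i" and l: "l = Inl j"
  have "(\<integral>z. complete_info_obs z \<theta> $ k $ l \<partial>obs_measure \<theta>) =
      comp_weight 1 \<theta> * (1 / var_of \<theta>) * gauss_vec_mean (\<lambda>h :: real ^ 'd. h $ i * h $ j)"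
    unfolding k l
    by (subst component_moment[OF \<theta>, where x = 1 and q = "\<lambda>h. h $ i * h $ j" and a = "1 / var_of \<theta>" and b = 0 and c = 0
          and d = 0 and e = 0, OF _ poly_bounded_mult[OF poly_bounded_vec_nth poly_bounded_vec_nth]])
       (simp_all add: complete_info_obs_nth)
  then show ?thesis by (simp add: complete_info_def component_info_def k l)
next
  interpret P: prob_space "obs_measure \<theta>" by (rule prob)
  assume k: "k = Inr 1" and l: "l = Inr 1"
  have "1 / (prob_of \<theta> * (1 - prob_of \<theta>)) = prob_of \<theta> * (1 / prob_of \<theta>)\<^sup>2 + (1 - prob_of \<theta>) * (1 / (1 - prob_of \<theta>))\<^sup>2"
  proof -
    have "1 / (p * q) = p * (1 / p)\<^sup>2 + q * (1 / q)\<^sup>2" if "0 < p" "0 < q" "p + q = 1" for p q :: real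
    proof -
      have "p * (1 / p)\<^sup>2 + q * (1 / q)\<^sup>2 = (p + q) / (p * q)"
        using that(1,2) by (simp add: power2_eq_square add_frac_eq add.commute)
      then show ?thesis using that(3) by simp
    qed
    from this[of "prob_of \<theta>" "1 - prob_of \<theta>"] show ?thesis using param_spaceD[OF \<theta>] by simp
  qed
  then show ?thesis unfolding k l
    by (simp add: complete_info_def complete_info_obs_nth component_info_def P.prob_space comp_weight_def)
next
  interpret P: prob_space "obs_measure \<theta>" by (rule prob)
  assume k: "k = Inr 2" and l: "l = Inr 2"
  show ?thesis unfolding k l
    by (simp add: complete_info_def complete_info_obs_nth component_info_def P.prob_space comp_weight_def power2_eq_square
       flip: distrib_right add_divide_distrib)
qed (simp_all add: complete_info_def complete_info_obs_nth component_info_def)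

text \<open>The gradient is the conditional mean of the labelled score, so this is the decomposition of a second
  moment into the moment of the conditional mean and the conditional variance.\<close>

lemma fisher_missing_complete: "fisher_info \<theta> + missing_info \<theta> = complete_info \<theta>"
proof -
  have "fisher_info \<theta> $ k $ l + missing_info \<theta> $ k $ l = complete_info \<theta> $ k $ l" for k l
  proof -
    let ?B = "\<lambda>z. comp_resp 1 z \<theta> * comp_resp 0 z \<theta> * ((score 1 z \<theta> - score 0 z \<theta>) $ k * (score 1 z \<theta> - score 0 z \<theta>) $ l)"
    let ?I = "\<lambda>x z. comp_resp x z \<theta> * (score x z \<theta> $ k * score x z \<theta> $ l)"
    have eq: "1 * ((comp_resp 1 z \<theta> *\<^sub>R score 1 z \<theta> + comp_resp 0 z \<theta> *\<^sub>R score 0 z \<theta>) $ k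
      * (comp_resp 1 z \<theta> *\<^sub>R score 1 z \<theta> + comp_resp 0 z \<theta> *\<^sub>R score 0 z \<theta>) $ l) = ?I 1 z + ?I 0 z - ?B z" for z
    proof -
      have r: "comp_resp 0 z \<theta> = 1 - comp_resp 1 z \<theta>" using comp_resp_sum[OF \<theta>, of z] by simp
      show ?thesis by (simp add: r algebra_simps)
    qed
    have "fisher_info \<theta> $ k $ l = (\<integral>z. ?I 1 z + ?I 0 z - ?B z \<partial>obs_measure \<theta>)"
      unfolding fisher_info_nth[OF \<theta>] eq ..
    also have "\<dots> = (\<integral>z. ?I 1 z \<partial>obs_measure \<theta>) + (\<integral>z. ?I 0 z \<partial>obs_measure \<theta>) - (\<integral>z. ?B z \<partial>obs_measure \<theta>)"
      by (simp only: integrable_score_products insertI1 insertI2 Bochner_Integration.integral_diff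
          Bochner_Integration.integral_add Bochner_Integration.integrable_add)
    also have "\<dots> = component_info 1 \<theta> k l + component_info 0 \<theta> k l - missing_info \<theta> $ k $ l"
      by (simp only: component_score_moments[OF \<theta> prob] insertI1 insertI2 missing_info_def vec_lambda_beta)
    finally show ?thesis by (simp add: complete_info_nth)
  qed
  then show ?thesis by (simp add: vec_eq_iff)
qed

lemma expected_hess: "(\<integral>z. hess_row z \<theta> k $ l \<partial>obs_measure \<theta>) = (- fisher_info \<theta>) $ k $ l"
proof -
  let ?B = "\<lambda>z. comp_resp 1 z \<theta> * comp_resp 0 z \<theta> * ((score 1 z \<theta> - score 0 z \<theta>) $ k * (score 1 z \<theta> - score 0 z \<theta>) $ l)"
  let ?D = "\<lambda>x z. comp_resp x z \<theta> * dscore x z \<theta> k $ l"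
  have "(\<integral>z. hess_row z \<theta> k $ l \<partial>obs_measure \<theta>) = (\<integral>z. ?D 1 z + ?D 0 z + ?B z \<partial>obs_measure \<theta>)"
    by (simp add: hess_row_def mult.assoc)
  also have "\<dots> = (\<integral>z. ?D 1 z \<partial>obs_measure \<theta>) + (\<integral>z. ?D 0 z \<partial>obs_measure \<theta>) + (\<integral>z. ?B z \<partial>obs_measure \<theta>)"
    by (simp only: integrable_score_products insertI1 insertI2
        Bochner_Integration.integral_add Bochner_Integration.integrable_add)
  also have "\<dots> = - component_info 1 \<theta> k l - component_info 0 \<theta> k l + missing_info \<theta> $ k $ l"
    by (simp only: component_dscore_moments[OF \<theta> prob] insertI1 insertI2 missing_info_def vec_lambda_beta)
  also have "\<dots> = - (complete_info \<theta> $ k $ l - missing_info \<theta> $ k $ l)" by (simp add: complete_info_nth)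
  also have "\<dots> = (- fisher_info \<theta>) $ k $ l" by (simp flip: fisher_missing_complete)
  finally show ?thesis .
qed

end

text \<open>The quadratic form at \<open>x\<close> is the integral of \<open>w (u \<bullet> x)\<^sup>2\<close>.\<close>

lemma second_moment_matrix_psd:
  fixes u :: "'a \<Rightarrow> real ^ 'n::finite"
  assumes B: "\<And>k l. B $ k $ l = (\<integral>z. w z * (u z $ k * u z $ l) \<partial>M)"
    and int: "\<And>k l. integrable M (\<lambda>z. w z * (u z $ k * u z $ l))" and w: "\<And>z. 0 \<le> w z"
  shows "x \<bullet> (B *v y) = y \<bullet> (B *v x)" and "0 \<le> x \<bullet> (B *v x)"
proof -
  have eq: "x \<bullet> (B *v y) = (\<integral>z. w z * ((u z \<bullet> x) * (u z \<bullet> y)) \<partial>M)" for x y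
  proof -
    have "(\<integral>z. w z * ((u z \<bullet> x) * (u z \<bullet> y)) \<partial>M)
        = (\<integral>z. (\<Sum>k\<in>UNIV. \<Sum>l\<in>UNIV. x $ k * y $ l * (w z * (u z $ k * u z $ l))) \<partial>M)"
    proof -
      have "w z * ((u z \<bullet> x) * (u z \<bullet> y)) = (\<Sum>k\<in>UNIV. \<Sum>l\<in>UNIV. x $ k * y $ l * (w z * (u z $ k * u z $ l)))" for z
      proof -
        have "w z * ((u z \<bullet> x) * (u z \<bullet> y)) = w z * (\<Sum>k\<in>UNIV. \<Sum>l\<in>UNIV. (u z $ k * x $ k) * (u z $ l * y $ l))"
          unfolding inner_vec_def inner_real_def sum_product ..
        also have "\<dots> = (\<Sum>k\<in>UNIV. \<Sum>l\<in>UNIV. x $ k * y $ l * (w z * (u z $ k * u z $ l)))"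
          unfolding sum_distrib_left by (intro sum.cong refl) (simp only: mult_ac)
        finally show ?thesis .
      qed
      then show ?thesis by presburger
    qed
    also have "\<dots> = (\<Sum>k\<in>UNIV. (\<integral>z. (\<Sum>l\<in>UNIV. x $ k * y $ l * (w z * (u z $ k * u z $ l))) \<partial>M))"
      by (intro Bochner_Integration.integral_sum Bochner_Integration.integrable_sum integrable_mult_right int)
    also have "\<dots> = (\<Sum>k\<in>UNIV. \<Sum>l\<in>UNIV. x $ k * y $ l * B $ k $ l)"
      unfolding B
      by (intro sum.cong refl) (subst Bochner_Integration.integral_sum, auto intro!: int)
    also have "\<dots> = x \<bullet> (B *v y)"
      by (simp add: inner_vec_def matrix_vector_mult_def sum_distrib_left algebra_simps)
    finally show ?thesis by simp
  qed
  show "x \<bullet> (B *v y) = y \<bullet> (B *v x)" unfolding eq by (simp add: mult.commute)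
  show "0 \<le> x \<bullet> (B *v x)" unfolding eq by (intro Bochner_Integration.integral_nonneg mult_nonneg_nonneg w zero_le_square)
qed

lemma fisher_info_psd:
  assumes \<theta>: "\<theta> \<in> param_space"
  shows "x \<bullet> (fisher_info \<theta> *v y) = y \<bullet> (fisher_info \<theta> *v x)" and "0 \<le> x \<bullet> (fisher_info \<theta> *v x)"
proof -
  have int: "integrable (obs_measure \<theta>) (\<lambda>z. 1 * ((comp_resp 1 z \<theta> *\<^sub>R score 1 z \<theta> + comp_resp 0 z \<theta> *\<^sub>R score 0 z \<theta>) $ k
    * (comp_resp 1 z \<theta> *\<^sub>R score 1 z \<theta> + comp_resp 0 z \<theta> *\<^sub>R score 0 z \<theta>) $ l))" for k l
    unfolding vector_add_component vector_scaleR_component real_scaleR_def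
    by (intro integrable_obs_measure \<theta> poly_bounded_intros poly_bounded_comp_resp poly_bounded_score insertI1 insertI2)
  show "x \<bullet> (fisher_info \<theta> *v y) = y \<bullet> (fisher_info \<theta> *v x)" "0 \<le> x \<bullet> (fisher_info \<theta> *v x)"
    by (rule second_moment_matrix_psd[OF fisher_info_nth[OF \<theta>] int]; simp)+
qed

lemma missing_info_psd:
  assumes \<theta>: "\<theta> \<in> param_space"
  shows "x \<bullet> (missing_info \<theta> *v y) = y \<bullet> (missing_info \<theta> *v x)" and "0 \<le> x \<bullet> (missing_info \<theta> *v x)"
proof -
  have int: "integrable (obs_measure \<theta>) (\<lambda>z. comp_resp 1 z \<theta> * comp_resp 0 z \<theta> *
     ((score 1 z \<theta> - score 0 z \<theta>) $ k * (score 1 z \<theta> - score 0 z \<theta>) $ l))" for k l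
    unfolding vector_minus_component
    by (intro integrable_obs_measure \<theta> poly_bounded_intros poly_bounded_comp_resp poly_bounded_score insertI1 insertI2)
  have w: "0 \<le> comp_resp 1 z \<theta> * comp_resp 0 z \<theta>" for z
    using comp_resp_bounds(1)[OF \<theta>, of 1 z] comp_resp_bounds(1)[OF \<theta>, of 0 z] by simp
  have nth: "missing_info \<theta> $ k $ l = (\<integral>z. comp_resp 1 z \<theta> * comp_resp 0 z \<theta> *
     ((score 1 z \<theta> - score 0 z \<theta>) $ k * (score 1 z \<theta> - score 0 z \<theta>) $ l) \<partial>obs_measure \<theta>)" for k l
    by (simp only: missing_info_def vec_lambda_beta)
  show "x \<bullet> (missing_info \<theta> *v y) = y \<bullet> (missing_info \<theta> *v x)" "0 \<le> x \<bullet> (missing_info \<theta> *v x)"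
    by (rule second_moment_matrix_psd[OF nth int w])+
qed

section \<open>Lipschitz dependence on the parameter\<close>

lemma poly_bounded_abs: "poly_bounded f \<Longrightarrow> poly_bounded (\<lambda>z. \<bar>f z\<bar>)"
  using poly_bounded_mono[of f "\<lambda>z. \<bar>f z\<bar>"] poly_bounded_measurable[of f] by simp

text \<open>One polynomially bounded function of the observation dominates both the values and the Lipschitz
  constants in the parameter. Demanding the two together makes the class closed under products.\<close>

definition poly_lipschitz :: "'b::real_normed_vector set \<Rightarrow> ('a::euclidean_space \<Rightarrow> 'b \<Rightarrow> real) \<Rightarrow> bool" where
  "poly_lipschitz K g \<longleftrightarrow> (\<forall>\<theta>\<in>K. (\<lambda>z. g z \<theta>) \<in> borel_measurable borel) \<and>
     (\<exists>h. poly_bounded h \<and> (\<forall>z. \<forall>\<theta>\<in>K. \<bar>g z \<theta>\<bar> \<le> h z) \<and>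
       (\<forall>z. \<forall>\<theta>\<in>K. \<forall>t\<in>K. \<bar>g z \<theta> - g z t\<bar> \<le> h z * norm (\<theta> - t)))"

lemma poly_lipschitzI:
  assumes "\<And>\<theta>. \<theta> \<in> K \<Longrightarrow> (\<lambda>z. g z \<theta>) \<in> borel_measurable borel" "poly_bounded h"
    "\<And>z \<theta>. \<theta> \<in> K \<Longrightarrow> \<bar>g z \<theta>\<bar> \<le> h z"
    "\<And>z \<theta> t. \<theta> \<in> K \<Longrightarrow> t \<in> K \<Longrightarrow> \<bar>g z \<theta> - g z t\<bar> \<le> h z * norm (\<theta> - t)"
  shows "poly_lipschitz K g"
  using assms unfolding poly_lipschitz_def by blast

lemma poly_lipschitzD:
  assumes "poly_lipschitz K g"
  shows "\<exists>h. poly_bounded h \<and> (\<forall>z. 0 \<le> h z) \<and> (\<forall>z. \<forall>\<theta>\<in>K. \<bar>g z \<theta>\<bar> \<le> h z) \<and>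
       (\<forall>z. \<forall>\<theta>\<in>K. \<forall>t\<in>K. \<bar>g z \<theta> - g z t\<bar> \<le> h z * norm (\<theta> - t))"
proof -
  obtain h where h: "poly_bounded h" "\<And>z \<theta>. \<theta> \<in> K \<Longrightarrow> \<bar>g z \<theta>\<bar> \<le> h z"
    "\<And>z \<theta> t. \<theta> \<in> K \<Longrightarrow> t \<in> K \<Longrightarrow> \<bar>g z \<theta> - g z t\<bar> \<le> h z * norm (\<theta> - t)"
    using assms unfolding poly_lipschitz_def by blast
  have "\<bar>g z \<theta>\<bar> \<le> \<bar>h z\<bar>" if "\<theta> \<in> K" for z \<theta> using h(2)[OF that, of z] by linarith
  moreover have "\<bar>g z \<theta> - g z t\<bar> \<le> \<bar>h z\<bar> * norm (\<theta> - t)" if "\<theta> \<in> K" "t \<in> K" for z \<theta> t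
    by (rule order_trans[OF h(3)[OF that] mult_right_mono]) auto
  ultimately show ?thesis using poly_bounded_abs[OF h(1)] by (intro exI[of _ "\<lambda>z. \<bar>h z\<bar>"]) auto
qed

lemma poly_lipschitz_measurable:
  "poly_lipschitz K g \<Longrightarrow> \<theta> \<in> K \<Longrightarrow> (\<lambda>z. g z \<theta>) \<in> borel_measurable borel"
  by (simp add: poly_lipschitz_def)

lemma poly_lipschitz_cong:
  assumes "\<And>z \<theta>. \<theta> \<in> K \<Longrightarrow> f z \<theta> = g z \<theta>"
  shows "poly_lipschitz K f \<longleftrightarrow> poly_lipschitz K g"
  using assms by (simp add: poly_lipschitz_def)

lemma poly_lipschitz_obs: "poly_bounded f \<Longrightarrow> poly_lipschitz K (\<lambda>z \<theta>. f z)"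
  by (rule poly_lipschitzI[where h = "\<lambda>z. \<bar>f z\<bar>"]) (auto simp: poly_bounded_measurable poly_bounded_abs)

lemma poly_lipschitz_const: "poly_lipschitz K (\<lambda>z \<theta>. c)"
  by (rule poly_lipschitz_obs[OF poly_bounded_const])

lemma poly_lipschitz_add:
  assumes f: "poly_lipschitz K f" and g: "poly_lipschitz K g"
  shows "poly_lipschitz K (\<lambda>z \<theta>. f z \<theta> + g z \<theta>)"
proof -
  obtain h where h: "poly_bounded h" "\<And>z \<theta>. \<theta> \<in> K \<Longrightarrow> \<bar>f z \<theta>\<bar> \<le> h z"
    "\<And>z \<theta> t. \<theta> \<in> K \<Longrightarrow> t \<in> K \<Longrightarrow> \<bar>f z \<theta> - f z t\<bar> \<le> h z * norm (\<theta> - t)"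
    using poly_lipschitzD[OF f] by blast
  obtain k where k: "poly_bounded k" "\<And>z \<theta>. \<theta> \<in> K \<Longrightarrow> \<bar>g z \<theta>\<bar> \<le> k z"
    "\<And>z \<theta> t. \<theta> \<in> K \<Longrightarrow> t \<in> K \<Longrightarrow> \<bar>g z \<theta> - g z t\<bar> \<le> k z * norm (\<theta> - t)"
    using poly_lipschitzD[OF g] by blast
  show ?thesis
  proof (rule poly_lipschitzI[OF _ poly_bounded_add[OF h(1) k(1)]])
    fix z \<theta> assume \<theta>: "\<theta> \<in> K"
    show "(\<lambda>z. f z \<theta> + g z \<theta>) \<in> borel_measurable borel"
      using poly_lipschitz_measurable[OF f \<theta>] poly_lipschitz_measurable[OF g \<theta>] by simp
    show "\<bar>f z \<theta> + g z \<theta>\<bar> \<le> h z + k z" using h(2)[OF \<theta>, of z] k(2)[OF \<theta>, of z] by linarith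
    fix t assume t: "t \<in> K"
    show "\<bar>(f z \<theta> + g z \<theta>) - (f z t + g z t)\<bar> \<le> (h z + k z) * norm (\<theta> - t)"
      using h(3)[OF \<theta> t, of z] k(3)[OF \<theta> t, of z] unfolding distrib_right by linarith
  qed
qed

lemma poly_lipschitz_mult:
  assumes f: "poly_lipschitz K f" and g: "poly_lipschitz K g"
  shows "poly_lipschitz K (\<lambda>z \<theta>. f z \<theta> * g z \<theta>)"
proof -
  obtain h where h: "poly_bounded h" "\<And>z. 0 \<le> h z" "\<And>z \<theta>. \<theta> \<in> K \<Longrightarrow> \<bar>f z \<theta>\<bar> \<le> h z"
    "\<And>z \<theta> t. \<theta> \<in> K \<Longrightarrow> t \<in> K \<Longrightarrow> \<bar>f z \<theta> - f z t\<bar> \<le> h z * norm (\<theta> - t)"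
    using poly_lipschitzD[OF f] by blast
  obtain k where k: "poly_bounded k" "\<And>z. 0 \<le> k z" "\<And>z \<theta>. \<theta> \<in> K \<Longrightarrow> \<bar>g z \<theta>\<bar> \<le> k z"
    "\<And>z \<theta> t. \<theta> \<in> K \<Longrightarrow> t \<in> K \<Longrightarrow> \<bar>g z \<theta> - g z t\<bar> \<le> k z * norm (\<theta> - t)"
    using poly_lipschitzD[OF g] by blast
  show ?thesis
  proof (rule poly_lipschitzI[where h = "\<lambda>z. 2 * (h z * k z)"])
    show "poly_bounded (\<lambda>z. 2 * (h z * k z))" by (intro poly_bounded_intros h k)
    fix z \<theta> assume \<theta>: "\<theta> \<in> K"
    show "(\<lambda>z. f z \<theta> * g z \<theta>) \<in> borel_measurable borel"
      using poly_lipschitz_measurable[OF f \<theta>] poly_lipschitz_measurable[OF g \<theta>] by simp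
    have "\<bar>f z \<theta> * g z \<theta>\<bar> \<le> h z * k z" unfolding abs_mult by (intro mult_mono h k \<theta>) auto
    then show "\<bar>f z \<theta> * g z \<theta>\<bar> \<le> 2 * (h z * k z)" using h(2)[of z] k(2)[of z] mult_nonneg_nonneg[of "h z" "k z"] by linarith
    fix t assume t: "t \<in> K"
    have "f z \<theta> * g z \<theta> - f z t * g z t = f z \<theta> * (g z \<theta> - g z t) + (f z \<theta> - f z t) * g z t"
      by (simp add: algebra_simps)
    also have "\<bar>\<dots>\<bar> \<le> h z * (k z * norm (\<theta> - t)) + (h z * norm (\<theta> - t)) * k z"
      by (intro order_trans[OF abs_triangle_ineq] add_mono; unfold abs_mult; intro mult_mono h k \<theta> t)
        (auto simp: h k)
    finally show "\<bar>f z \<theta> * g z \<theta> - f z t * g z t\<bar> \<le> 2 * (h z * k z) * norm (\<theta> - t)" by (simp add: algebra_simps)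
  qed
qed

lemma poly_lipschitz_minus: "poly_lipschitz K f \<Longrightarrow> poly_lipschitz K (\<lambda>z \<theta>. - f z \<theta>)"
  using poly_lipschitz_mult[OF poly_lipschitz_const[of K "-1"], of f] by simp

lemma poly_lipschitz_diff:
  "poly_lipschitz K f \<Longrightarrow> poly_lipschitz K g \<Longrightarrow> poly_lipschitz K (\<lambda>z \<theta>. f z \<theta> - g z \<theta>)"
  using poly_lipschitz_add[OF _ poly_lipschitz_minus, of K f g] by simp

lemma poly_lipschitz_power: "poly_lipschitz K f \<Longrightarrow> poly_lipschitz K (\<lambda>z \<theta>. f z \<theta> ^ n)"
  by (induction n) (auto intro: poly_lipschitz_const poly_lipschitz_mult)

lemma poly_lipschitz_sum:
  "(\<And>i. i \<in> I \<Longrightarrow> poly_lipschitz K (f i)) \<Longrightarrow> poly_lipschitz K (\<lambda>z \<theta>. \<Sum>i\<in>I. f i z \<theta>)"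
  by (induction I rule: infinite_finite_induct) (auto intro: poly_lipschitz_const poly_lipschitz_add)

lemma poly_lipschitz_divide:
  assumes f: "poly_lipschitz K f" and g: "poly_lipschitz K g" and b: "0 < b" "\<And>z \<theta>. \<theta> \<in> K \<Longrightarrow> b \<le> g z \<theta>"
  shows "poly_lipschitz K (\<lambda>z \<theta>. f z \<theta> / g z \<theta>)"
proof -
  obtain k where k: "poly_bounded k" "\<And>z. 0 \<le> k z" "\<And>z \<theta>. \<theta> \<in> K \<Longrightarrow> \<bar>g z \<theta>\<bar> \<le> k z"
    "\<And>z \<theta> t. \<theta> \<in> K \<Longrightarrow> t \<in> K \<Longrightarrow> \<bar>g z \<theta> - g z t\<bar> \<le> k z * norm (\<theta> - t)"
    using poly_lipschitzD[OF g] by blast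
  have "poly_lipschitz K (\<lambda>z \<theta>. inverse (g z \<theta>))"
  proof (rule poly_lipschitzI[where h = "\<lambda>z. 1 / b + 1 / (b * b) * k z"])
    show "poly_bounded (\<lambda>z. 1 / b + 1 / (b * b) * k z)" by (intro poly_bounded_intros k)
    fix z \<theta> assume \<theta>: "\<theta> \<in> K"
    show "(\<lambda>z. inverse (g z \<theta>)) \<in> borel_measurable borel"
      using poly_lipschitz_measurable[OF g \<theta>] by simp
    have pos: "0 < g z \<theta>" using b(1) b(2)[OF \<theta>, of z] by linarith
    have nn: "0 \<le> 1 / (b * b) * k z" using k(2)[of z] b(1) by simp
    have "inverse (g z \<theta>) \<le> 1 / b" using b(1) b(2)[OF \<theta>, of z] by (simp add: inverse_eq_divide frac_le)
    then show "\<bar>inverse (g z \<theta>)\<bar> \<le> 1 / b + 1 / (b * b) * k z" using pos nn by simp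
    fix t assume t: "t \<in> K"
    have pos': "0 < g z t" using b(1) b(2)[OF t, of z] by linarith
    have "\<bar>inverse (g z \<theta>) - inverse (g z t)\<bar> = \<bar>g z \<theta> - g z t\<bar> / (g z \<theta> * g z t)"
      using pos pos' by (simp add: inverse_diff_inverse abs_mult divide_inverse abs_minus_commute)
    also have "\<dots> \<le> (k z * norm (\<theta> - t)) / (b * b)"
      using b(1) b(2)[OF \<theta>, of z] b(2)[OF t, of z] k(2)[of z]
      by (intro frac_le mult_mono k(4) \<theta> t) auto
    also have "\<dots> = (1 / (b * b) * k z) * norm (\<theta> - t)" by simp
    also have "\<dots> \<le> (1 / b + 1 / (b * b) * k z) * norm (\<theta> - t)" using b(1) by (intro mult_right_mono) auto
    finally show "\<bar>inverse (g z \<theta>) - inverse (g z t)\<bar> \<le> (1 / b + 1 / (b * b) * k z) * norm (\<theta> - t)" .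
  qed
  then show ?thesis unfolding divide_inverse by (rule poly_lipschitz_mult[OF f])
qed

lemma poly_lipschitz_linear:
  assumes L: "bounded_linear L" and "bounded K"
  shows "poly_lipschitz K (\<lambda>z \<theta>. L \<theta>)"
proof -
  obtain C where C: "0 < C" "\<And>x. norm (L x) \<le> norm x * C" using bounded_linear.pos_bounded[OF L] by blast
  obtain R where R: "\<And>x. x \<in> K \<Longrightarrow> norm x \<le> R" using \<open>bounded K\<close> unfolding bounded_iff by blast
  show ?thesis
  proof (rule poly_lipschitzI[where h = "\<lambda>z. \<bar>R\<bar> * C + C"])
    fix z \<theta> assume \<theta>: "\<theta> \<in> K"
    have "norm \<theta> * C \<le> \<bar>R\<bar> * C" using R[OF \<theta>] C(1) by (intro mult_right_mono) auto
    then show "\<bar>L \<theta>\<bar> \<le> \<bar>R\<bar> * C + C" using C(1) C(2)[of \<theta>] unfolding real_norm_def by linarith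
    fix t
    have "\<bar>L \<theta> - L t\<bar> \<le> norm (\<theta> - t) * C" using C(2)[of "\<theta> - t"] by (simp add: linear_diff[OF bounded_linear.linear[OF L]])
    also have "\<dots> \<le> (\<bar>R\<bar> * C + C) * norm (\<theta> - t)" using C(1) by (subst mult.commute, intro mult_right_mono) auto
    finally show "\<bar>L \<theta> - L t\<bar> \<le> (\<bar>R\<bar> * C + C) * norm (\<theta> - t)" .
  qed (auto simp: poly_bounded_const)
qed

text \<open>This is how the responsibility enters the class: it is not a rational function of the parameters,
  but its gradient is dominated by scores.\<close>

lemma poly_lipschitz_deriv:
  fixes g :: "'a::euclidean_space \<Rightarrow> 'b::real_inner \<Rightarrow> real"
  assumes "convex K" and meas: "\<And>\<theta>. \<theta> \<in> K \<Longrightarrow> (\<lambda>z. g z \<theta>) \<in> borel_measurable borel"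
    and h: "poly_bounded h" "\<And>z \<theta>. \<theta> \<in> K \<Longrightarrow> \<bar>g z \<theta>\<bar> \<le> h z"
    and D: "\<And>z \<theta>. \<theta> \<in> K \<Longrightarrow> GDERIV (g z) \<theta> :> D z \<theta>"
    and k: "poly_bounded k" "\<And>z \<theta>. \<theta> \<in> K \<Longrightarrow> norm (D z \<theta>) \<le> k z"
  shows "poly_lipschitz K g"
proof (rule poly_lipschitzI[where h = "\<lambda>z. \<bar>h z\<bar> + \<bar>k z\<bar>"])
  show "poly_bounded (\<lambda>z. \<bar>h z\<bar> + \<bar>k z\<bar>)" by (intro poly_bounded_intros poly_bounded_abs h k)
  fix z \<theta> assume \<theta>: "\<theta> \<in> K"
  show "(\<lambda>z. g z \<theta>) \<in> borel_measurable borel" by (rule meas[OF \<theta>])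
  show "\<bar>g z \<theta>\<bar> \<le> \<bar>h z\<bar> + \<bar>k z\<bar>" using h(2)[OF \<theta>, of z] by linarith
  fix t assume t: "t \<in> K"
  have "norm (g z \<theta> - g z t) \<le> k z * norm (\<theta> - t)"
  proof (rule differentiable_bound[OF \<open>convex K\<close> _ _ \<theta> t])
    fix x assume x: "x \<in> K"
    show "(g z has_derivative (\<lambda>d. d \<bullet> D z x)) (at x within K)"
      using D[OF x] unfolding gderiv_def by (rule has_derivative_at_withinI)
    show "onorm (\<lambda>d. d \<bullet> D z x) \<le> k z"
    proof (rule onorm_bound)
      show "0 \<le> k z" by (rule order_trans[OF norm_ge_zero k(2)[OF x]])
      show "norm (d \<bullet> D z x) \<le> k z * norm d" for d
      proof -
        have "norm (d \<bullet> D z x) \<le> norm d * norm (D z x)" using Cauchy_Schwarz_ineq2 by simp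
        also have "\<dots> \<le> norm d * k z" by (intro mult_left_mono k(2) x) auto
        finally show ?thesis by (simp add: mult.commute)
      qed
    qed
  qed
  also have "\<dots> \<le> (\<bar>h z\<bar> + \<bar>k z\<bar>) * norm (\<theta> - t)" by (intro mult_right_mono) auto
  finally show "\<bar>g z \<theta> - g z t\<bar> \<le> (\<bar>h z\<bar> + \<bar>k z\<bar>) * norm (\<theta> - t)" by simp
qed

lemmas poly_lipschitz_intros = poly_lipschitz_const poly_lipschitz_add poly_lipschitz_mult
  poly_lipschitz_minus poly_lipschitz_diff poly_lipschitz_power

text \<open>A convex bounded set of parameters that keeps a distance \<open>b\<close> from the boundary of the parameter
  space, so that divisions by \<open>p\<close>, \<open>1 - p\<close> and \<open>\<sigma>\<^sup>2\<close> are harmless.\<close>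

locale param_ball =
  fixes K :: "'d::finite param set" and b :: real
  assumes conv: "convex K" and bdd: "bounded K" and b_pos: "0 < b"
    and margin: "\<And>\<theta>. \<theta> \<in> K \<Longrightarrow> b \<le> prob_of \<theta> \<and> b \<le> 1 - prob_of \<theta> \<and> b \<le> var_of \<theta>"
begin

lemma K_param_space: "\<theta> \<in> K \<Longrightarrow> \<theta> \<in> param_space"
  using margin[of \<theta>] b_pos by (auto simp: param_space_def)

lemma poly_lipschitz_prob: "poly_lipschitz K (\<lambda>z \<theta>. prob_of \<theta>)"
  and poly_lipschitz_var: "poly_lipschitz K (\<lambda>z \<theta>. var_of \<theta>)"
  by (intro poly_lipschitz_linear bounded_linear_sel bdd)+

lemma poly_lipschitz_snd: "poly_lipschitz K (\<lambda>(z :: 'd obs) \<theta>. snd z $ i)"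
  by (rule poly_lipschitz_obs[OF poly_bounded_snd_nth])

lemma poly_lipschitz_resid: "poly_lipschitz K (resid x)"
proof -
  have "poly_lipschitz K (\<lambda>(z :: 'd obs) \<theta>. fst z - x * (\<Sum>i\<in>UNIV. snd z $ i * \<theta> $ Inl i))"
    by (intro poly_lipschitz_intros poly_lipschitz_sum poly_lipschitz_snd poly_lipschitz_obs[OF poly_bounded_fst]
        poly_lipschitz_linear bounded_linear_vec_nth bdd)
  then show ?thesis by (simp add: resid_def[abs_def] inner_vec_def mean_of_def)
qed

lemma poly_lipschitz_div_p: "poly_lipschitz K f \<Longrightarrow> poly_lipschitz K (\<lambda>z \<theta>. f z \<theta> / prob_of \<theta>)"
  by (rule poly_lipschitz_divide[OF _ poly_lipschitz_prob b_pos]) (use margin in auto)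

lemma poly_lipschitz_div_q: "poly_lipschitz K f \<Longrightarrow> poly_lipschitz K (\<lambda>z \<theta>. f z \<theta> / (1 - prob_of \<theta>))"
  by (rule poly_lipschitz_divide[OF _ _ b_pos]) (use margin in \<open>auto intro!: poly_lipschitz_intros poly_lipschitz_prob\<close>)

lemma poly_lipschitz_div_v: "poly_lipschitz K f \<Longrightarrow> poly_lipschitz K (\<lambda>z \<theta>. f z \<theta> / var_of \<theta>)"
  by (rule poly_lipschitz_divide[OF _ poly_lipschitz_var b_pos]) (use margin in auto)

lemma poly_lipschitz_half: "poly_lipschitz K f \<Longrightarrow> poly_lipschitz K (\<lambda>z \<theta>. f z \<theta> / 2)"
  using poly_lipschitz_mult[OF _ poly_lipschitz_const[of K "1 / 2"], of f] by simp

lemmas poly_lipschitz_rational = poly_lipschitz_intros poly_lipschitz_div_p poly_lipschitz_div_q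
  poly_lipschitz_div_v poly_lipschitz_half poly_lipschitz_resid poly_lipschitz_snd

lemma poly_lipschitz_score: "poly_lipschitz K (\<lambda>z \<theta>. score x z \<theta> $ k)"
  by (cases k rule: param_index_cases) (simp only: score_nth, intro poly_lipschitz_rational)+

lemma poly_lipschitz_dscore: "poly_lipschitz K (\<lambda>z \<theta>. dscore x z \<theta> k $ l)"
  by (cases k rule: param_index_cases; cases l rule: param_index_cases)
    (simp only: dscore_nth, intro poly_lipschitz_rational)+

lemma poly_lipschitz_comp_resp1: "poly_lipschitz K (comp_resp 1)"
proof -
  have "poly_lipschitz K (\<lambda>z \<theta>. score 1 z \<theta> $ k - score 0 z \<theta> $ k)" for k
    by (intro poly_lipschitz_diff poly_lipschitz_score)
  then have "\<exists>h. poly_bounded h \<and> (\<forall>z. \<forall>\<theta>\<in>K. \<bar>(score 1 z \<theta> - score 0 z \<theta>) $ k\<bar> \<le> h z)" for k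
    unfolding poly_lipschitz_def vector_minus_component by blast
  then obtain h where h: "\<And>k. poly_bounded (h k)"
    "\<And>k z \<theta>. \<theta> \<in> K \<Longrightarrow> \<bar>(score 1 z \<theta> - score 0 z \<theta>) $ k\<bar> \<le> h k z"
    by metis
  show ?thesis
  proof (rule poly_lipschitz_deriv[OF conv _ poly_bounded_const[of 1] _ GDERIV_comp_resp1])
    show "poly_bounded (\<lambda>z. \<Sum>k\<in>UNIV. h k z)" by (intro poly_bounded_sum h)
    fix z \<theta> assume \<theta>: "\<theta> \<in> K"
    note \<theta>' = K_param_space[OF \<theta>]
    show "\<theta> \<in> param_space" by (rule \<theta>')
    show "(\<lambda>z. comp_resp 1 z \<theta>) \<in> borel_measurable borel" by simp
    show "\<bar>comp_resp 1 z \<theta>\<bar> \<le> 1" using comp_resp_bounds[OF \<theta>', of 1 z] by simp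
    have "0 \<le> comp_resp 1 z \<theta> * comp_resp 0 z \<theta>" "comp_resp 1 z \<theta> * comp_resp 0 z \<theta> \<le> 1"
      using comp_resp_bounds[OF \<theta>', of 1 z] comp_resp_bounds[OF \<theta>', of 0 z]
      by (auto intro: mult_le_one)
    then have "norm ((comp_resp 1 z \<theta> * comp_resp 0 z \<theta>) *\<^sub>R (score 1 z \<theta> - score 0 z \<theta>)) \<le> 1 * norm (score 1 z \<theta> - score 0 z \<theta>)"
      unfolding norm_scaleR by (intro mult_right_mono) auto
    also have "\<dots> \<le> (\<Sum>k\<in>UNIV. h k z)"
      unfolding mult_1 by (rule order_trans[OF norm_le_l1_cart sum_mono[OF h(2)[OF \<theta>]]])
    finally show "norm ((comp_resp 1 z \<theta> * comp_resp 0 z \<theta>) *\<^sub>R (score 1 z \<theta> - score 0 z \<theta>)) \<le> (\<Sum>k\<in>UNIV. h k z)" .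
  qed
qed

lemma poly_lipschitz_comp_resp0: "poly_lipschitz K (comp_resp 0)"
proof (subst poly_lipschitz_cong)
  show "comp_resp 0 z \<theta> = 1 - comp_resp 1 z \<theta>" if "\<theta> \<in> K" for z \<theta>
    using comp_resp_sum[OF K_param_space[OF that], of z] by simp
  show "poly_lipschitz K (\<lambda>(z :: 'd obs) \<theta>. 1 - comp_resp 1 z \<theta>)"
    by (intro poly_lipschitz_intros poly_lipschitz_comp_resp1)
qed

lemma poly_lipschitz_hess_row: "poly_lipschitz K (\<lambda>z \<theta>. hess_row z \<theta> k $ l)"
  unfolding hess_row_def vector_add_component vector_scaleR_component vector_minus_component real_scaleR_def
  by (intro poly_lipschitz_intros poly_lipschitz_comp_resp1 poly_lipschitz_comp_resp0 poly_lipschitz_score poly_lipschitz_dscore)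

lemma poly_lipschitz_complete_info_obs: "poly_lipschitz K (\<lambda>z \<theta>. complete_info_obs z \<theta> $ k $ l)"
  by (cases k rule: param_index_cases; cases l rule: param_index_cases)
    (simp only: complete_info_obs_nth, intro poly_lipschitz_rational poly_lipschitz_comp_resp1)+

end

lemma param_ball_exists:
  assumes \<theta>: "\<theta>s \<in> param_space"
  shows "\<exists>\<rho>>0. param_ball (cball \<theta>s \<rho>) \<rho>"
proof -
  \<comment> \<open>Half the distance to the boundary: a coordinate moves by at most \<rho> and starts at least 2 \<rho> away.\<close>
  define \<rho> where "\<rho> = min (prob_of \<theta>s) (min (1 - prob_of \<theta>s) (var_of \<theta>s)) / 2"
  have \<rho>: "0 < \<rho>" "2 * \<rho> \<le> prob_of \<theta>s" "2 * \<rho> \<le> 1 - prob_of \<theta>s" "2 * \<rho> \<le> var_of \<theta>s"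
    using param_spaceD[OF \<theta>] by (auto simp: \<rho>_def)
  have "\<rho> \<le> prob_of \<theta> \<and> \<rho> \<le> 1 - prob_of \<theta> \<and> \<rho> \<le> var_of \<theta>" if "\<theta> \<in> cball \<theta>s \<rho>" for \<theta>
  proof -
    have "\<bar>(\<theta>s - \<theta>) $ k\<bar> \<le> \<rho>" for k
      using that order_trans[OF component_le_norm_cart[of "\<theta>s - \<theta>" k]] by (simp add: dist_norm)
    from this[of "Inr 1"] this[of "Inr 2"] show ?thesis
      using \<rho> by (simp add: prob_of_def var_of_def abs_le_iff)
  qed
  then show ?thesis using \<rho>(1) by (intro exI[of _ \<rho>] conjI, simp) (unfold_locales, auto)
qed

section \<open>Empirical means over the sample\<close>

lemma linear_emp_mean: "linear f \<Longrightarrow> f (emp_mean N zs g) = emp_mean N zs (\<lambda>z. f (g z))"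
  by (simp add: emp_mean_def linear_scale linear_sum)

lemma emp_mean_diff: "emp_mean N zs (\<lambda>z. f z - g z) = emp_mean N zs f - emp_mean N zs g"
  by (simp add: emp_mean_def sum_subtractf scaleR_diff_right)

lemma norm_emp_mean_le:
  fixes f :: "'a \<Rightarrow> 'b::real_normed_vector"
  assumes "\<And>z. norm (f z) \<le> g z"
  shows "norm (emp_mean N zs f) \<le> emp_mean N zs g"
  unfolding emp_mean_def norm_scaleR real_scaleR_def
  by (intro mult_mono order_trans[OF norm_sum] sum_mono assms) (auto intro!: sum_nonneg)

lemma norm_le_sum_norm_nth: "norm x \<le> (\<Sum>i\<in>UNIV. norm (x $ i))"
  unfolding norm_vec_def by (intro L2_set_le_sum) auto

locale mixture_sample = prob_space M
  for M :: "'w measure" and \<theta>s :: "'d::finite param" and Z :: "nat \<Rightarrow> 'w \<Rightarrow> 'd obs" +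
  assumes \<theta>s: "\<theta>s \<in> param_space"
    and indep: "indep_vars (\<lambda>_. borel) Z {1..}"
    and dist: "\<And>n. n \<ge> 1 \<Longrightarrow> distributed M lborel (Z n) (\<lambda>z. ennreal (mix_density \<theta>s z))"
begin

lemma Z_measurable: "1 \<le> n \<Longrightarrow> Z n \<in> borel_measurable M"
  using distributed_measurable[OF dist] by simp

lemma distr_Z: "1 \<le> n \<Longrightarrow> distr M borel (Z n) = obs_measure \<theta>s"
  using distributed_distr_eq_density[OF dist, of n]
  by (simp add: obs_measure_def cong: distr_cong)

lemma prob_space_obs: "prob_space (obs_measure \<theta>s)"
  using prob_space_distr[OF Z_measurable[of 1]] distr_Z[of 1] by simp

lemma emp_mean_measurable:
  fixes F :: "'d obs \<Rightarrow> 'b::euclidean_space"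
  assumes F: "F \<in> borel_measurable borel"
  shows "(\<lambda>\<omega>. emp_mean N (\<lambda>n. Z n \<omega>) F) \<in> borel_measurable M"
  unfolding emp_mean_def
  by (intro borel_measurable_scaleR borel_measurable_const borel_measurable_sum measurable_compose[OF Z_measurable F]) auto

lemma emp_mean_whp:
  assumes g: "poly_bounded g" and "0 < \<epsilon>"
  shows "whp M (\<lambda>N \<omega>. norm (emp_mean N (\<lambda>n. Z n \<omega>) g - integral\<^sup>L (obs_measure \<theta>s) g) < \<epsilon>)"
proof -
  note gm = poly_bounded_measurable[OF g]
  have g2: "poly_bounded (\<lambda>z. (g z)\<^sup>2)" by (rule poly_bounded_power[OF g])
  note gm2 = poly_bounded_measurable[OF g2]
  have "whp M (\<lambda>N \<omega>. \<bar>(1 / real N) * (\<Sum>n = 1..N. g (Z n \<omega>)) - integral\<^sup>L (obs_measure \<theta>s) g\<bar> < \<epsilon>)"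
  proof (rule weak_law_of_large_numbers[OF _ _ _ _ \<open>0 < \<epsilon>\<close>])
    show "indep_vars (\<lambda>_. borel) (\<lambda>n \<omega>. g (Z n \<omega>)) {1..}"
      by (rule indep_vars_compose2[OF indep gm])
    fix n :: nat assume n: "1 \<le> n"
    show "integrable M (\<lambda>\<omega>. (g (Z n \<omega>))\<^sup>2)"
      using integrable_obs_measure[OF \<theta>s g2] integrable_distr_eq[OF Z_measurable[OF n] gm2] distr_Z[OF n] by simp
    show "expectation (\<lambda>\<omega>. g (Z n \<omega>)) = integral\<^sup>L (obs_measure \<theta>s) g"
      using integral_distr[OF Z_measurable[OF n] gm] distr_Z[OF n] by simp
    show "expectation (\<lambda>\<omega>. (g (Z n \<omega>))\<^sup>2) = (\<integral>z. (g z)\<^sup>2 \<partial>obs_measure \<theta>s)"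
      using integral_distr[OF Z_measurable[OF n] gm2] distr_Z[OF n] by simp
  qed
  then show ?thesis by (simp add: emp_mean_def)
qed

text \<open>From entries to vectors, and applied again from rows to matrices.\<close>

lemma emp_mean_whp_step:
  fixes F :: "'d obs \<Rightarrow> 'b::euclidean_space ^ 'n::finite"
  assumes meas: "\<And>k. (\<lambda>z. F z $ k) \<in> borel_measurable borel"
    and comp: "\<And>k \<epsilon>. 0 < \<epsilon> \<Longrightarrow> whp M (\<lambda>N \<omega>. norm (emp_mean N (\<lambda>n. Z n \<omega>) (\<lambda>z. F z $ k) - m $ k) < \<epsilon>)"
    and "0 < \<epsilon>"
  shows "whp M (\<lambda>N \<omega>. norm (emp_mean N (\<lambda>n. Z n \<omega>) F - m) < \<epsilon>)"
proof (rule whp_mono)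
  let ?e = "\<epsilon> / real CARD('n)"
  have e: "0 < ?e" using \<open>0 < \<epsilon>\<close> by simp
  show "whp M (\<lambda>N \<omega>. \<forall>k\<in>UNIV. norm (emp_mean N (\<lambda>n. Z n \<omega>) (\<lambda>z. F z $ k) - m $ k) < ?e)"
    by (intro whp_finite_ball comp e) auto
  have Fm: "F \<in> borel_measurable borel" by (rule borel_measurable_vecI[OF meas])
  show "{\<omega> \<in> space M. norm (emp_mean N (\<lambda>n. Z n \<omega>) F - m) < \<epsilon>} \<in> sets M" for N
    using emp_mean_measurable[OF Fm, of N] by measurable
  have "norm (emp_mean N zs F - m) < \<epsilon>"
    if "\<forall>k\<in>UNIV. norm (emp_mean N zs (\<lambda>z. F z $ k) - m $ k) < ?e" for N zs
  proof -
    have "norm (emp_mean N zs F - m) \<le> (\<Sum>k\<in>UNIV. norm ((emp_mean N zs F - m) $ k))"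
      by (rule norm_le_sum_norm_nth)
    also have "\<dots> < (\<Sum>k\<in>(UNIV :: 'n set). ?e)"
      by (rule sum_strict_mono) (use that in \<open>auto simp: emp_mean_nth\<close>)
    finally show ?thesis by simp
  qed
  then show "\<forall>\<^sub>F N in sequentially. \<forall>\<omega>\<in>space M.
      (\<forall>k\<in>UNIV. norm (emp_mean N (\<lambda>n. Z n \<omega>) (\<lambda>z. F z $ k) - m $ k) < ?e) \<longrightarrow>
      norm (emp_mean N (\<lambda>n. Z n \<omega>) F - m) < \<epsilon>" by simp
qed

lemma emp_mean_vec_whp:
  assumes F: "\<And>k. poly_bounded (\<lambda>z. F z $ k)" and m: "\<And>k. integral\<^sup>L (obs_measure \<theta>s) (\<lambda>z. F z $ k) = m $ k"
    and "0 < \<epsilon>"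
  shows "whp M (\<lambda>N \<omega>. norm (emp_mean N (\<lambda>n. Z n \<omega>) F - m) < \<epsilon>)"
  using emp_mean_whp[OF F] m by (intro emp_mean_whp_step poly_bounded_measurable F \<open>0 < \<epsilon>\<close>) simp

lemma emp_mean_mat_whp:
  assumes F: "\<And>k l. poly_bounded (\<lambda>z. F z $ k $ l)"
    and m: "\<And>k l. integral\<^sup>L (obs_measure \<theta>s) (\<lambda>z. F z $ k $ l) = m $ k $ l" and "0 < \<epsilon>"
  shows "whp M (\<lambda>N \<omega>. norm (emp_mean N (\<lambda>n. Z n \<omega>) F - m) < \<epsilon>)"
  by (intro emp_mean_whp_step borel_measurable_vecI poly_bounded_measurable F emp_mean_vec_whp m \<open>0 < \<epsilon>\<close>)

text \<open>A locally uniform law of large numbers. Moving from \<open>\<theta>s\<close> to \<open>\<theta>\<close> changes the empirical mean by at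
  most the empirical mean of the Lipschitz constants times the distance, and the former stays below
  its expectation plus 1.\<close>

lemma emp_mean_mat_locally_uniform:
  fixes F :: "'d obs \<Rightarrow> 'd param \<Rightarrow> real ^ 'm::finite ^ 'n::finite"
  assumes "\<theta>s \<in> K" and F: "\<And>k l. poly_lipschitz K (\<lambda>z \<theta>. F z \<theta> $ k $ l)"
    and m: "\<And>k l. integral\<^sup>L (obs_measure \<theta>s) (\<lambda>z. F z \<theta>s $ k $ l) = m $ k $ l" and "0 < \<eta>"
  shows "\<exists>\<rho>>0. \<exists>Q. whp M Q \<and> (\<forall>N \<omega>. Q N \<omega> \<longrightarrow>
    (\<forall>\<theta>\<in>K. norm (\<theta> - \<theta>s) \<le> \<rho> \<longrightarrow> norm (emp_mean N (\<lambda>n. Z n \<omega>) (\<lambda>z. F z \<theta>) - m) < \<eta>))"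
proof -
  have "\<forall>k l. \<exists>h. poly_bounded h \<and> (\<forall>z. \<forall>\<theta>\<in>K. \<bar>F z \<theta> $ k $ l\<bar> \<le> h z) \<and>
       (\<forall>z. \<forall>\<theta>\<in>K. \<forall>t\<in>K. \<bar>F z \<theta> $ k $ l - F z t $ k $ l\<bar> \<le> h z * norm (\<theta> - t))"
    using F unfolding poly_lipschitz_def by blast
  then obtain h where h: "\<And>k l. poly_bounded (h k l)" "\<And>k l z. \<bar>F z \<theta>s $ k $ l\<bar> \<le> h k l z"
    "\<And>k l z \<theta>. \<theta> \<in> K \<Longrightarrow> \<bar>F z \<theta> $ k $ l - F z \<theta>s $ k $ l\<bar> \<le> h k l z * norm (\<theta> - \<theta>s)"
    using \<open>\<theta>s \<in> K\<close> by metis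
  define L where "L z = (\<Sum>k\<in>UNIV. \<Sum>l\<in>UNIV. h k l z)" for z
  have L: "poly_bounded L" unfolding L_def by (intro poly_bounded_sum h)
  have lip: "norm (F z \<theta> - F z \<theta>s) \<le> L z * norm (\<theta> - \<theta>s)" if "\<theta> \<in> K" for z \<theta>
  proof -
    have "norm (F z \<theta> - F z \<theta>s) \<le> (\<Sum>k\<in>UNIV. \<Sum>l\<in>UNIV. norm ((F z \<theta> - F z \<theta>s) $ k $ l))"
      by (intro order_trans[OF norm_le_sum_norm_nth] sum_mono norm_le_sum_norm_nth)
    also have "\<dots> \<le> (\<Sum>k\<in>UNIV. \<Sum>l\<in>UNIV. h k l z * norm (\<theta> - \<theta>s))"
      by (intro sum_mono) (simp add: h(3)[OF that])
    finally show ?thesis by (simp add: L_def sum_distrib_right)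
  qed
  \<comment> \<open>A bound for the empirical mean of the Lipschitz constants; the absolute value only keeps E positive.\<close>
  define E where "E = \<bar>integral\<^sup>L (obs_measure \<theta>s) L\<bar> + 1"
  have E: "0 < E" unfolding E_def by linarith
  define Q where "Q N \<omega> \<longleftrightarrow> norm (emp_mean N (\<lambda>n. Z n \<omega>) (\<lambda>z. F z \<theta>s) - m) < \<eta> / 2 \<and>
    norm (emp_mean N (\<lambda>n. Z n \<omega>) L - integral\<^sup>L (obs_measure \<theta>s) L) < 1" for N \<omega>
  have Fp: "poly_bounded (\<lambda>z. F z \<theta>s $ k $ l)" for k l
    by (rule poly_bounded_mono[OF h(1)[of k l] poly_lipschitz_measurable[OF F \<open>\<theta>s \<in> K\<close>]])
      (rule order_trans[OF h(2) abs_ge_self])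
  have "whp M Q"
    unfolding Q_def using \<open>0 < \<eta>\<close> by (intro whp_conj emp_mean_mat_whp emp_mean_whp L Fp m) auto
  moreover have "norm (emp_mean N (\<lambda>n. Z n \<omega>) (\<lambda>z. F z \<theta>) - m) < \<eta>"
    if Q: "Q N \<omega>" and \<theta>: "\<theta> \<in> K" "norm (\<theta> - \<theta>s) \<le> \<eta> / (2 * E)" for N \<omega> \<theta>
  proof -
    let ?zs = "\<lambda>n. Z n \<omega>"
    have "norm (emp_mean N ?zs (\<lambda>z. F z \<theta>) - emp_mean N ?zs (\<lambda>z. F z \<theta>s)) \<le> emp_mean N ?zs (\<lambda>z. L z * norm (\<theta> - \<theta>s))"
      unfolding emp_mean_diff[symmetric] by (rule norm_emp_mean_le[OF lip[OF \<theta>(1)]])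
    also have "\<dots> = emp_mean N ?zs L * norm (\<theta> - \<theta>s)"
      by (simp add: emp_mean_def sum_distrib_right)
    also have "\<dots> \<le> E * (\<eta> / (2 * E))"
    proof (rule mult_mono)
      show "emp_mean N ?zs L \<le> E" using Q unfolding Q_def E_def real_norm_def by linarith
    qed (use \<theta> E in auto)
    also have "\<dots> = \<eta> / 2" using E by simp
    finally have "norm (emp_mean N ?zs (\<lambda>z. F z \<theta>) - emp_mean N ?zs (\<lambda>z. F z \<theta>s)) \<le> \<eta> / 2" .
    moreover have "norm (emp_mean N ?zs (\<lambda>z. F z \<theta>s) - m) < \<eta> / 2" using Q by (simp add: Q_def)
    ultimately show ?thesis
      using norm_triangle_ineq[of "emp_mean N ?zs (\<lambda>z. F z \<theta>) - emp_mean N ?zs (\<lambda>z. F z \<theta>s)" "emp_mean N ?zs (\<lambda>z. F z \<theta>s) - m"]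
      by simp
  qed
  moreover have "0 < \<eta> / (2 * E)" using E \<open>0 < \<eta>\<close> by simp
  ultimately show ?thesis by blast
qed

end

section \<open>Continuity and measurability of the iteration\<close>

lemma borel_measurable_SUP_continuous:
  fixes f :: "'w \<Rightarrow> 'a::euclidean_space \<Rightarrow> real"
  assumes meas: "\<And>t. t \<in> S \<Longrightarrow> (\<lambda>\<omega>. f \<omega> t) \<in> borel_measurable M"
    and cont: "\<And>\<omega>. \<omega> \<in> space M \<Longrightarrow> continuous_on S (f \<omega>)"
  shows "(\<lambda>\<omega>. SUP t\<in>S. ereal (f \<omega> t)) \<in> borel_measurable M"
proof -
  obtain D where D: "countable D" "D \<subseteq> S" "S \<subseteq> closure D"
    using separable[of S] by blast
  have eq: "(SUP t\<in>S. ereal (f \<omega> t)) = (SUP t\<in>D. ereal (f \<omega> t))" if \<omega>: "\<omega> \<in> space M" for \<omega>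
  proof (rule antisym)
    show "(SUP t\<in>D. ereal (f \<omega> t)) \<le> (SUP t\<in>S. ereal (f \<omega> t))" using D(2) by (rule SUP_subset_mono) simp
    show "(SUP t\<in>S. ereal (f \<omega> t)) \<le> (SUP t\<in>D. ereal (f \<omega> t))"
    proof (rule SUP_least)
      fix t assume t: "t \<in> S"
      then obtain d where d: "\<And>n. d n \<in> D" "d \<longlonglongrightarrow> t" using D(3) closure_sequential[of t D] by blast
      have "(\<lambda>n. f \<omega> (d n)) \<longlonglongrightarrow> f \<omega> t"
        using cont[OF \<omega>] t d D(2) unfolding continuous_on_sequentially comp_def by blast
      then have "(\<lambda>n. ereal (f \<omega> (d n))) \<longlonglongrightarrow> ereal (f \<omega> t)" by simp
      then show "ereal (f \<omega> t) \<le> (SUP t\<in>D. ereal (f \<omega> t))"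
        by (rule LIMSEQ_le_const2) (auto intro!: SUP_upper d(1))
    qed
  qed
  have "(\<lambda>\<omega>. SUP t\<in>D. ereal (f \<omega> t)) \<in> borel_measurable M"
    using D(1,2) meas by (intro borel_measurable_SUP) auto
  then show ?thesis by (simp add: eq cong: measurable_cong)
qed

lemma complete_info_obs_mult_vec:
  "complete_info_obs z \<theta> *v x = mk_param ((comp_resp 1 z \<theta> / var_of \<theta> * (snd z \<bullet> mean_of x)) *\<^sub>R snd z)
     (prob_of x / (prob_of \<theta> * (1 - prob_of \<theta>))) (var_of x / (2 * (var_of \<theta>)\<^sup>2))"
proof -
  have "(complete_info_obs z \<theta> *v x) $ k = mk_param ((comp_resp 1 z \<theta> / var_of \<theta> * (snd z \<bullet> mean_of x)) *\<^sub>R snd z)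
     (prob_of x / (prob_of \<theta> * (1 - prob_of \<theta>))) (var_of x / (2 * (var_of \<theta>)\<^sup>2)) $ k" for k
    by (cases k rule: param_index_cases)
      (simp_all add: matrix_vector_mult_def sum_param_index complete_info_obs_nth inner_vec_def mean_of_def
        power2_eq_square prob_of_def var_of_def sum_distrib_left sum_distrib_right sum_divide_distrib mult_ac)
  then show ?thesis by (simp add: vec_eq_iff)
qed

text \<open>The quadratic form of \<open>A\<^sub>N(\<theta>)\<close> is a sum of squares with positive weights, and \<open>\<theta>\<close> occurs in the
  weights only.\<close>

lemma A_mat_kernel:
  assumes "1 \<le> N" and \<theta>: "\<theta> \<in> param_space"
  shows "A_mat N zs \<theta> *v x = 0 \<longleftrightarrow>
    prob_of x = 0 \<and> var_of x = 0 \<and> (\<forall>n\<in>{1..N}. snd (zs n) \<bullet> mean_of x = 0)"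
proof -
  let ?v = "\<lambda>z. complete_info_obs z \<theta> *v x"
  have lin: "A_mat N zs \<theta> *v x = emp_mean N zs ?v"
    unfolding A_mat_eq_emp_mean[OF assms(1)]
    by (rule linear_emp_mean) (auto intro!: linearI simp: matrix_vector_mult_add_rdistrib scaleR_matrix_vector_assoc)
  have pos: "0 < prob_of \<theta> * (1 - prob_of \<theta>)" "0 < 2 * (var_of \<theta>)\<^sup>2" using param_spaceD[OF \<theta>] by simp_all
  have w: "0 < comp_resp 1 z \<theta> / var_of \<theta>" for z
    using comp_resp_bounds(1)[OF \<theta>, of 1 z] param_spaceD[OF \<theta>] by simp
  note nonneg = mult_nonneg_nonneg[OF less_imp_le[OF w] zero_le_power2]
    divide_nonneg_pos[OF zero_le_power2 pos(1)] divide_nonneg_pos[OF zero_le_power2 pos(2)]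
  have q: "x \<bullet> ?v z = comp_resp 1 z \<theta> / var_of \<theta> * (snd z \<bullet> mean_of x)\<^sup>2
      + ((prob_of x)\<^sup>2 / (prob_of \<theta> * (1 - prob_of \<theta>)) + (var_of x)\<^sup>2 / (2 * (var_of \<theta>)\<^sup>2))" for z
    by (simp add: complete_info_obs_mult_vec inner_param inner_commute power2_eq_square)
  show ?thesis
  proof
    assume "A_mat N zs \<theta> *v x = 0"
    then have "0 = x \<bullet> emp_mean N zs ?v" by (simp add: lin)
    also have "\<dots> = (\<Sum>n = 1..N. x \<bullet> ?v (zs n)) / real N"
      by (simp add: emp_mean_def inner_sum_right)
    finally have "(\<Sum>n = 1..N. x \<bullet> ?v (zs n)) = 0" using assms(1) by simp
    moreover have nn: "0 \<le> x \<bullet> ?v z" for z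
      unfolding q by (intro add_nonneg_nonneg nonneg)
    ultimately have z: "x \<bullet> ?v (zs n) = 0" if "n \<in> {1..N}" for n
      using sum_nonneg_eq_0_iff[of "{1..N}" "\<lambda>n. x \<bullet> ?v (zs n)"] that by auto
    have parts: "snd (zs n) \<bullet> mean_of x = 0 \<and> prob_of x = 0 \<and> var_of x = 0" if "n \<in> {1..N}" for n
    proof -
      have a: "0 \<le> comp_resp 1 (zs n) \<theta> / var_of \<theta> * (snd (zs n) \<bullet> mean_of x)\<^sup>2"
        "0 \<le> (prob_of x)\<^sup>2 / (prob_of \<theta> * (1 - prob_of \<theta>))" "0 \<le> (var_of x)\<^sup>2 / (2 * (var_of \<theta>)\<^sup>2)"
        by (rule nonneg)+
      have "comp_resp 1 (zs n) \<theta> / var_of \<theta> * (snd (zs n) \<bullet> mean_of x)\<^sup>2 = 0"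
        "(prob_of x)\<^sup>2 / (prob_of \<theta> * (1 - prob_of \<theta>)) = 0" "(var_of x)\<^sup>2 / (2 * (var_of \<theta>)\<^sup>2) = 0"
        using z[OF that] a unfolding q by linarith+
      then show ?thesis using w[of "zs n"] pos by auto
    qed
    show "prob_of x = 0 \<and> var_of x = 0 \<and> (\<forall>n\<in>{1..N}. snd (zs n) \<bullet> mean_of x = 0)"
      using parts assms(1) by auto
  next
    assume "prob_of x = 0 \<and> var_of x = 0 \<and> (\<forall>n\<in>{1..N}. snd (zs n) \<bullet> mean_of x = 0)"
    then have "?v (zs n) = 0" if "n \<in> {1..N}" for n
      using that by (simp add: complete_info_obs_mult_vec mk_param_def vec_eq_iff split: sum.split)
    then show "A_mat N zs \<theta> *v x = 0" by (simp add: lin emp_mean_def)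
  qed
qed

lemma invertible_A_mat_cong:
  assumes "1 \<le> N" "\<theta> \<in> param_space" "\<theta>' \<in> param_space"
  shows "invertible (A_mat N zs \<theta>) \<longleftrightarrow> invertible (A_mat N zs \<theta>')"
  using assms by (simp add: invertible_left_inverse matrix_left_invertible_ker A_mat_kernel)

text \<open>Both sides are the same choice from an unsatisfiable predicate.\<close>

lemma matrix_inv_singular:
  fixes A B :: "real ^ 'n::finite ^ 'n"
  assumes "\<not> invertible A" "\<not> invertible B"
  shows "matrix_inv A = matrix_inv B"
proof -
  have "(\<lambda>X. A ** X = mat 1 \<and> X ** A = mat 1) = (\<lambda>X. B ** X = mat 1 \<and> X ** B = mat 1)"
    using assms by (auto simp: invertible_def)
  then show ?thesis by (simp add: matrix_inv_def)
qed

lemma continuous_on_vecI: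
  fixes f :: "'a::topological_space \<Rightarrow> 'b::real_normed_vector ^ 'n::finite"
  assumes "\<And>i. continuous_on S (\<lambda>x. f x $ i)"
  shows "continuous_on S f"
  using continuous_on_vec_lambda[of S "\<lambda>i x. f x $ i"] assms by simp

lemma continuous_on_matrix_vector_mult:
  fixes A :: "'a::topological_space \<Rightarrow> real ^ 'n::finite ^ 'm::finite"
  assumes "continuous_on S A" "continuous_on S v"
  shows "continuous_on S (\<lambda>x. A x *v v x)"
  unfolding matrix_vector_mult_def by (intro continuous_intros assms)

lemma continuous_on_matrix_mult:
  fixes A B :: "'a::topological_space \<Rightarrow> real ^ 'n::finite ^ 'n"
  assumes "continuous_on S A" "continuous_on S B"
  shows "continuous_on S (\<lambda>x. A x ** B x)"
  unfolding matrix_matrix_mult_def by (intro continuous_intros assms)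

lemma borel_measurable_matrix_vector_mult:
  fixes A :: "'a \<Rightarrow> real ^ 'n::finite ^ 'm::finite"
  assumes [measurable]: "A \<in> borel_measurable M" "v \<in> borel_measurable M"
  shows "(\<lambda>x. A x *v v x) \<in> borel_measurable M"
  by (intro borel_measurable_vecI) (simp add: matrix_vector_mult_def)

lemma borel_measurable_matrix_mult:
  fixes A B :: "'a \<Rightarrow> real ^ 'n::finite ^ 'n"
  assumes [measurable]: "A \<in> borel_measurable M" "B \<in> borel_measurable M"
  shows "(\<lambda>x. A x ** B x) \<in> borel_measurable M"
  by (intro borel_measurable_vecI) (simp add: matrix_matrix_mult_def)

lemma poly_lipschitz_continuous_on:
  assumes "poly_lipschitz K g" shows "continuous_on K (g z)"
proof -
  obtain h where h: "\<And>z. 0 \<le> h z" "\<And>z \<theta> t. \<theta> \<in> K \<Longrightarrow> t \<in> K \<Longrightarrow> \<bar>g z \<theta> - g z t\<bar> \<le> h z * norm (\<theta> - t)"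
    using poly_lipschitzD[OF assms] by blast
  have "(h z)-lipschitz_on K (g z)"
    by (rule lipschitz_onI) (use h in \<open>auto simp: dist_norm\<close>)
  then show ?thesis by (rule lipschitz_on_continuous_on)
qed

lemma continuous_on_emp_mean:
  fixes F :: "'a \<Rightarrow> 'b::topological_space \<Rightarrow> 'c::real_normed_vector"
  assumes "\<And>z. continuous_on S (F z)"
  shows "continuous_on S (\<lambda>\<theta>. emp_mean N zs (\<lambda>z. F z \<theta>))"
  unfolding emp_mean_def by (intro continuous_intros assms)

lemma has_derivative_emp_mean_grad:
  assumes \<theta>: "\<theta> \<in> param_space"
  shows "((\<lambda>t. emp_mean N zs (\<lambda>z. grad (loglik z) t)) has_derivative
    (\<lambda>d. emp_mean N zs (\<lambda>z. hess (loglik z) \<theta>) *v d)) (at \<theta>)"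
proof -
  have "emp_mean N zs (\<lambda>z. hess (loglik z) \<theta>) *v d = emp_mean N zs (\<lambda>z. hess (loglik z) \<theta> *v d)" for d
    by (rule linear_emp_mean[of "\<lambda>A. A *v d"])
      (auto intro!: linearI simp: matrix_vector_mult_add_rdistrib scaleR_matrix_vector_assoc)
  then show ?thesis
    unfolding emp_mean_def
    by (simp only:) (intro has_derivative_scaleR_right has_derivative_sum has_derivative_grad_loglik_hess \<theta>)
qed

context param_ball
begin

lemma continuous_on_complete_info_obs: "continuous_on K (complete_info_obs z)"
  by (intro continuous_on_vecI poly_lipschitz_continuous_on poly_lipschitz_complete_info_obs)

lemma continuous_on_hess: "continuous_on K (hess (loglik z))"
proof (rule continuous_on_eq)
  show "continuous_on K (\<lambda>\<theta>. \<chi> k. hess_row z \<theta> k)"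
    by (intro continuous_on_vec_lambda continuous_on_vecI poly_lipschitz_continuous_on poly_lipschitz_hess_row)
qed (simp add: hess_loglik K_param_space)

lemma continuous_on_grad: "continuous_on K (grad (loglik z))"
  by (rule has_derivative_continuous_on[OF has_derivative_at_withinI[OF has_derivative_grad_loglik_hess[OF K_param_space]]])

text \<open>Either all the matrices are invertible or none is; in the second case the function is constant.\<close>

lemma continuous_on_inv_A_mat:
  assumes "1 \<le> N" shows "continuous_on K (\<lambda>\<theta>. matrix_inv (A_mat N zs \<theta>))"
proof (cases "\<exists>\<theta>\<in>K. invertible (A_mat N zs \<theta>)")
  case True
  then have inv: "invertible (A_mat N zs \<theta>)" if "\<theta> \<in> K" for \<theta>
    using invertible_A_mat_cong[OF assms K_param_space K_param_space] that by blast
  show ?thesis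
  proof (rule continuous_on_compose2[of "A_mat N zs ` K" matrix_inv])
    show "continuous_on (A_mat N zs ` K) matrix_inv"
      by (rule continuous_at_imp_continuous_on) (auto intro: isCont_matrix_inv inv)
    show "continuous_on K (A_mat N zs)"
      unfolding A_mat_eq_emp_mean[OF assms, abs_def]
      by (intro continuous_on_emp_mean continuous_on_complete_info_obs)
  qed simp
next
  case False
  show ?thesis
  proof (cases "K = {}")
    case False
    then obtain \<theta>0 where "\<theta>0 \<in> K" by blast
    show ?thesis
    proof (rule continuous_on_eq[OF continuous_on_const])
      show "matrix_inv (A_mat N zs \<theta>0) = matrix_inv (A_mat N zs \<theta>)" if "\<theta> \<in> K" for \<theta>
        using \<open>\<not> (\<exists>\<theta>\<in>K. invertible (A_mat N zs \<theta>))\<close> \<open>\<theta>0 \<in> K\<close> that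
        by (intro matrix_inv_singular) auto
    qed
  qed simp
qed

lemma continuous_on_T_map: "1 \<le> N \<Longrightarrow> continuous_on K (T_map N zs)"
  unfolding T_map_def
  by (intro continuous_intros continuous_on_matrix_vector_mult continuous_on_inv_A_mat continuous_on_emp_mean
      continuous_on_grad)

lemma continuous_on_T_prime: "1 \<le> N \<Longrightarrow> continuous_on K (T_prime N zs)"
  unfolding T_prime_def
  by (intro continuous_intros continuous_on_matrix_mult continuous_on_inv_A_mat continuous_on_emp_mean
      continuous_on_hess)

end

context mixture_sample
begin

lemma grad_measurable:
  assumes "\<theta> \<in> param_space" shows "(\<lambda>z. grad (loglik z) \<theta>) \<in> borel_measurable borel"
  unfolding grad_loglik[OF assms]
  by (intro borel_measurable_vecI poly_bounded_measurable,
      unfold vector_add_component vector_scaleR_component real_scaleR_def,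
      intro poly_bounded_intros poly_bounded_comp_resp poly_bounded_score assms insertI1 insertI2)

lemma hess_measurable:
  assumes "\<theta> \<in> param_space" shows "(\<lambda>z. hess (loglik z) \<theta>) \<in> borel_measurable borel"
  unfolding hess_loglik[OF assms]
  by (intro borel_measurable_vecI)
    (simp add: poly_bounded_measurable[OF poly_bounded_hess_row[OF assms]])

lemma A_inv_measurable:
  assumes "1 \<le> N" "\<theta> \<in> param_space"
  shows "(\<lambda>\<omega>. matrix_inv (A_mat N (\<lambda>n. Z n \<omega>) \<theta>)) \<in> borel_measurable M"
  unfolding A_mat_eq_emp_mean[OF assms(1)]
  by (intro measurable_compose[OF _ borel_measurable_matrix_inv] emp_mean_measurable borel_measurable_vecI
      poly_bounded_measurable poly_bounded_complete_info_obs assms)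

lemma T_map_measurable:
  assumes "1 \<le> N" "\<theta> \<in> param_space"
  shows "(\<lambda>\<omega>. T_map N (\<lambda>n. Z n \<omega>) \<theta>) \<in> borel_measurable M"
  unfolding T_map_def
  by (intro borel_measurable_add borel_measurable_const borel_measurable_matrix_vector_mult A_inv_measurable
      emp_mean_measurable grad_measurable assms)

lemma T_prime_measurable:
  assumes "1 \<le> N" "\<theta> \<in> param_space"
  shows "(\<lambda>\<omega>. T_prime N (\<lambda>n. Z n \<omega>) \<theta>) \<in> borel_measurable M"
  unfolding T_prime_def
  by (intro borel_measurable_add borel_measurable_const borel_measurable_matrix_mult A_inv_measurable
      emp_mean_measurable hess_measurable assms)

text \<open>For \<open>N = 0\<close> empirical means vanish and the events do not depend on the sample.\<close>

lemma sup_events_measurable: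
  assumes \<nu>: "is_norm \<nu>" and "param_ball K b" and SK: "S \<subseteq> K"
  shows "{\<omega> \<in> space M. (SUP \<theta>\<in>S. ereal (\<nu> (T_map N (\<lambda>n. Z n \<omega>) \<theta> - \<theta>s))) \<le> c} \<in> sets M"
    and "{\<omega> \<in> space M. (SUP \<theta>\<in>S. ereal (induced_norm \<nu> (T_prime N (\<lambda>n. Z n \<omega>) \<theta>))) < c} \<in> sets M"
proof -
  interpret K: param_ball K b by fact
  note \<nu>c = is_norm_continuous[OF \<nu>] and ic = continuous_on_induced_norm[OF \<nu>]
  have zero: "T_map 0 zs = T_map 0 zs'" "T_prime 0 zs = T_prime 0 zs'" for zs zs' :: "nat \<Rightarrow> 'd obs"
    by (simp_all add: fun_eq_iff T_map_def T_prime_def A_mat_def emp_mean_def cong: sum.case_cong)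
  have "(\<lambda>\<omega>. SUP \<theta>\<in>S. ereal (\<nu> (T_map N (\<lambda>n. Z n \<omega>) \<theta> - \<theta>s))) \<in> borel_measurable M"
  proof (cases "N = 0")
    case True
    have "(\<lambda>\<omega>. SUP \<theta>\<in>S. ereal (\<nu> (T_map N (\<lambda>n. Z n \<omega>) \<theta> - \<theta>s)))
        = (\<lambda>\<omega>. SUP \<theta>\<in>S. ereal (\<nu> (T_map N (\<lambda>n. undefined) \<theta> - \<theta>s)))"
      unfolding True by (rule ext) (subst zero(1)[of _ "\<lambda>n. undefined"], rule refl)
    then show ?thesis by simp
  next
    case False
    show ?thesis
    proof (rule borel_measurable_SUP_continuous)
      fix \<theta> assume "\<theta> \<in> S"
      then have "\<theta> \<in> param_space" using SK K.K_param_space by blast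
      then show "(\<lambda>\<omega>. \<nu> (T_map N (\<lambda>n. Z n \<omega>) \<theta> - \<theta>s)) \<in> borel_measurable M"
        using False by (intro measurable_compose[OF _ borel_measurable_continuous_onI[OF \<nu>c]] borel_measurable_diff
            borel_measurable_const T_map_measurable) auto
    next
      fix \<omega>
      show "continuous_on S (\<lambda>\<theta>. \<nu> (T_map N (\<lambda>n. Z n \<omega>) \<theta> - \<theta>s))"
        using False by (intro continuous_on_compose2[OF \<nu>c] continuous_on_diff continuous_on_const
            continuous_on_subset[OF K.continuous_on_T_map SK]) auto
    qed
  qed
  then show "{\<omega> \<in> space M. (SUP \<theta>\<in>S. ereal (\<nu> (T_map N (\<lambda>n. Z n \<omega>) \<theta> - \<theta>s))) \<le> c} \<in> sets M"
    by measurable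
  have "(\<lambda>\<omega>. SUP \<theta>\<in>S. ereal (induced_norm \<nu> (T_prime N (\<lambda>n. Z n \<omega>) \<theta>))) \<in> borel_measurable M"
  proof (cases "N = 0")
    case True
    have "(\<lambda>\<omega>. SUP \<theta>\<in>S. ereal (induced_norm \<nu> (T_prime N (\<lambda>n. Z n \<omega>) \<theta>)))
        = (\<lambda>\<omega>. SUP \<theta>\<in>S. ereal (induced_norm \<nu> (T_prime N (\<lambda>n. undefined) \<theta>)))"
      unfolding True by (rule ext) (subst zero(2)[of _ "\<lambda>n. undefined"], rule refl)
    then show ?thesis by simp
  next
    case False
    show ?thesis
    proof (rule borel_measurable_SUP_continuous)
      fix \<theta> assume "\<theta> \<in> S"
      then have "\<theta> \<in> param_space" using SK K.K_param_space by blast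
      then show "(\<lambda>\<omega>. induced_norm \<nu> (T_prime N (\<lambda>n. Z n \<omega>) \<theta>)) \<in> borel_measurable M"
        using False by (intro measurable_compose[OF _ borel_measurable_continuous_onI[OF ic]] T_prime_measurable) auto
    next
      fix \<omega>
      show "continuous_on S (\<lambda>\<theta>. induced_norm \<nu> (T_prime N (\<lambda>n. Z n \<omega>) \<theta>))"
        using False by (intro continuous_on_compose2[OF ic] continuous_on_subset[OF K.continuous_on_T_prime SK]) auto
    qed
  qed
  then show "{\<omega> \<in> space M. (SUP \<theta>\<in>S. ereal (induced_norm \<nu> (T_prime N (\<lambda>n. Z n \<omega>) \<theta>))) < c} \<in> sets M"
    by measurable
qed

end

section \<open>Invariance of the ball and contraction\<close>

lemma convex_norm_cball:
  assumes "is_norm \<nu>" shows "convex (norm_cball \<nu> c \<delta>)"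
proof (rule convexI)
  fix x y and u v :: real assume xy: "x \<in> norm_cball \<nu> c \<delta>" "y \<in> norm_cball \<nu> c \<delta>" and uv: "0 \<le> u" "0 \<le> v" "u + v = 1"
  have "u *\<^sub>R x + v *\<^sub>R y - c = u *\<^sub>R x + v *\<^sub>R y - (u + v) *\<^sub>R c" using uv(3) by simp
  also have "\<dots> = u *\<^sub>R (x - c) + v *\<^sub>R (y - c)" by (simp only: scaleR_add_left scaleR_diff_right) simp
  also have "\<nu> \<dots> \<le> \<nu> (u *\<^sub>R (x - c)) + \<nu> (v *\<^sub>R (y - c))" using assms unfolding is_norm_def by blast
  also have "\<dots> = u * \<nu> (x - c) + v * \<nu> (y - c)" using assms uv by (simp add: is_norm_def)
  also have "\<dots> \<le> u * \<delta> + v * \<delta>" using xy uv by (intro add_mono mult_left_mono) (auto simp: norm_cball_def)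
  also have "\<dots> = \<delta>" using uv(3) by (simp flip: distrib_right)
  finally show "u *\<^sub>R x + v *\<^sub>R y \<in> norm_cball \<nu> c \<delta>" by (simp add: norm_cball_def)
qed

text \<open>The inverse matrix is held fixed at the point \<open>\<theta>\<close> at which \<open>T\<^sub>N\<close> is evaluated, while the gradient moves
  from \<open>\<theta>s\<close> to \<open>\<theta>\<close>. The ball is mapped into itself because the step from the centre uses up only the
  part \<open>(1 - q) \<delta>\<close> that the contraction leaves free.\<close>

lemma T_map_contraction:
  fixes \<theta>s :: "'d::finite param"
  assumes P: "pd_matrix P" and "0 \<le> q" "0 \<le> \<delta>"
    and sub: "norm_cball (qnorm P) \<theta>s \<delta> \<subseteq> param_space"
    and \<theta>: "\<theta> \<in> norm_cball (qnorm P) \<theta>s \<delta>"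
    and contr: "\<And>t d. t \<in> norm_cball (qnorm P) \<theta>s \<delta> \<Longrightarrow>
      qnorm P ((mat 1 + matrix_inv (A_mat N zs \<theta>) ** emp_mean N zs (\<lambda>z. hess (loglik z) t)) *v d) \<le> q * qnorm P d"
    and start: "qnorm P (matrix_inv (A_mat N zs \<theta>) *v emp_mean N zs (\<lambda>z. grad (loglik z) \<theta>s)) \<le> (1 - q) * \<delta>"
  shows "qnorm P (T_map N zs \<theta> - \<theta>s) \<le> \<delta>"
proof -
  let ?\<nu> = "qnorm P" and ?S = "norm_cball (qnorm P) \<theta>s \<delta>" and ?X = "matrix_inv (A_mat N zs \<theta>)"
  have \<nu>: "is_norm ?\<nu>" by (rule is_norm_qnorm[OF P])
  let ?G = "\<lambda>t. emp_mean N zs (\<lambda>z. grad (loglik z) t)"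
  let ?H = "\<lambda>t. emp_mean N zs (\<lambda>z. hess (loglik z) t)"
  define \<Psi> where "\<Psi> t = t + ?X *v ?G t" for t
  have c: "\<theta>s \<in> ?S" using \<open>0 \<le> \<delta>\<close> by (simp add: norm_cball_def qnorm_def)
  have "?\<nu> (\<Psi> \<theta> - \<Psi> \<theta>s) \<le> q * ?\<nu> (\<theta> - \<theta>s)"
  proof (rule qnorm_mean_value[OF P convex_norm_cball[OF \<nu>] c \<theta> _ contr])
    fix t assume t: "t \<in> ?S"
    have "(\<Psi> has_derivative (\<lambda>d. d + ?X *v (?H t *v d))) (at t)"
      unfolding \<Psi>_def[abs_def]
      by (intro has_derivative_add has_derivative_ident
          bounded_linear.has_derivative[OF matrix_vector_mul_bounded_linear] has_derivative_emp_mean_grad)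
        (use t sub in blast)
    then show "(\<Psi> has_derivative (\<lambda>d. (mat 1 + ?X ** ?H t) *v d)) (at t)"
      by (simp add: matrix_vector_mult_add_rdistrib matrix_vector_mul_assoc)
  qed
  also have "\<dots> \<le> q * \<delta>" using \<theta> \<open>0 \<le> q\<close> by (intro mult_left_mono) (simp_all add: norm_cball_def)
  finally have 1: "?\<nu> (\<Psi> \<theta> - \<Psi> \<theta>s) \<le> q * \<delta>" .
  have "T_map N zs \<theta> - \<theta>s = (\<Psi> \<theta> - \<Psi> \<theta>s) + ?X *v ?G \<theta>s"
    by (simp add: \<Psi>_def T_map_def)
  then have "?\<nu> (T_map N zs \<theta> - \<theta>s) \<le> ?\<nu> (\<Psi> \<theta> - \<Psi> \<theta>s) + ?\<nu> (?X *v ?G \<theta>s)"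
    using \<nu> unfolding is_norm_def by simp
  also have "\<dots> \<le> q * \<delta> + (1 - q) * \<delta>" by (rule add_mono[OF 1 start])
  finally show ?thesis by (simp add: algebra_simps)
qed

theorem theorem3:
  fixes \<theta>s :: "'d::finite param"
    and M :: "'w measure"
    and Z :: "nat \<Rightarrow> 'w \<Rightarrow> 'd obs"
  assumes "\<theta>s \<in> param_space"
    and "invertible (fisher_info \<theta>s)"
    and "prob_space M"
    and "prob_space.indep_vars M (\<lambda>_. borel) Z {1..}"
    and "\<And>n. n \<ge> 1 \<Longrightarrow> distributed M lborel (Z n) (\<lambda>z. ennreal (mix_density \<theta>s z))"
  shows "\<exists>\<delta>>0. \<exists>\<nu> :: 'd param \<Rightarrow> real.
    is_norm \<nu> \<and> norm_cball \<nu> \<theta>s \<delta> \<subseteq> param_space \<and>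
    (\<lambda>N. measure M {\<omega> \<in> space M.
        (SUP \<theta>\<in>norm_cball \<nu> \<theta>s \<delta>. ereal (\<nu> (T_map N (\<lambda>n. Z n \<omega>) \<theta> - \<theta>s))) \<le> ereal \<delta>})
      \<longlonglongrightarrow> 1 \<and>
    (\<lambda>N. measure M {\<omega> \<in> space M.
        (SUP \<theta>\<in>norm_cball \<nu> \<theta>s \<delta>. ereal (induced_norm \<nu> (T_prime N (\<lambda>n. Z n \<omega>) \<theta>))) < 1})
      \<longlonglongrightarrow> 1"
proof -
  interpret prob_space M by (rule assms(3))
  interpret mixture_sample M \<theta>s Z
    using assms(1,4,5) by unfold_locales
  define J where "J = fisher_info \<theta>s"
  define P where "P = complete_info \<theta>s"
  have PJ: "P = J + missing_info \<theta>s"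
    using fisher_missing_complete[OF \<theta>s prob_space_obs] by (simp add: P_def J_def)
  have J: "pd_matrix J"
    unfolding J_def pd_matrix_def
    using fisher_info_psd[OF \<theta>s] psd_invertible_imp_pd[OF fisher_info_psd[OF \<theta>s] assms(2)] by blast
  have P: "pd_matrix P" unfolding PJ by (rule pd_matrix_add_psd[OF J missing_info_psd[OF \<theta>s]])
  define \<nu> where "\<nu> = qnorm P"
  have \<nu>: "is_norm \<nu>" unfolding \<nu>_def by (rule is_norm_qnorm[OF P])
  obtain \<kappa> where \<kappa>: "0 \<le> \<kappa>" "\<kappa> < 1" "\<And>x. \<nu> ((mat 1 + matrix_inv P ** (- J)) *v x) \<le> \<kappa> * \<nu> x"
    unfolding \<nu>_def PJ by (rule qnorm_contraction[OF J missing_info_psd[OF \<theta>s]]) blast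
  define q where "q = (\<kappa> + 1) / 2"
  have q: "\<kappa> < q" "0 \<le> q" "q < 1" using \<kappa> by (simp_all add: q_def)
  obtain \<eta> where \<eta>: "0 < \<eta>"
    "\<And>A. norm (A - P) < \<eta> \<Longrightarrow> norm (matrix_inv A) \<le> norm (matrix_inv P) + 1"
    "\<And>A H x. norm (A - P) < \<eta> \<Longrightarrow> norm (H - (- J)) < \<eta> \<Longrightarrow> \<nu> ((mat 1 + matrix_inv A ** H) *v x) \<le> q * \<nu> x"
    by (rule contraction_perturb[OF \<nu> pd_matrix_invertible[OF P] q(1) \<kappa>(3)]) blast
  obtain \<rho>0 where \<rho>0: "0 < \<rho>0" "param_ball (cball \<theta>s \<rho>0) \<rho>0" using param_ball_exists[OF \<theta>s] by blast
  define K where "K = cball \<theta>s \<rho>0"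
  interpret K: param_ball K \<rho>0 unfolding K_def by (rule \<rho>0(2))
  have \<theta>sK: "\<theta>s \<in> K" using \<rho>0(1) by (simp add: K_def)
  have hess_row: "hess (loglik z) \<theta> = (\<chi> k. hess_row z \<theta> k)" if "\<theta> \<in> K" for z \<theta>
    by (rule hess_loglik[OF K.K_param_space[OF that]])
  obtain \<rho>1 Q1 where \<rho>1: "0 < \<rho>1" "whp M Q1"
    and Q1: "\<And>N \<omega> \<theta>. Q1 N \<omega> \<Longrightarrow> \<theta> \<in> K \<Longrightarrow> norm (\<theta> - \<theta>s) \<le> \<rho>1 \<Longrightarrow>
      norm (emp_mean N (\<lambda>n. Z n \<omega>) (\<lambda>z. complete_info_obs z \<theta>) - P) < \<eta>"
    using emp_mean_mat_locally_uniform[OF \<theta>sK K.poly_lipschitz_complete_info_obs _ \<eta>(1), of P]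
    by (auto simp: P_def complete_info_def)
  obtain \<rho>2 Q2 where \<rho>2: "0 < \<rho>2" "whp M Q2"
    and Q2: "\<And>N \<omega> \<theta>. Q2 N \<omega> \<Longrightarrow> \<theta> \<in> K \<Longrightarrow> norm (\<theta> - \<theta>s) \<le> \<rho>2 \<Longrightarrow>
      norm (emp_mean N (\<lambda>n. Z n \<omega>) (\<lambda>z. \<chi> k. hess_row z \<theta> k) - (- J)) < \<eta>"
  proof -
    have "poly_lipschitz K (\<lambda>z \<theta>. (\<chi> k. hess_row z \<theta> k) $ k $ l)" for k l by (simp add: K.poly_lipschitz_hess_row)
    moreover have "(\<integral>z. (\<chi> k. hess_row z \<theta>s k) $ k $ l \<partial>obs_measure \<theta>s) = (- J) $ k $ l" for k l
      unfolding J_def vec_lambda_beta by (rule expected_hess[OF \<theta>s prob_space_obs])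
    ultimately show ?thesis
      using emp_mean_mat_locally_uniform[OF \<theta>sK _ _ \<eta>(1), of "\<lambda>z \<theta>. \<chi> k. hess_row z \<theta> k" "- J"] that by blast
  qed
  obtain c where c: "0 < c" "\<And>x. c * norm x \<le> \<nu> x" using is_norm_lower[OF \<nu>] by blast
  obtain C where C: "0 < C" "\<And>x. \<nu> x \<le> C * norm x" using is_norm_upper[OF \<nu>] by blast
  \<comment> \<open>The \<nu>-ball then lies in the three Euclidean balls.\<close>
  define \<delta> where "\<delta> = c * min \<rho>0 (min \<rho>1 \<rho>2)"
  have \<delta>: "0 < \<delta>" using c(1) \<rho>0(1) \<rho>1(1) \<rho>2(1) by (simp add: \<delta>_def)
  define S where "S = norm_cball \<nu> \<theta>s \<delta>"
  have S: "\<theta> \<in> K \<and> norm (\<theta> - \<theta>s) \<le> \<rho>1 \<and> norm (\<theta> - \<theta>s) \<le> \<rho>2" if "\<theta> \<in> S" for \<theta>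
  proof -
    have "c * norm (\<theta> - \<theta>s) \<le> c * min \<rho>0 (min \<rho>1 \<rho>2)"
      using c(2)[of "\<theta> - \<theta>s"] that by (simp add: S_def norm_cball_def \<delta>_def)
    then have "norm (\<theta> - \<theta>s) \<le> min \<rho>0 (min \<rho>1 \<rho>2)" using c(1) by (simp only: mult_le_cancel_left_pos)
    then show ?thesis by (simp add: K_def dist_norm norm_minus_commute)
  qed
  have SK: "S \<subseteq> K" using S by blast
  have SP: "S \<subseteq> param_space" using SK K.K_param_space by blast
  have near: "norm (A_mat N (\<lambda>n. Z n \<omega>) \<theta> - P) < \<eta>" "norm (emp_mean N (\<lambda>n. Z n \<omega>) (\<lambda>z. hess (loglik z) \<theta>) - (- J)) < \<eta>"
    if "Q1 N \<omega> \<and> Q2 N \<omega>" "1 \<le> N" "\<theta> \<in> S" for N \<omega> \<theta>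
    using Q1[of N \<omega> \<theta>] Q2[of N \<omega> \<theta>] S[OF that(3)] that(1)
    by (simp_all add: A_mat_eq_emp_mean[OF that(2)] hess_row)
  define b where "b = norm (matrix_inv P) + 1"
  have b: "0 < b" unfolding b_def by (simp add: add_nonneg_pos)
  \<comment> \<open>Makes the step from the centre at most (1 - q) \<delta> in \<nu>, given the bound b on the inverse matrices.\<close>
  define \<epsilon> where "\<epsilon> = (1 - q) * \<delta> / (C * b)"
  have \<epsilon>: "0 < \<epsilon>" using q(3) \<delta> C(1) b by (simp add: \<epsilon>_def)
  define Q3 where "Q3 N \<omega> \<longleftrightarrow> norm (emp_mean N (\<lambda>n. Z n \<omega>) (\<lambda>z. grad (loglik z) \<theta>s) - 0) < \<epsilon>" for N \<omega>
  have Q3: "whp M Q3"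
    unfolding Q3_def
  proof (rule emp_mean_vec_whp[OF _ _ \<epsilon>])
    show "poly_bounded (\<lambda>z. grad (loglik z) \<theta>s $ k)" for k
      unfolding grad_loglik[OF \<theta>s] vector_add_component vector_scaleR_component real_scaleR_def
      by (intro poly_bounded_intros poly_bounded_comp_resp poly_bounded_score \<theta>s insertI1 insertI2)
    show "(\<integral>z. grad (loglik z) \<theta>s $ k \<partial>obs_measure \<theta>s) = 0 $ k" for k
      by (simp add: expected_grad[OF \<theta>s prob_space_obs])
  qed
  have map_le: "\<nu> (T_map N (\<lambda>n. Z n \<omega>) \<theta> - \<theta>s) \<le> \<delta>"
    if Q: "Q1 N \<omega> \<and> Q2 N \<omega>" "Q3 N \<omega>" "1 \<le> N" and \<theta>: "\<theta> \<in> S" for N \<omega> \<theta>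
    unfolding \<nu>_def
  proof (rule T_map_contraction[OF P q(2) less_imp_le[OF \<delta>]])
    let ?X = "matrix_inv (A_mat N (\<lambda>n. Z n \<omega>) \<theta>)" and ?g = "emp_mean N (\<lambda>n. Z n \<omega>) (\<lambda>z. grad (loglik z) \<theta>s)"
    show "norm_cball (qnorm P) \<theta>s \<delta> \<subseteq> param_space" "\<theta> \<in> norm_cball (qnorm P) \<theta>s \<delta>"
      using SP \<theta> by (simp_all add: S_def \<nu>_def)
    show "qnorm P ((mat 1 + ?X ** emp_mean N (\<lambda>n. Z n \<omega>) (\<lambda>z. hess (loglik z) t)) *v d) \<le> q * qnorm P d"
      if "t \<in> norm_cball (qnorm P) \<theta>s \<delta>" for t d
      using \<eta>(3)[OF near(1)[OF Q(1,3) \<theta>] near(2)[OF Q(1,3), of t]] that by (simp add: S_def \<nu>_def)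
    have "\<nu> (?X *v ?g) \<le> C * (norm ?X * norm ?g)"
      using C order_trans[OF C(2) mult_left_mono[OF norm_matrix_vector_mult_le]] by simp
    also have "\<dots> \<le> C * (b * \<epsilon>)"
      using \<eta>(2)[OF near(1)[OF Q(1,3) \<theta>]] Q(2) C(1) b \<epsilon>
      by (intro mult_left_mono mult_mono) (auto simp: b_def Q3_def)
    also have "\<dots> = (1 - q) * \<delta>" using C(1) b by (simp add: \<epsilon>_def)
    finally show "qnorm P (?X *v ?g) \<le> (1 - q) * \<delta>" by (simp add: \<nu>_def)
  qed
  have prime_le: "induced_norm \<nu> (T_prime N (\<lambda>n. Z n \<omega>) \<theta>) \<le> q"
    if Q: "Q1 N \<omega> \<and> Q2 N \<omega>" "1 \<le> N" and \<theta>: "\<theta> \<in> S" for N \<omega> \<theta>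
    unfolding T_prime_def by (rule induced_norm_le[OF \<nu> \<eta>(3)[OF near[OF Q \<theta>]]])
  have Q12: "whp M (\<lambda>N \<omega>. Q1 N \<omega> \<and> Q2 N \<omega>)" by (rule whp_conj[OF \<rho>1(2) \<rho>2(2)])
  note meas = sup_events_measurable[OF \<nu> K.param_ball_axioms SK]
  have 1: "whp M (\<lambda>N \<omega>. (SUP \<theta>\<in>S. ereal (\<nu> (T_map N (\<lambda>n. Z n \<omega>) \<theta> - \<theta>s))) \<le> ereal \<delta>)"
  proof (rule whp_mono[OF whp_conj[OF Q12 Q3] meas(1)])
    show "\<forall>\<^sub>F N in sequentially. \<forall>\<omega>\<in>space M. (Q1 N \<omega> \<and> Q2 N \<omega>) \<and> Q3 N \<omega> \<longrightarrow>
        (SUP \<theta>\<in>S. ereal (\<nu> (T_map N (\<lambda>n. Z n \<omega>) \<theta> - \<theta>s))) \<le> ereal \<delta>"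
      using eventually_ge_at_top[of 1] by eventually_elim (auto intro!: SUP_least map_le)
  qed
  have 2: "whp M (\<lambda>N \<omega>. (SUP \<theta>\<in>S. ereal (induced_norm \<nu> (T_prime N (\<lambda>n. Z n \<omega>) \<theta>))) < 1)"
  proof (rule whp_mono[OF Q12 meas(2)])
    have lt: "(SUP \<theta>\<in>S. ereal (induced_norm \<nu> (T_prime N (\<lambda>n. Z n \<omega>) \<theta>))) < 1"
      if "Q1 N \<omega> \<and> Q2 N \<omega>" "1 \<le> N" for N \<omega>
    proof -
      have "(SUP \<theta>\<in>S. ereal (induced_norm \<nu> (T_prime N (\<lambda>n. Z n \<omega>) \<theta>))) \<le> ereal q"
        by (rule SUP_least) (simp add: prime_le[OF that])
      also have "\<dots> < 1" using q(3) by simp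
      finally show ?thesis .
    qed
    show "\<forall>\<^sub>F N in sequentially. \<forall>\<omega>\<in>space M. Q1 N \<omega> \<and> Q2 N \<omega> \<longrightarrow>
        (SUP \<theta>\<in>S. ereal (induced_norm \<nu> (T_prime N (\<lambda>n. Z n \<omega>) \<theta>))) < 1"
      using eventually_ge_at_top[of 1] by eventually_elim (use lt in blast)
  qed
  show ?thesis
    using \<delta> \<nu> SP 1 2 unfolding S_def whp_def by blast
qed

end
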